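(* Let $\psi\in L^2(\mathbb{R}^3,\mathbb{C}^4)$, $\psi\neq 0$, be a Dirac wavefunction localized in a bounded region. Then for every direction (unit vector) $e\in\mathbb{R}^3$ there exists a unique time $t_e=t_e(\psi)\in\mathbb{R}$ such that $$e(\psi_t)=e(\psi)+|t_e|-|t-t_e|\qquad\text{for all } t\in\mathbb{R}.$$ In particular, $e(\psi_{t_e})=e(\psi)+|t_e|$ is the maximum of $t\mapsto e(\psi_t)$.
   Context: Fix a mass $m>0$ and Dirac matrices $\alpha_1,\alpha_2,\alpha_3,\beta$: Hermitian $4\times4$ complex matrices with $\alpha_j\alpha_k+\alpha_k\alpha_j=2\delta_{jk}I_4$, $\alpha_k\beta+\beta\alpha_k=0$, $\beta^2=I_4$. The free Dirac operator is the self-adjoint operator $H=\sum_{k=1}^3\alpha_k\frac{1}{\mathrm{i}}\partial_k+\beta m$ in $L^2(\mathbb{R}^3,\mathbb{C}^4)$ (equivalently $H=\mathcal{F}^{-1}h\mathcal{F}$, where $\mathcal{F}$ is the unitary Fourier transform and $h$ denotes multiplication by $h(p)=\sum_k\alpha_kp_k+\beta m$). A Dirac wavefunction is an element of $L^2(\mathbb{R}^3,\mathbb{C}^4)$. For a Dirac wavefunction $\psi$ and $t\in\mathbb{R}$ put $\psi_t:=\mathrm{e}^{\mathrm{i}tH}\psi$. A region is a measurable subset $\Delta\subset\mathbb{R}^3$; $\psi$ is localized in $\Delta$ if $1_\Delta\psi=\psi$ a.e. For $x,y\in\mathbb{R}^3$, $xy:=\sum_kx_ky_k$. For a unit vector $e\in\mathbb{R}^3$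 and $\psi\neq0$, $e(\psi)\in[-\infty,\infty]$ denotes the maximal $\alpha\in[-\infty,\infty]$ such that $1_{\{x\in\mathbb{R}^3:\,xe\le\alpha\}}\psi=0$ a.e. *)

theory Defs
  imports "HOL-Analysis.Analysis"
begin

type_synonym wavefunction = "real ^ 3 \<Rightarrow> complex ^ 4"
type_synonym matrix4 = "complex ^ 4 ^ 4"

(* Elements of L^2(R^3, C^4) are represented by functions; equality in L^2 is equality
   almost everywhere. Representatives chosen below are determined only up to null sets, which
   support_edge does not see. *)

definition L2 :: "wavefunction set" where
  "L2 = {f. f \<in> borel_measurable lebesgue \<and> integrable lebesgue (\<lambda>x. (norm (f x))\<^sup>2)}"

definition localized_in :: "wavefunction \<Rightarrow> (real ^ 3) set \<Rightarrow> bool" where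
  "localized_in \<psi> \<Delta> \<longleftrightarrow> (AE x in lebesgue. indicator \<Delta> x *\<^sub>R \<psi> x = \<psi> x)"

(* The integral defining the unitary Fourier transform, cut off to the ball of radius R. *)
definition fourier_cutoff :: "real \<Rightarrow> wavefunction \<Rightarrow> wavefunction" where
  "fourier_cutoff R f p =
     ((2 * pi) powr (- 3 / 2)) *\<^sub>R (LINT x:cball 0 R|lebesgue. cis (- (p \<bullet> x)) *s f x)"

(* g = F f in L^2: the cut-off integrals converge to g in the L^2 norm. *)
definition is_fourier_transform :: "wavefunction \<Rightarrow> wavefunction \<Rightarrow> bool" where
  "is_fourier_transform f g \<longleftrightarrow> f \<in> L2 \<and> g \<in> L2 \<and>
     ((\<lambda>R. \<integral>\<^sup>+ p. ennreal ((norm (fourier_cutoff R f p - g p))\<^sup>2) \<partial>lebesgue) \<longlongrightarrow> 0) at_top"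

(* By Plancherel's theorem the representatives chosen here exist and are unique up to
   null sets for all arguments in L2. *)
definition fourier :: "wavefunction \<Rightarrow> wavefunction" where
  "fourier f = (SOME g. is_fourier_transform f g)"

definition inv_fourier :: "wavefunction \<Rightarrow> wavefunction" where
  "inv_fourier g = (SOME f. is_fourier_transform f g)"

definition hermitian :: "matrix4 \<Rightarrow> bool" where
  "hermitian A \<longleftrightarrow> map_matrix cnj (transpose A) = A"

definition dirac_matrices :: "(3 \<Rightarrow> matrix4) \<Rightarrow> matrix4 \<Rightarrow> bool" where
  "dirac_matrices \<alpha> \<beta> \<longleftrightarrow>
     (\<forall>k. hermitian (\<alpha> k)) \<and> hermitian \<beta> \<and>
     (\<forall>j k. \<alpha> j ** \<alpha> k + \<alpha> k ** \<alpha> j = mat (if j = k then 2 else 0)) \<and>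
     (\<forall>k. \<alpha> k ** \<beta> + \<beta> ** \<alpha> k = 0) \<and>
     \<beta> ** \<beta> = mat 1"

definition dirac_symbol :: "(3 \<Rightarrow> matrix4) \<Rightarrow> matrix4 \<Rightarrow> real \<Rightarrow> real ^ 3 \<Rightarrow> matrix4" where
  "dirac_symbol \<alpha> \<beta> m p = (\<Sum>k\<in>UNIV. (p $ k) *\<^sub>R \<alpha> k) + m *\<^sub>R \<beta>"

(* The type of matrices is not an instance of the normed algebra class on which the library
   defines exp (its class product is componentwise), hence the power series is spelled out. *)
definition mat_exp :: "matrix4 \<Rightarrow> matrix4" where
  "mat_exp A = (\<Sum>n. (1 / fact n) *\<^sub>R (((**) A ^^ n) (mat 1)))"

(* F^{-1} M F, where M acts by pointwise application of the matrix M p. The free Dirac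
   operator H is this operator for M = dirac_symbol, on its maximal domain. *)
definition fourier_multiplier :: "(real ^ 3 \<Rightarrow> matrix4) \<Rightarrow> wavefunction \<Rightarrow> wavefunction" where
  "fourier_multiplier M \<psi> = inv_fourier (\<lambda>p. M p *v fourier \<psi> p)"

(* exp(i t H) psi, by the functional calculus for H = F^{-1} h F, which is unitarily
   equivalent to multiplication by h = dirac_symbol: exp(i t H) = F^{-1} exp(i t h) F. *)
definition dirac_evolution ::
    "(3 \<Rightarrow> matrix4) \<Rightarrow> matrix4 \<Rightarrow> real \<Rightarrow> real \<Rightarrow> wavefunction \<Rightarrow> wavefunction" where
  "dirac_evolution \<alpha> \<beta> m t =
     fourier_multiplier
       (\<lambda>p. mat_exp (map_matrix ((*) (\<i> * complex_of_real t)) (dirac_symbol \<alpha> \<beta> m p)))"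

(* e(psi) as an extended real. For nonzero psi the maximum exists. *)
definition support_edge :: "real ^ 3 \<Rightarrow> wavefunction \<Rightarrow> ereal" where
  "support_edge e \<psi> =
     (GREATEST a. AE x in lebesgue. indicator {x. ereal (x \<bullet> e) \<le> a} x *\<^sub>R \<psi> x = 0)"

end

(* Write h(p) for the symbol and eps(p)^2 = p^2 + m^2 for its square. Restricted to a complex line p = q + z e with q
   orthogonal to e, the Fourier transform of a compactly supported wavefunction is an entire function of z. By
   Liouville's theorem the wavefunction vanishes for x e <= a if and only if, on every such line, exp(i a z) times
   this entire function is bounded in a lower half-plane. There eps has a holomorphic branch asymptotic to z, so the
   two spectral components of h evolve by factors comparable to exp(i t z) and exp(-i t z). Hence the set of
   admissible a at time t is { a. a + t is in A and a - t is in B } for two lower sets A and B not depending on t,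
   which gives e(psi_t) = min (sup A - t) (sup B + t). If, say, A were all of R, then on every line a spectral
   component would decay superexponentially and vanish by a Phragmen-Lindelof argument; unless psi = 0, this makes
   eps a meromorphic function on some line, contradicting its branch points.

   That psi_t exists with compact support follows from the Trotter product formula: the factors exp(i s alpha_k p_k)
   are translations by s along the k-th axis on the eigenspaces of alpha_k. Plancherel's theorem is obtained from
   Gaussian regularization. *)

theory Submission
  imports Defs "HOL-Probability.Probability" "HOL-Complex_Analysis.Complex_Analysis"
begin

section \<open>Continuity of translations\<close>

text \<open>\<open>fourier\<close> and \<open>inv_fourier\<close> are choices by
  \<open>SOME\<close>, so nothing can be computed from them directly. For compactly supported data
  the proof exhibits an explicit function whose absolutely convergent Fourier integral is the
  required product; uniqueness and injectivity of \<open>is_fourier_transform\<close> then force the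
  chosen values to agree with it almost everywhere. Compact support serves twice: it makes the
  transform on a complex line entire, and it bounds it on every horizontal strip. The second point
  leaves the depth of the half-plane free. It is taken as \<open>2 * M\<close> with \<open>M\<close>
  = \<open>transverse_mass m q\<close>, away from the branch points i M and -i M, although this
  depth grows with the transverse momentum \<open>q\<close>. The cut is crossed by writing exp(i t
  h) = cos(t eps) + i (sin(t eps) / eps) h. Both coefficients are even in eps, hence entire
  functions of eps^2, so the relation between the initial and the evolved transform continues from
  real to complex momenta before any branch is chosen.\<close>

lemma lborel_integrable_translate:
  fixes f :: "'a::euclidean_space \<Rightarrow> 'b::{banach, second_countable_topology}"
  assumes "integrable lborel f"
  shows "integrable lborel (\<lambda>x. f (x + v))"
proof -
  have "integrable (distr lborel borel ((+) v)) f"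
    using assms by (simp add: lborel_distr_plus)
  then have "integrable lborel (\<lambda>x. f (v + x))"
    by (rule integrable_distr[rotated]) simp
  then show ?thesis by (simp add: add.commute)
qed

lemma lborel_integral_translate:
  fixes f :: "'a::euclidean_space \<Rightarrow> 'b::{banach, second_countable_topology}"
  assumes [measurable]: "f \<in> borel_measurable borel"
  shows "(LINT x|lborel. f (x + v)) = (LINT x|lborel. f x)"
proof -
  have "(LINT x|lborel. f x) = (LINT x|distr lborel borel ((+) v). f x)"
    by (simp add: lborel_distr_plus)
  also have "\<dots> = (LINT x|lborel. f (v + x))"
    by (rule integral_distr) simp_all
  finally show ?thesis by (simp add: add.commute)
qed

definition translation_continuous ::
    "('a::euclidean_space \<Rightarrow> 'b::{banach, second_countable_topology}) \<Rightarrow> bool" where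
  "translation_continuous f \<longleftrightarrow>
     (\<forall>X. X \<longlonglongrightarrow> 0 \<longrightarrow> (\<lambda>n. LINT x|lborel. norm (f (x + X n) - f x)) \<longlonglongrightarrow> 0)"

text \<open>By translation invariance the errors |f - g| at \<open>x\<close> and at
  \<open>x + X n\<close> have the same integral, so the approximation is uniform in the shift:
  functions with continuous translation form a closed set in L1.\<close>

lemma translation_continuous_approx:
  fixes f :: "'a::euclidean_space \<Rightarrow> 'b::{banach, second_countable_topology}"
  assumes f: "integrable lborel f"
    and ex: "\<And>e. e > 0 \<Longrightarrow> \<exists>g. integrable lborel g \<and> translation_continuous g
                 \<and> (LINT x|lborel. norm (f x - g x)) < e"
  shows "translation_continuous f"
  unfolding translation_continuous_def
proof (intro allI impI LIMSEQ_I)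
  fix X :: "nat \<Rightarrow> 'a" and e :: real
  assume X: "X \<longlonglongrightarrow> 0" and e: "0 < e"
  obtain g where g: "integrable lborel g" "translation_continuous g"
      and fg: "(LINT x|lborel. norm (f x - g x)) < e / 3"
    using ex[of "e/3"] e by auto
  have "(\<lambda>n. LINT x|lborel. norm (g (x + X n) - g x)) \<longlonglongrightarrow> 0"
    using g X unfolding translation_continuous_def by auto
  from LIMSEQ_D[OF this, of "e/3"] e obtain N where
    N: "\<And>n. n \<ge> N \<Longrightarrow> norm (LINT x|lborel. norm (g (x + X n) - g x)) < e / 3" by auto
  have "norm ((LINT x|lborel. norm (f (x + X n) - f x)) - 0) < e" if "n \<ge> N" for n
  proof -
    have i1: "integrable lborel (\<lambda>x. norm (f x - g x))" using f g by auto
    have i2: "integrable lborel (\<lambda>x. norm (f (x + X n) - g (x + X n)))"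
      using lborel_integrable_translate[OF i1] .
    have i3: "integrable lborel (\<lambda>x. norm (g (x + X n) - g x))"
      by (intro integrable_norm Bochner_Integration.integrable_diff lborel_integrable_translate g)
    have m: "(\<lambda>x. norm (f x - g x)) \<in> borel_measurable borel"
      using borel_measurable_integrable[OF i1] by simp
    have "(LINT x|lborel. norm (f (x + X n) - f x))
        \<le> (LINT x|lborel. norm (f (x + X n) - g (x + X n)) + norm (g (x + X n) - g x) + norm (f x - g x))"
    proof (rule integral_mono)
      show "integrable lborel (\<lambda>x. norm (f (x + X n) - f x))"
        by (intro integrable_norm Bochner_Integration.integrable_diff lborel_integrable_translate f)
      show "integrable lborel (\<lambda>x. norm (f (x + X n) - g (x + X n)) + norm (g (x + X n) - g x) + norm (f x - g x))"
        using i1 i2 i3 by auto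
      fix x
      show "norm (f (x + X n) - f x) \<le> norm (f (x + X n) - g (x + X n)) + norm (g (x + X n) - g x) + norm (f x - g x)"
        using norm_triangle_ineq4[of "(f (x + X n) - g (x + X n)) + (g (x + X n) - g x)" "f x - g x"]
          norm_triangle_ineq[of "f (x + X n) - g (x + X n)" "g (x + X n) - g x"] by simp
    qed
    also have "\<dots> = 2 * (LINT x|lborel. norm (f x - g x)) + (LINT x|lborel. norm (g (x + X n) - g x))"
      using i1 i2 i3 lborel_integral_translate[OF m, of "X n"] by simp
    also have "\<dots> < e" using fg N[OF that] by auto
    finally show ?thesis by (simp add: integral_nonneg)
  qed
  then show "\<exists>no. \<forall>n\<ge>no. norm ((LINT x|lborel. norm (f (x + X n) - f x)) - 0) < e" by blast
qed

text \<open>|1_A - 1_B| = 1_A + 1_B - 2 1_A 1_B reduces the claim to the overlap of \<open>U\<close>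
  with its translate. For \<open>x\<close> in the open set \<open>U\<close> the shifted point
  eventually stays in \<open>U\<close>, which gives pointwise convergence of the overlap.\<close>

lemma translation_continuous_indicator_open:
  fixes U :: "'a::euclidean_space set" and c :: "'b::{banach, second_countable_topology}"
  assumes U: "open U" "emeasure lborel U < \<infinity>"
  shows "translation_continuous (\<lambda>x. indicator U x *\<^sub>R c)"
  unfolding translation_continuous_def
proof (intro allI impI)
  fix X :: "nat \<Rightarrow> 'a" assume X: "X \<longlonglongrightarrow> 0"
  have [measurable]: "U \<in> sets borel" using U by auto
  have iU: "integrable lborel (indicator U :: 'a \<Rightarrow> real)" using U by (intro integrable_real_indicator) auto
  have iUX: "integrable lborel (\<lambda>x. indicator U (x + X n) :: real)" for n
    using lborel_integrable_translate[OF iU] .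
  have iUU: "integrable lborel (\<lambda>x. indicator U x * indicator U (x + X n) :: real)" for n
    by (rule Bochner_Integration.integrable_bound[OF iU]) (auto simp: indicator_def)
  have eq: "(LINT x|lborel. norm (indicator U (x + X n) *\<^sub>R c - indicator U x *\<^sub>R c))
      = norm c * (2 * measure lborel U - 2 * (LINT x|lborel. indicator U x * indicator U (x + X n)))" for n
  proof -
    have "(LINT x|lborel. norm (indicator U (x + X n) *\<^sub>R c - indicator U x *\<^sub>R c))
       = (LINT x|lborel. norm c * (indicator U (x + X n) + indicator U x - 2 * (indicator U x * indicator U (x + X n))))"
      by (intro Bochner_Integration.integral_cong refl) (auto simp: indicator_def)
    also have "\<dots> = norm c * ((LINT x|lborel. indicator U (x + X n)) + (LINT x|lborel. indicator U x)
         - 2 * (LINT x|lborel. indicator U x * indicator U (x + X n)))"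
      using iU iUX[of n] iUU[of n] by simp
    also have "(LINT x|lborel. indicator U (x + X n) :: real) = (LINT x|lborel. indicator U x)"
      by (rule lborel_integral_translate) measurable
    finally show ?thesis by simp
  qed
  have "(\<lambda>n. LINT x|lborel. indicator U x * indicator U (x + X n)) \<longlonglongrightarrow> (LINT x|lborel. indicator U x :: real)"
  proof (rule integral_dominated_convergence[OF _ _ iU])
    show "AE x in lborel. (\<lambda>n. indicator U x * indicator U (x + X n)) \<longlonglongrightarrow> (indicator U x :: real)"
    proof (intro AE_I2)
      fix x
      show "(\<lambda>n. indicator U x * indicator U (x + X n)) \<longlonglongrightarrow> (indicator U x :: real)"
      proof (cases "x \<in> U")
        case True
        have "(\<lambda>n. x + X n) \<longlonglongrightarrow> x + 0" by (intro tendsto_intros X)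
        then have "eventually (\<lambda>n. x + X n \<in> U) sequentially"
          using True U by (auto dest: topological_tendstoD)
        then show ?thesis using True
          by (intro tendsto_eventually) (auto elim!: eventually_mono)
      qed simp
    qed
  qed (auto simp: indicator_def)
  then have "(\<lambda>n. norm c * (2 * measure lborel U - 2 * (LINT x|lborel. indicator U x * indicator U (x + X n))))
      \<longlonglongrightarrow> norm c * (2 * measure lborel U - 2 * (LINT x|lborel. indicator U x))"
    by (intro tendsto_intros)
  then show "(\<lambda>n. LINT x|lborel. norm (indicator U (x + X n) *\<^sub>R c - indicator U x *\<^sub>R c)) \<longlonglongrightarrow> 0"
    unfolding eq by simp
qed

text \<open>Density argument along \<open>integrable_induct\<close>: outer regularity replaces a
  measurable set of finite measure by an open one, and \<open>translation_continuous_approx\<close>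
  passes to limits.\<close>

lemma translation_continuous_integrable:
  fixes f :: "'a::euclidean_space \<Rightarrow> 'b::{banach, second_countable_topology}"
  assumes "integrable lborel f"
  shows "translation_continuous f"
  using assms
proof (induction rule: integrable_induct)
  case (base A c)
  note [measurable] = base(1)
  have i: "integrable lborel (\<lambda>x. indicator A x *\<^sub>R c)" using base by auto
  show ?case
  proof (rule translation_continuous_approx[OF i])
    fix e :: real assume e: "e > 0"
    define d where "d = e / (norm c + 1)"
    have c: "norm c + 1 > 0" by (simp add: add_nonneg_pos)
    have d: "d > 0" using e c by (simp add: d_def)
    have "d * (norm c + 1) = e" using c by (simp add: d_def)
    then have "norm c * d + d = e" by (simp add: algebra_simps)
    with d have d: "d > 0" "norm c * d < e" by auto
    obtain U where U: "open U" "A \<subseteq> U" "emeasure lborel (U - A) < d"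
      using outer_regular_lborel[of A d] base d by auto
    have [measurable]: "U \<in> sets borel" using U by auto
    have "emeasure lborel U \<le> emeasure lborel A + emeasure lborel (U - A)"
      using emeasure_subadditive[of A lborel "U - A"] U base by (auto simp: Un_absorb1)
    also have "\<dots> < \<infinity>" using base U by (auto simp: less_top[symmetric])
    finally have fU: "emeasure lborel U < \<infinity>" .
    have "(LINT x|lborel. norm (indicator A x *\<^sub>R c - indicator U x *\<^sub>R c)) =
      (LINT x|lborel. norm c * indicator (U - A) x)"
      using U by (intro Bochner_Integration.integral_cong) (auto simp: indicator_def)
    also have "\<dots> = norm c * measure lborel (U - A)" by simp
    also have "\<dots> \<le> norm c * d"
      using U d by (intro mult_left_mono)
        (auto simp: measure_def intro!: enn2real_leI)
    also have "\<dots> < e" by (rule d)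
    finally show "\<exists>g. integrable lborel g \<and> translation_continuous g
         \<and> (LINT x|lborel. norm (indicator A x *\<^sub>R c - g x)) < e"
      using translation_continuous_indicator_open[OF U(1) fU, of c] fU
      by (intro exI[of _ "\<lambda>x. indicator U x *\<^sub>R c"]) auto
  qed
next
  case (add f g)
  show ?case unfolding translation_continuous_def
  proof (intro allI impI)
    fix X :: "nat \<Rightarrow> 'a" assume X: "X \<longlonglongrightarrow> 0"
    have l: "(\<lambda>n. (LINT x|lborel. norm (f (x + X n) - f x)) + (LINT x|lborel. norm (g (x + X n) - g x))) \<longlonglongrightarrow> 0 + 0"
      using add X unfolding translation_continuous_def by (intro tendsto_add) auto
    have i: "integrable lborel (\<lambda>x. norm (f (x + X n) - f x))" "integrable lborel (\<lambda>x. norm (g (x + X n) - g x))" for n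
      by (intro integrable_norm Bochner_Integration.integrable_diff lborel_integrable_translate add)+
    show "(\<lambda>n. LINT x|lborel. norm (f (x + X n) + g (x + X n) - (f x + g x))) \<longlonglongrightarrow> 0"
    proof (rule tendsto_sandwich[OF _ _ tendsto_const l[simplified]])
      show "\<forall>\<^sub>F n in sequentially. (LINT x|lborel. norm (f (x + X n) + g (x + X n) - (f x + g x)))
         \<le> (LINT x|lborel. norm (f (x + X n) - f x)) + (LINT x|lborel. norm (g (x + X n) - g x))"
      proof (intro always_eventually allI)
        fix n
        have "(LINT x|lborel. norm (f (x + X n) + g (x + X n) - (f x + g x)))
          \<le> (LINT x|lborel. norm (f (x + X n) - f x) + norm (g (x + X n) - g x))"
          by (intro integral_mono Bochner_Integration.integrable_add i integrable_norm
              Bochner_Integration.integrable_diff lborel_integrable_translate add norm_diff_triangle_ineq)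
        then show "(LINT x|lborel. norm (f (x + X n) + g (x + X n) - (f x + g x)))
         \<le> (LINT x|lborel. norm (f (x + X n) - f x)) + (LINT x|lborel. norm (g (x + X n) - g x))"
          using i by simp
      qed
    qed (auto intro!: always_eventually integral_nonneg)
  qed
next
  case (lim f s)
  show ?case
  proof (rule translation_continuous_approx[OF lim(4)])
    fix e :: real assume e: "e > 0"
    have "(\<lambda>i. LINT x|lborel. norm (f x - s i x)) \<longlonglongrightarrow> (LINT x|lborel. norm (f x - f x))"
    proof (rule integral_dominated_convergence[where w="\<lambda>x. 3 * norm (f x)"])
      show "AE x in lborel. (\<lambda>i. norm (f x - s i x)) \<longlonglongrightarrow> norm (f x - f x)"
        using lim by (intro AE_I2 tendsto_intros) auto
      show "AE x in lborel. norm (norm (f x - s i x)) \<le> 3 * norm (f x)" for i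
      proof (intro AE_I2)
        fix x
        have "norm (f x - s i x) \<le> norm (f x) + norm (s i x)" by (rule norm_triangle_ineq4)
        then show "norm (norm (f x - s i x)) \<le> 3 * norm (f x)" using lim(3)[of x i] by simp
      qed
    qed (use lim in auto)
    from LIMSEQ_D[OF this e] obtain i where "(LINT x|lborel. norm (f x - s i x)) < e" by auto
    then show "\<exists>g. integrable lborel g \<and> translation_continuous g \<and> (LINT x|lborel. norm (f x - g x)) < e"
      using lim by blast
  qed
qed

text \<open>The map \<open>u \<mapsto> |u| u\<close> sends \<open>L2\<close> to \<open>L1\<close>, and its inverse is Hoelder continuous of exponent \<open>1/2\<close>;
  this reduces continuity of translations in \<open>L2\<close> to \<open>L1\<close>.\<close>

lemma norm_diff_square_le_norm_scaled_diff:
  fixes u v :: "'a::real_inner"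
  shows "(norm (u - v))\<^sup>2 \<le> 2 * norm (norm u *\<^sub>R u - norm v *\<^sub>R v)"
proof (cases "u = v")
  case False
  define a b where "a = norm u" and "b = norm v"
  have ab: "a \<ge> 0" "b \<ge> 0" "u \<bullet> u = a\<^sup>2" "v \<bullet> v = b\<^sup>2" by (auto simp: a_def b_def power2_norm_eq_inner)
  have n: "(norm (u - v))\<^sup>2 = a\<^sup>2 + b\<^sup>2 - 2 * (u \<bullet> v)"
    by (simp add: power2_norm_eq_inner inner_diff_left inner_diff_right inner_commute[of v u] ab(3,4))
  \<comment> \<open>Strong monotonicity of the map: its increment paired with \<open>u - v\<close>
    is at least (a + b) / 2 times |u - v|^2, and a + b \<ge> |u - v|.\<close>
  have "2 * ((a *\<^sub>R u - b *\<^sub>R v) \<bullet> (u - v)) - (a + b) * (norm (u - v))\<^sup>2 = (a - b) * (a\<^sup>2 - b\<^sup>2)"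
    unfolding n by (simp add: inner_diff_left inner_diff_right inner_commute[of v u] ab(3,4)
        algebra_simps power2_eq_square)
  also have "\<dots> = (a - b)\<^sup>2 * (a + b)" by (simp add: power2_eq_square algebra_simps)
  also have "\<dots> \<ge> 0" using ab by simp
  finally have "(a + b) * (norm (u - v))\<^sup>2 \<le> 2 * ((a *\<^sub>R u - b *\<^sub>R v) \<bullet> (u - v))" by simp
  also have "\<dots> \<le> 2 * (norm (a *\<^sub>R u - b *\<^sub>R v) * norm (u - v))"
    by (intro mult_left_mono norm_cauchy_schwarz) auto
  finally have 1: "(a + b) * (norm (u - v))\<^sup>2 \<le> 2 * (norm (a *\<^sub>R u - b *\<^sub>R v) * norm (u - v))" .
  have "norm (u - v) * (norm (u - v))\<^sup>2 \<le> (a + b) * (norm (u - v))\<^sup>2"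
    unfolding a_def b_def by (intro mult_right_mono norm_triangle_ineq4) auto
  with 1 have "norm (u - v) * (norm (u - v))\<^sup>2 \<le> norm (u - v) * (2 * norm (a *\<^sub>R u - b *\<^sub>R v))"
    by (simp add: algebra_simps)
  then show ?thesis using False by (simp add: a_def b_def)
qed simp

lemma translation_continuous_L2:
  fixes f :: "'a::euclidean_space \<Rightarrow> 'b::euclidean_space"
  assumes [measurable]: "f \<in> borel_measurable borel"
    and f: "integrable lborel (\<lambda>x. (norm (f x))\<^sup>2)" and X: "X \<longlonglongrightarrow> 0"
  shows "(\<lambda>n. LINT x|lborel. (norm (f (x + X n) - f x))\<^sup>2) \<longlonglongrightarrow> 0"
proof -
  define F where "F x = norm (f x) *\<^sub>R f x" for x
  have [measurable]: "F \<in> borel_measurable borel" unfolding F_def by measurable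
  have F: "integrable lborel F"
    by (rule Bochner_Integration.integrable_bound[OF f]) (auto simp: F_def power2_eq_square)
  have iF: "integrable lborel (\<lambda>x. norm (F (x + X n) - F x))" for n
    by (intro integrable_norm Bochner_Integration.integrable_diff lborel_integrable_translate F)
  have l: "(\<lambda>n. 2 * (LINT x|lborel. norm (F (x + X n) - F x))) \<longlonglongrightarrow> 0"
    using translation_continuous_integrable[OF F] X unfolding translation_continuous_def
    by (intro tendsto_mult_right_zero) auto
  show ?thesis
  proof (rule tendsto_sandwich[OF _ _ tendsto_const l])
    show "\<forall>\<^sub>F n in sequentially. (LINT x|lborel. (norm (f (x + X n) - f x))\<^sup>2)
        \<le> 2 * (LINT x|lborel. norm (F (x + X n) - F x))"
    proof (intro always_eventually allI)
      fix n
      have "(LINT x|lborel. (norm (f (x + X n) - f x))\<^sup>2) \<le> (LINT x|lborel. 2 * norm (F (x + X n) - F x))"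
      proof (rule integral_mono)
        show "integrable lborel (\<lambda>x. 2 * norm (F (x + X n) - F x))" using iF by auto
        then show "integrable lborel (\<lambda>x. (norm (f (x + X n) - f x))\<^sup>2)"
          by (rule Bochner_Integration.integrable_bound)
             (auto simp: F_def intro!: AE_I2 norm_diff_square_le_norm_scaled_diff)
      qed (auto simp: F_def norm_diff_square_le_norm_scaled_diff)
      then show "(LINT x|lborel. (norm (f (x + X n) - f x))\<^sup>2) \<le> 2 * (LINT x|lborel. norm (F (x + X n) - F x))"
        by simp
    qed
  qed (auto intro!: always_eventually integral_nonneg)
qed

section \<open>Plancherel's theorem\<close>

lemma lborel_integral_scale:
  fixes f :: "'a::euclidean_space \<Rightarrow> 'b::{banach, second_countable_topology}"
  assumes [measurable]: "f \<in> borel_measurable borel" and c: "c \<noteq> 0"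
  shows "(LINT x|lborel. f (t + c *\<^sub>R x)) = (1 / \<bar>c\<bar> ^ DIM('a)) *\<^sub>R (LINT x|lborel. f x)"
proof -
  have "(LINT x|lborel. f x)
      = (LINT x|density (distr lborel borel (\<lambda>x. t + c *\<^sub>R x)) (\<lambda>_. \<bar>c\<bar> ^ DIM('a)). f x)"
    by (subst lborel_affine[OF c, of t]) (rule refl)
  also have "\<dots> = (LINT x|distr lborel borel (\<lambda>x. t + c *\<^sub>R x). (\<bar>c\<bar> ^ DIM('a)) *\<^sub>R f x)"
    by (rule integral_density) auto
  also have "\<dots> = (\<bar>c\<bar> ^ DIM('a)) *\<^sub>R (LINT x|lborel. f (t + c *\<^sub>R x))"
    by (subst integral_distr) auto
  finally show ?thesis using c by simp
qed

lemma lborel_integrable_scale: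
  fixes f :: "'a::euclidean_space \<Rightarrow> 'b::{banach, second_countable_topology}"
  assumes f: "integrable lborel f" and c: "c \<noteq> 0"
  shows "integrable lborel (\<lambda>x. f (t + c *\<^sub>R x))"
proof -
  have [measurable]: "f \<in> borel_measurable borel" using borel_measurable_integrable[OF f] by simp
  have "integrable (density (distr lborel borel (\<lambda>x. t + c *\<^sub>R x)) (\<lambda>_. \<bar>c\<bar> ^ DIM('a))) f"
    using f by (subst (asm) lborel_affine[OF c, of t])
  then have "integrable (distr lborel borel (\<lambda>x. t + c *\<^sub>R x)) (\<lambda>x. (\<bar>c\<bar> ^ DIM('a)) *\<^sub>R f x)"
    by (subst (asm) integrable_density) auto
  then have "integrable lborel (\<lambda>x. (\<bar>c\<bar> ^ DIM('a)) *\<^sub>R f (t + c *\<^sub>R x))"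
    by (subst (asm) integrable_distr_eq) auto
  from integrable_scaleR_right[OF this, of "1 / \<bar>c\<bar> ^ DIM('a)"]
  show ?thesis using c by (simp only: scaleR_scaleR) simp
qed

lemma lborel_integrable_reflect:
  fixes f :: "'a::euclidean_space \<Rightarrow> 'b::{banach, second_countable_topology}"
  assumes "integrable lborel f"
  shows "integrable lborel (\<lambda>z. f (x - z))"
  using lborel_integrable_scale[OF assms, of "-1" x] by simp

lemma lborel_integral_reflect:
  fixes f :: "'a::euclidean_space \<Rightarrow> 'b::{banach, second_countable_topology}"
  assumes "f \<in> borel_measurable borel"
  shows "(LINT z|lborel. f (x - z)) = (LINT z|lborel. f z)"
  using lborel_integral_scale[OF assms, of "-1" x] by simp

lemma lborel_integral_prod_Basis:
  fixes f :: "'a::euclidean_space \<Rightarrow> real \<Rightarrow> complex"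
  assumes f: "\<And>b. b \<in> Basis \<Longrightarrow> integrable lborel (f b)"
  shows "integrable lborel (\<lambda>x::'a. \<Prod>b\<in>Basis. f b (x \<bullet> b))" (is ?I)
    and "(LINT x|lborel. (\<Prod>b\<in>Basis. f b (x \<bullet> b))) = (\<Prod>b\<in>Basis. LINT x|lborel. f b x)" (is ?E)
proof -
  interpret product_sigma_finite "\<lambda>_::'a. lborel :: real measure" ..
  have m[measurable]: "b \<in> Basis \<Longrightarrow> f b \<in> borel_measurable borel" for b
    using borel_measurable_integrable[OF f] by simp
  have [simp]: "(\<Sum>b'\<in>Basis. g b' *\<^sub>R b') \<bullet> b = g b" if "b \<in> Basis" for g and b :: 'a
    using that by (simp add: inner_sum_left inner_Basis if_distrib cong: if_cong)
  have T[measurable]: "(\<lambda>g. \<Sum>b\<in>Basis. g b *\<^sub>R b) \<in> (\<Pi>\<^sub>M b\<in>Basis. lborel) \<rightarrow>\<^sub>M (borel :: 'a measure)"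
    by measurable
  have P[measurable]: "(\<lambda>x::'a. \<Prod>b\<in>Basis. f b (x \<bullet> b)) \<in> borel_measurable borel"
    by (intro borel_measurable_prod) (auto intro: measurable_compose[OF _ m])
  have i: "integrable (\<Pi>\<^sub>M b\<in>Basis. lborel) (\<lambda>g. \<Prod>b\<in>Basis. f b (g b))"
    by (rule product_integrable_prod) (auto intro: f)
  show ?I
    by (subst lborel_eq, subst integrable_distr_eq[OF T P]) (use i in simp)
  show ?E
    by (subst lborel_eq, subst integral_distr[OF T P]) (use product_integral_prod[OF finite_Basis f] in simp)
qed

section \<open>Gaussians and their Fourier transforms\<close>

definition gauss :: "'a::euclidean_space \<Rightarrow> real" where
  "gauss x = exp (- (x \<bullet> x) / 2)"

lemma gauss_pos: "gauss x > 0" and gauss_le_1: "gauss x \<le> 1" and gauss_0 [simp]: "gauss 0 = 1"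
  by (simp_all add: gauss_def)

lemma borel_measurable_gauss [measurable]: "gauss \<in> borel_measurable borel"
  unfolding gauss_def[abs_def] by measurable

text \<open>Up to the factor \<open>sqrt (2 * pi)\<close> this is the characteristic function of the
  standard normal distribution.\<close>

lemma gauss_fourier_real:
  fixes t :: real
  shows "integrable lborel (\<lambda>x. cis (- (t * x)) * of_real (gauss x))" (is ?I)
    and "(LINT x|lborel. cis (- (t * x)) * of_real (gauss x)) = of_real (sqrt (2 * pi) * gauss t)" (is ?E)
proof -
  have g: "gauss x = sqrt (2 * pi) * std_normal_density x" for x :: real
    by (simp add: gauss_def std_normal_density_def power2_eq_square)
  interpret prob_space std_normal_distribution
    using real_dist_normal_dist by (simp add: real_distribution_def)
  have d: "std_normal_density x *\<^sub>R iexp (- t * x) = cis (- (t * x)) * of_real (std_normal_density x)" for x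
    by (simp add: scaleR_conv_of_real cis_conv_exp mult.commute)
  note d' = d[simplified]
  have "integrable std_normal_distribution (\<lambda>x. iexp (- t * x))"
    by (rule integrable_iexp) auto
  then have i: "integrable lborel (\<lambda>x. cis (- (t * x)) * of_real (std_normal_density x))"
    by (subst (asm) integrable_density) (auto simp: d')
  have "char std_normal_distribution (- t) = (LINT x|lborel. cis (- (t * x)) * of_real (std_normal_density x))"
    unfolding char_def by (subst integral_density) (auto simp: d')
  then have e: "(LINT x|lborel. cis (- (t * x)) * of_real (std_normal_density x)) = of_real (gauss t)"
    unfolding char_std_normal_distribution by (simp add: gauss_def power2_eq_square)
  have eq: "(\<lambda>x. cis (- (t * x)) * of_real (gauss x))
      = (\<lambda>x. of_real (sqrt (2 * pi)) * (cis (- (t * x)) * of_real (std_normal_density x)))"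
    by (auto simp: g)
  show ?I unfolding eq using i by (rule integrable_mult_right)
  show ?E unfolding eq integral_mult_right_zero e by simp
qed

lemma gauss_prod: "gauss x = (\<Prod>b\<in>Basis. gauss (x \<bullet> b))" for x :: "'a::euclidean_space"
  unfolding gauss_def by (subst euclidean_inner[of x x]) (simp add: exp_sum[symmetric] sum_divide_distrib sum_negf)

lemma cis_sum: "cis (sum f A) = (\<Prod>b\<in>A. cis (f b))"
  by (induction A rule: infinite_finite_induct) (auto simp: cis_mult[symmetric])

lemma gauss_fourier:
  fixes p :: "'a::euclidean_space"
  shows "integrable lborel (\<lambda>x. cis (- (p \<bullet> x)) * of_real (gauss x))" (is ?I)
    and "(LINT x|lborel. cis (- (p \<bullet> x)) * of_real (gauss x)) = of_real (sqrt (2 * pi) ^ DIM('a) * gauss p)" (is ?E)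
proof -
  have eq: "(\<lambda>x. cis (- (p \<bullet> x)) * of_real (gauss x))
      = (\<lambda>x. \<Prod>b\<in>Basis. cis (- ((p \<bullet> b) * (x \<bullet> b))) * of_real (gauss (x \<bullet> b)))"
    by (rule ext, subst gauss_prod, subst euclidean_inner)
       (simp add: prod.distrib sum_negf[symmetric] cis_sum)
  show ?I unfolding eq
    by (rule lborel_integral_prod_Basis) (rule gauss_fourier_real)
  have "(LINT x|lborel. (\<Prod>b\<in>Basis. cis (- ((p \<bullet> b) * (x \<bullet> b))) * of_real (gauss (x \<bullet> b))))
      = (\<Prod>b\<in>(Basis :: 'a set). LINT x|lborel. cis (- ((p \<bullet> b) * x)) * of_real (gauss x))"
    by (rule lborel_integral_prod_Basis) (rule gauss_fourier_real)
  also have "\<dots> = (\<Prod>b\<in>(Basis :: 'a set). of_real (sqrt (2 * pi) * gauss (p \<bullet> b)))"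
    by (simp add: gauss_fourier_real(2))
  also have "\<dots> = of_real (sqrt (2 * pi) ^ DIM('a) * gauss p)"
    by (subst (2) gauss_prod) (simp add: prod.distrib)
  finally show ?E unfolding eq .
qed

lemma integrable_gauss: "integrable lborel (gauss :: 'a::euclidean_space \<Rightarrow> real)"
  and integral_gauss: "(LINT x|lborel. gauss (x :: 'a::euclidean_space)) = sqrt (2 * pi) ^ DIM('a)"
proof -
  have "integrable lborel (\<lambda>x. Re (of_real (gauss (x :: 'a))))"
    using gauss_fourier(1)[of "0 :: 'a"] by (intro integrable_Re) simp
  then show i: "integrable lborel (gauss :: 'a \<Rightarrow> real)" by simp
  have "complex_of_real (LINT x|lborel. gauss (x :: 'a)) = of_real (sqrt (2 * pi) ^ DIM('a))"
    using gauss_fourier(2)[of "0 :: 'a"] by simp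
  then show "(LINT x|lborel. gauss (x :: 'a)) = sqrt (2 * pi) ^ DIM('a)" by (simp only: of_real_eq_iff)
qed

lemma borel_measurable_cnj [measurable (raw)]:
  "f \<in> borel_measurable M \<Longrightarrow> (\<lambda>x. cnj (f x)) \<in> borel_measurable M"
  by (rule borel_measurable_continuous_on[OF continuous_on_cnj[OF continuous_on_id]])

lemma borel_measurable_cis [measurable (raw)]:
  "f \<in> borel_measurable M \<Longrightarrow> (\<lambda>x. cis (f x)) \<in> borel_measurable M"
  by (rule borel_measurable_continuous_on[OF continuous_on_cis[OF continuous_on_id]])

text \<open>Used with the Fourier kernel, to move the transform from the autocorrelation of a
  function onto a Gaussian weight.\<close>

lemma integral_bounded_kernel_swap:
  fixes u v :: "'a::euclidean_space \<Rightarrow> complex" and k :: "'a \<Rightarrow> 'a \<Rightarrow> complex"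
  assumes u: "integrable lborel u" and v: "integrable lborel v"
    and [measurable]: "case_prod k \<in> borel_measurable (borel \<Otimes>\<^sub>M borel)" and k: "\<And>x p. norm (k x p) \<le> 1"
  shows "(LINT p|lborel. (LINT x|lborel. u x * k x p) * v p) = (LINT x|lborel. u x * (LINT p|lborel. k x p * v p))"
proof -
  have [measurable]: "u \<in> borel_measurable borel" "v \<in> borel_measurable borel"
    using borel_measurable_integrable[OF u] borel_measurable_integrable[OF v] by simp_all
  have "integrable (lborel \<Otimes>\<^sub>M lborel) (\<lambda>(x, p). u x * v p)"
  proof (rule lborel_pair.Fubini_integrable)
    show "integrable lborel (\<lambda>x. LINT y|lborel. norm (case (x, y) of (x, p) \<Rightarrow> u x * v p))"
      using u by (simp add: norm_mult)
  qed (use v in auto)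
  then have "integrable (lborel \<Otimes>\<^sub>M lborel) (\<lambda>(x, p). u x * k x p * v p)"
    by (rule Bochner_Integration.integrable_bound)
       (auto simp: norm_mult intro!: AE_I2 mult_right_mono mult_left_le k)
  from lborel_pair.Fubini_integral[OF this] show ?thesis
    by (simp add: mult.assoc flip: integral_mult_left_zero integral_mult_right_zero)
qed

lemma norm_integral_le_L1:
  fixes f :: "'a \<Rightarrow> complex"
  assumes "\<And>x. norm (k x) \<le> 1" "integrable M f" "k \<in> borel_measurable M"
  shows "norm (LINT x|M. k x * f x) \<le> (LINT x|M. norm (f x))"
proof -
  have "norm (LINT x|M. k x * f x) \<le> (LINT x|M. norm (k x * f x))" by (rule integral_norm_bound)
  also have "\<dots> \<le> (LINT x|M. norm (f x))"
    using assms borel_measurable_integrable[OF assms(2)]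
    by (intro integral_mono integrable_norm Bochner_Integration.integrable_bound[OF assms(2)])
       (auto simp: norm_mult intro!: mult_left_le_one_le AE_I2)
  finally show ?thesis .
qed

section \<open>Plancherel's identity for scalar functions\<close>

context
  fixes f :: "'a::euclidean_space \<Rightarrow> complex"
  assumes f1: "integrable lborel f" and f2: "integrable lborel (\<lambda>x. (norm (f x))\<^sup>2)"
begin

private lemma m [measurable]: "f \<in> borel_measurable borel"
  using borel_measurable_integrable[OF f1] by simp

text \<open>The autocorrelation of \<open>f\<close>. Its Fourier transform is |fh|^2 and its value
  at 0 is \<open>N\<close>, so Plancherel's identity amounts to Fourier inversion for
  \<open>C\<close> at the single point 0.\<close>

private definition "C z = (LINT x|lborel. f x * cnj (f (x - z)))"
private definition "fh p = (LINT x|lborel. cis (- (p \<bullet> x)) * f x)"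
private definition "N = (LINT x|lborel. (norm (f x))\<^sup>2)"

private lemma pair_integrable:
  assumes [measurable]: "k \<in> borel_measurable borel" and k: "\<And>z. norm (k z) \<le> 1"
  shows "integrable (lborel \<Otimes>\<^sub>M lborel) (\<lambda>(x, z). f x * cnj (f (x - z)) * k z)"
proof -
  have r: "integrable lborel (\<lambda>z. norm (f (x - z)))" for x
    using lborel_integrable_reflect[OF f1] by auto
  have r': "(LINT z|lborel. norm (f (x - z))) = (LINT z|lborel. norm (f z))" for x
    by (rule lborel_integral_reflect) measurable
  have "integrable (lborel \<Otimes>\<^sub>M lborel) (\<lambda>(x, z). f x * cnj (f (x - z)))"
  proof (rule lborel_pair.Fubini_integrable)
    show "integrable lborel (\<lambda>x. LINT y|lborel. norm (case (x, y) of (x, z) \<Rightarrow> f x * cnj (f (x - z))))"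
      using f1 by (simp add: norm_mult r')
    show "AE x in lborel. integrable lborel (\<lambda>y. case (x, y) of (x, z) \<Rightarrow> f x * cnj (f (x - z)))"
      using lborel_integrable_reflect[OF f1] by (intro AE_I2) auto
  qed auto
  then show ?thesis
    by (rule Bochner_Integration.integrable_bound) (auto simp: norm_mult intro!: AE_I2 mult_left_le k)
qed

private lemma C_integrable: "integrable lborel C"
proof -
  show ?thesis
    using lborel_pair.integrable_snd[OF pair_integrable[of "\<lambda>_. 1"]] unfolding C_def[abs_def] by simp
qed

private lemma autocorrelation: "(LINT z|lborel. C z * cis (- (p \<bullet> z))) = fh p * cnj (fh p)"
proof -
  have "(LINT z|lborel. C z * cis (- (p \<bullet> z)))
      = (LINT z|lborel. LINT x|lborel. f x * cnj (f (x - z)) * cis (- (p \<bullet> z)))"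
    unfolding C_def by simp
  also have "\<dots> = (LINT x|lborel. LINT z|lborel. f x * cnj (f (x - z)) * cis (- (p \<bullet> z)))"
    by (rule lborel_pair.Fubini_integral[OF pair_integrable]) auto
  also have "\<dots> = (LINT x|lborel. cis (- (p \<bullet> x)) * f x * cnj (fh p))"
  proof (intro Bochner_Integration.integral_cong refl)
    fix x
    have "(LINT z|lborel. f x * cnj (f (x - z)) * cis (- (p \<bullet> z)))
        = (LINT z|lborel. (\<lambda>y. f x * cis (- (p \<bullet> x)) * cnj (cis (- (p \<bullet> y)) * f y)) (x - z))"
      by (intro Bochner_Integration.integral_cong refl)
         (simp add: inner_diff_right cis_cnj cis_mult mult_ac)
    also have "\<dots> = (LINT y|lborel. f x * cis (- (p \<bullet> x)) * cnj (cis (- (p \<bullet> y)) * f y))"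
      by (rule lborel_integral_reflect) measurable
    also have "\<dots> = f x * cis (- (p \<bullet> x)) * cnj (fh p)"
      by (simp only: fh_def integral_mult_right_zero Bochner_Integration.integral_cnj)
    finally show "(LINT z|lborel. f x * cnj (f (x - z)) * cis (- (p \<bullet> z))) = cis (- (p \<bullet> x)) * f x * cnj (fh p)"
      by (simp add: mult_ac)
  qed
  also have "\<dots> = fh p * cnj (fh p)" unfolding fh_def by simp
  finally show ?thesis .
qed

text \<open>Expanding |f(x - z) - f(x)|^2 turns L2 continuity of translations into continuity of
  \<open>Re (C z)\<close> at 0. The bound by \<open>N\<close> supplies the dominating function for
  the limit below.\<close>

private lemma Re_C: "Re (C z) = N - (LINT x|lborel. (norm (f (x - z) - f x))\<^sup>2) / 2"
  and Re_C_le: "\<bar>Re (C z)\<bar> \<le> N"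
proof -
  have i': "integrable lborel (\<lambda>x. (norm (f (x - z)))\<^sup>2)"
    using lborel_integrable_translate[OF f2, of "- z"] by simp
  have N': "(LINT x|lborel. (norm (f (x - z)))\<^sup>2) = N"
    using lborel_integral_translate[of "\<lambda>x. (norm (f x))\<^sup>2" "- z"] by (simp add: N_def)
  have p: "\<bar>Re (a * cnj b)\<bar> \<le> ((norm a)\<^sup>2 + (norm b)\<^sup>2) / 2" "norm (a * cnj b) \<le> ((norm a)\<^sup>2 + (norm b)\<^sup>2) / 2" for a b :: complex
  proof -
    show "norm (a * cnj b) \<le> ((norm a)\<^sup>2 + (norm b)\<^sup>2) / 2"
      using sum_squares_bound[of "norm a" "norm b"] by (simp add: norm_mult)
    then show "\<bar>Re (a * cnj b)\<bar> \<le> ((norm a)\<^sup>2 + (norm b)\<^sup>2) / 2"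
      using abs_Re_le_cmod[of "a * cnj b"] by linarith
  qed
  have i: "integrable lborel (\<lambda>x. f x * cnj (f (x - z)))"
    by (rule Bochner_Integration.integrable_bound[of _ "\<lambda>x. ((norm (f x))\<^sup>2 + (norm (f (x - z)))\<^sup>2) / 2"])
       (use f2 i' p(2) in \<open>auto intro!: AE_I2\<close>)
  have iR: "integrable lborel (\<lambda>x. Re (f x * cnj (f (x - z))))" by (rule integrable_Re[OF i])
  have R: "Re (C z) = (LINT x|lborel. Re (f x * cnj (f (x - z))))"
    unfolding C_def by (rule integral_Re[OF i, symmetric])
  have "(norm (f (x - z) - f x))\<^sup>2 = (norm (f x))\<^sup>2 + (norm (f (x - z)))\<^sup>2 - 2 * Re (f x * cnj (f (x - z)))" for x
    unfolding cmod_power2 by (simp add: power2_eq_square algebra_simps)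
  then have "(LINT x|lborel. (norm (f (x - z) - f x))\<^sup>2)
      = (LINT x|lborel. (norm (f x))\<^sup>2 + (norm (f (x - z)))\<^sup>2 - 2 * Re (f x * cnj (f (x - z))))"
    by presburger
  also have "\<dots> = (LINT x|lborel. (norm (f x))\<^sup>2 + (norm (f (x - z)))\<^sup>2) - (LINT x|lborel. 2 * Re (f x * cnj (f (x - z))))"
    using f2 i' iR by (intro Bochner_Integration.integral_diff Bochner_Integration.integrable_add integrable_mult_right)
  also have "\<dots> = N + N - 2 * Re (C z)"
    unfolding R integral_mult_right_zero using f2 i' by (simp add: N' N_def)
  finally have "(LINT x|lborel. (norm (f (x - z) - f x))\<^sup>2) = N + N - 2 * Re (C z)" .
  then show "Re (C z) = N - (LINT x|lborel. (norm (f (x - z) - f x))\<^sup>2) / 2" by linarith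
  have "\<bar>Re (C z)\<bar> \<le> (LINT x|lborel. \<bar>Re (f x * cnj (f (x - z)))\<bar>)"
    unfolding R by (rule integral_abs_bound)
  also have "\<dots> \<le> (LINT x|lborel. ((norm (f x))\<^sup>2 + (norm (f (x - z)))\<^sup>2) / 2)"
    by (intro integral_mono) (use iR f2 i' p(1) in auto)
  also have "\<dots> = N" using f2 i' by (simp add: N' N_def)
  finally show "\<bar>Re (C z)\<bar> \<le> N" .
qed

private lemma fh_measurable [measurable]: "fh \<in> borel_measurable borel"
  unfolding fh_def[abs_def] by measurable

text \<open>The Gaussian makes the integral of |fh|^2 converge absolutely, \<open>fh\<close> being
  known only to be bounded at this stage. After Fubini, the substitution z = s u leaves
  \<open>s\<close> only in the argument of \<open>C\<close>.\<close>

private lemma gauss_weighted: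
  assumes s: "s > 0"
  shows "integrable lborel (\<lambda>p. (norm (fh p))\<^sup>2 * gauss (s *\<^sub>R p))"
    and "(LINT p|lborel. (norm (fh p))\<^sup>2 * gauss (s *\<^sub>R p))
       = sqrt (2 * pi) ^ DIM('a) * (LINT u|lborel. Re (C (s *\<^sub>R u)) * gauss u)"
proof -
  let ?K = "sqrt (2 * pi) ^ DIM('a)"
  have s': "inverse s * (s * w) = w" for w using s by simp
  have gs: "integrable lborel (\<lambda>p::'a. gauss (s *\<^sub>R p))"
    using lborel_integrable_scale[OF integrable_gauss, of s 0] s by simp
  have [measurable]: "C \<in> borel_measurable borel" using borel_measurable_integrable[OF C_integrable] by simp
  have G: "(LINT p|lborel. cis (- (p \<bullet> z)) * of_real (gauss (s *\<^sub>R p))) = of_real (?K / s ^ DIM('a) * gauss (z /\<^sub>R s))" for z :: 'a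
  proof -
    have "(LINT p|lborel. cis (- (p \<bullet> z)) * of_real (gauss (s *\<^sub>R p)))
        = (LINT p|lborel. (\<lambda>x. cis (- ((z /\<^sub>R s) \<bullet> x)) * complex_of_real (gauss x)) (0 + s *\<^sub>R p))"
      by (intro Bochner_Integration.integral_cong refl) (simp add: inner_commute s')
    also have "\<dots> = (1 / \<bar>s\<bar> ^ DIM('a)) *\<^sub>R (LINT x|lborel. cis (- ((z /\<^sub>R s) \<bullet> x)) * complex_of_real (gauss x))"
      by (rule lborel_integral_scale) (use s in auto)
    finally show ?thesis unfolding gauss_fourier(2) using s by (simp add: scaleR_conv_of_real)
  qed
  have k: "(\<lambda>(z::'a, p). cis (- (p \<bullet> z))) \<in> borel_measurable (borel \<Otimes>\<^sub>M borel)" by measurable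
  have gs': "integrable lborel (\<lambda>p::'a. complex_of_real (gauss (s *\<^sub>R p)))" using gs by simp
  have "(LINT p|lborel. fh p * cnj (fh p) * of_real (gauss (s *\<^sub>R p)))
     = (LINT p|lborel. (LINT z|lborel. C z * cis (- (p \<bullet> z))) * of_real (gauss (s *\<^sub>R p)))"
    by (simp add: autocorrelation)
  also have "\<dots> = (LINT z|lborel. C z * (LINT p|lborel. cis (- (p \<bullet> z)) * of_real (gauss (s *\<^sub>R p))))"
    by (rule integral_bounded_kernel_swap[OF C_integrable gs' k]) simp
  also have "\<dots> = (LINT z|lborel. of_real (?K / s ^ DIM('a)) * (C z * of_real (gauss (z /\<^sub>R s))))"
    unfolding G by (simp add: mult_ac)
  also have "\<dots> = ?K *\<^sub>R ((1 / \<bar>s\<bar> ^ DIM('a)) *\<^sub>R (LINT z|lborel. C z * of_real (gauss (z /\<^sub>R s))))"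
    unfolding integral_mult_right_zero using s by (simp add: scaleR_conv_of_real)
  also have "(1 / \<bar>s\<bar> ^ DIM('a)) *\<^sub>R (LINT z|lborel. C z * of_real (gauss (z /\<^sub>R s)))
     = (LINT u|lborel. (\<lambda>z. C z * of_real (gauss (z /\<^sub>R s))) (0 + s *\<^sub>R u))"
    by (rule lborel_integral_scale[symmetric]) (use s in auto)
  finally have e: "(LINT p|lborel. fh p * cnj (fh p) * of_real (gauss (s *\<^sub>R p)))
      = ?K *\<^sub>R (LINT u|lborel. C (s *\<^sub>R u) * of_real (gauss u))" using s by simp
  have bd: "norm (fh p) \<le> (LINT x|lborel. norm (f x))" for p
    unfolding fh_def by (rule norm_integral_le_L1) (auto intro: f1)
  have B: "integrable lborel (\<lambda>p::'a. (LINT x|lborel. norm (f x))\<^sup>2 * gauss (s *\<^sub>R p))"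
    by (intro integrable_mult_right gs)
  show i1: "integrable lborel (\<lambda>p. (norm (fh p))\<^sup>2 * gauss (s *\<^sub>R p))"
    by (rule Bochner_Integration.integrable_bound[OF B])
       (auto intro!: AE_I2 mult_mono power_mono bd simp: abs_mult less_imp_le[OF gauss_pos] integral_nonneg)
  have "integrable lborel (\<lambda>u. C (0 + s *\<^sub>R u))"
    using s by (intro lborel_integrable_scale C_integrable) auto
  then have i2: "integrable lborel (\<lambda>u. C (s *\<^sub>R u) * of_real (gauss u))"
    by (rule Bochner_Integration.integrable_bound)
      (auto simp: norm_mult gauss_le_1 less_imp_le[OF gauss_pos] intro!: AE_I2 mult_left_le)
  have "complex_of_real (LINT p|lborel. (norm (fh p))\<^sup>2 * gauss (s *\<^sub>R p))
      = (LINT p|lborel. fh p * cnj (fh p) * of_real (gauss (s *\<^sub>R p)))"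
    by (simp add: complex_norm_square[symmetric] integral_complex_of_real[symmetric] del: integral_complex_of_real)
  from arg_cong[OF this, of Re]
  have "(LINT p|lborel. (norm (fh p))\<^sup>2 * gauss (s *\<^sub>R p)) = Re (?K *\<^sub>R (LINT u|lborel. C (s *\<^sub>R u) * of_real (gauss u)))"
    unfolding e by (simp only: Re_complex_of_real)
  also have "\<dots> = ?K * (LINT u|lborel. Re (C (s *\<^sub>R u)) * gauss u)"
    using integral_Re[OF i2] by simp
  finally show "(LINT p|lborel. (norm (fh p))\<^sup>2 * gauss (s *\<^sub>R p))
       = ?K * (LINT u|lborel. Re (C (s *\<^sub>R u)) * gauss u)" .
qed

text \<open>Let s tend to 0 in \<open>gauss_weighted\<close>: the left side increases to the full
  integral, the right side converges by domination. Of the factor (2 pi)^n, one square root comes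
  from the transform of the Gaussian and one from its total mass. The \<open>nn_integral\<close>
  form also yields finiteness.\<close>

lemma plancherel_complex:
  "(\<integral>\<^sup>+ p. ennreal ((norm (LINT x|lborel. cis (- (p \<bullet> x)) * f x))\<^sup>2) \<partial>lborel)
    = ennreal ((2 * pi) ^ DIM('a) * (LINT x|lborel. (norm (f x))\<^sup>2))"
proof -
  let ?K = "sqrt (2 * pi) ^ DIM('a)"
  define s where "s n = inverse (real (Suc n))" for n
  have s: "s n > 0" "s \<longlonglongrightarrow> 0" for n
    unfolding s_def using LIMSEQ_inverse_real_of_nat by auto
  have [measurable]: "C \<in> borel_measurable borel" using borel_measurable_integrable[OF C_integrable] by simp
  have "(\<lambda>n. LINT u|lborel. Re (C (s n *\<^sub>R u)) * gauss u) \<longlonglongrightarrow> (LINT u::'a|lborel. N * gauss u)"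
  proof (rule integral_dominated_convergence[where w="\<lambda>u. N * gauss u"])
    show "integrable lborel (\<lambda>u::'a. N * gauss u)" using integrable_gauss by auto
    show "AE u in lborel. norm (Re (C (s n *\<^sub>R u)) * gauss u) \<le> N * gauss u" for n
      by (auto intro!: AE_I2 mult_right_mono Re_C_le simp: abs_mult less_imp_le[OF gauss_pos])
    show "AE u in lborel. (\<lambda>n. Re (C (s n *\<^sub>R u)) * gauss u) \<longlonglongrightarrow> N * gauss u"
    proof (intro AE_I2 tendsto_intros)
      fix u :: 'a
      have X: "(\<lambda>n. - (s n *\<^sub>R u)) \<longlonglongrightarrow> 0"
        using tendsto_minus[OF tendsto_scaleR[OF s(2) tendsto_const[of u]]] by simp
      have "(\<lambda>n. LINT x|lborel. (norm (f (x - s n *\<^sub>R u) - f x))\<^sup>2) \<longlonglongrightarrow> 0"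
        using translation_continuous_L2[OF m f2 X] by simp
      from tendsto_diff[OF tendsto_const[of N] tendsto_divide[OF this tendsto_const[of 2]]]
      show "(\<lambda>n. Re (C (s n *\<^sub>R u))) \<longlonglongrightarrow> N" by (simp add: Re_C)
    qed
  qed auto
  then have "(\<lambda>n. ?K * (LINT u|lborel. Re (C (s n *\<^sub>R u)) * gauss u)) \<longlonglongrightarrow> ?K * (LINT u::'a|lborel. N * gauss u)"
    by (rule tendsto_mult_left)
  moreover have "?K * (LINT u::'a|lborel. N * gauss u) = (2 * pi) ^ DIM('a) * N"
  proof -
    have "?K * ?K = (2 * pi) ^ DIM('a)" by (simp only: power_mult_distrib[symmetric]) simp
    moreover have "?K * (N * ?K) = (?K * ?K) * N" by (simp only: mult_ac)
    ultimately show ?thesis unfolding integral_mult_right_zero integral_gauss by (simp only:)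
  qed
  ultimately have "(\<lambda>n. LINT p|lborel. (norm (fh p))\<^sup>2 * gauss (s n *\<^sub>R p)) \<longlonglongrightarrow> (2 * pi) ^ DIM('a) * N"
    by (simp only: gauss_weighted(2)[OF s(1)])
  then have lim: "(\<lambda>n. ennreal (LINT p|lborel. (norm (fh p))\<^sup>2 * gauss (s n *\<^sub>R p))) \<longlonglongrightarrow> ennreal ((2 * pi) ^ DIM('a) * N)"
    by (rule tendsto_ennrealI)
  have eq: "ennreal (LINT p|lborel. (norm (fh p))\<^sup>2 * gauss (s n *\<^sub>R p))
      = (\<integral>\<^sup>+ p. ennreal ((norm (fh p))\<^sup>2 * gauss (s n *\<^sub>R p)) \<partial>lborel)" for n
    by (rule nn_integral_eq_integral[symmetric, OF gauss_weighted(1)[OF s(1)]])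
       (auto simp: less_imp_le[OF gauss_pos])
  have "(\<lambda>n. \<integral>\<^sup>+ p. ennreal ((norm (fh p))\<^sup>2 * gauss (s n *\<^sub>R p)) \<partial>lborel)
      \<longlonglongrightarrow> (\<integral>\<^sup>+ p. ennreal ((norm (fh p))\<^sup>2) \<partial>lborel)"
  proof (rule nn_integral_LIMSEQ)
    show "incseq (\<lambda>n p. ennreal ((norm (fh p))\<^sup>2 * gauss (s n *\<^sub>R p)))"
    proof (intro incseq_SucI le_funI ennreal_leI mult_left_mono)
      fix n and p :: 'a
      have "s (Suc n) \<le> s n" unfolding s_def by (intro le_imp_inverse_le) auto
      then have "s (Suc n) * s (Suc n) \<le> s n * s n" using s by (intro mult_mono) (auto intro: less_imp_le)
      then have "s (Suc n) * s (Suc n) * (p \<bullet> p) \<le> s n * s n * (p \<bullet> p)" by (rule mult_right_mono) simp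
      then show "gauss (s n *\<^sub>R p) \<le> gauss (s (Suc n) *\<^sub>R p)" by (simp add: gauss_def mult.assoc)
    qed auto
    fix p :: 'a
    have "(\<lambda>n. gauss (s n *\<^sub>R p)) \<longlonglongrightarrow> gauss (0 *\<^sub>R p)"
      unfolding gauss_def by (intro tendsto_intros s) auto
    then have "(\<lambda>n. (norm (fh p))\<^sup>2 * gauss (s n *\<^sub>R p)) \<longlonglongrightarrow> (norm (fh p))\<^sup>2 * gauss (0 *\<^sub>R p)"
      by (intro tendsto_intros)
    then show "(\<lambda>n. ennreal ((norm (fh p))\<^sup>2 * gauss (s n *\<^sub>R p))) \<longlonglongrightarrow> ennreal ((norm (fh p))\<^sup>2)"
      by (intro tendsto_ennrealI) simp
  qed auto
  then have "(\<integral>\<^sup>+ p. ennreal ((norm (fh p))\<^sup>2) \<partial>lborel) = ennreal ((2 * pi) ^ DIM('a) * N)"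
    by (rule LIMSEQ_unique) (use lim in \<open>simp only: eq\<close>)
  then show ?thesis by (simp add: fh_def N_def)
qed

end

section \<open>Vector-valued functions and their Fourier integrals\<close>

lemma norm_vector_smult: "norm (c *s v) = norm c * norm (v :: complex ^ 'n)"
  by (simp add: norm_vec_def L2_set_def norm_mult power_mult_distrib sum_distrib_left[symmetric]
      real_sqrt_mult)

lemma norm_complex_vec_square: "(norm v)\<^sup>2 = (\<Sum>j\<in>UNIV. (norm (v $ j))\<^sup>2)" for v :: "complex ^ 'n"
  by (simp add: norm_vec_def L2_set_def sum_nonneg)

lemma bounded_linear_smult: "bounded_linear (\<lambda>v :: complex ^ 'n. c *s v)"
  by (rule bounded_linear_intro[where K="norm c"])
     (simp_all add: vector_add_ldistrib norm_vector_smult vec_eq_iff mult_ac)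

lemma bounded_bilinear_smult: "bounded_bilinear (\<lambda>c (v :: complex ^ 'n). c *s v)"
proof (rule bounded_bilinear.intro)
  show "\<exists>K. \<forall>a (b :: complex ^ 'n). norm (a *s b) \<le> norm a * norm b * K"
    by (intro exI[of _ 1]) (simp add: norm_vector_smult)
qed (simp_all add: vec_eq_iff algebra_simps)

lemmas continuous_on_smult = bounded_bilinear.continuous_on[OF bounded_bilinear_smult]

lemma borel_measurable_smult [measurable (raw)]:
  fixes f :: "'a \<Rightarrow> complex ^ 'n"
  assumes "c \<in> borel_measurable M" "f \<in> borel_measurable M"
  shows "(\<lambda>x. c x *s f x) \<in> borel_measurable M"
proof (rule borel_measurable_continuous_Pair[OF assms])
  show "continuous_on UNIV (\<lambda>x :: complex \<times> (complex ^ 'n). fst x *s snd x)"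
    by (intro continuous_on_smult continuous_intros)
qed

lemma borel_measurable_matrix_vector [measurable (raw)]:
  fixes f :: "'a \<Rightarrow> complex ^ 'n" and A :: "complex ^ 'n ^ 'm"
  assumes "f \<in> borel_measurable M"
  shows "(\<lambda>x. A *v f x) \<in> borel_measurable M"
  using assms by (rule borel_measurable_continuous_on[rotated])
    (intro linear_continuous_on matrix_vector_mul_bounded_linear)

lemma borel_measurable_vec_nth' [measurable (raw)]:
  fixes f :: "'a \<Rightarrow> complex ^ 'n"
  assumes "f \<in> borel_measurable M"
  shows "(\<lambda>x. f x $ i) \<in> borel_measurable M"
  using assms by (rule borel_measurable_continuous_on[rotated])
    (intro linear_continuous_on bounded_linear_vec_nth)

lemma integrable_vec_nth:
  fixes f :: "'a \<Rightarrow> complex ^ 'n"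
  assumes "integrable M f"
  shows "integrable M (\<lambda>x. f x $ j)"
  by (rule integrable_bounded_linear[OF bounded_linear_vec_nth assms])

lemma integral_vec_nth:
  fixes f :: "'a \<Rightarrow> complex ^ 'n"
  assumes "integrable M f"
  shows "(LINT x|M. f x) $ j = (LINT x|M. f x $ j)"
  by (rule integral_bounded_linear[OF bounded_linear_vec_nth assms, symmetric])

text \<open>Left unnormalized, so that translations and matrices pass through without constants; the
  factor \<open>fourier_const\<close> enters only in the comparison with
  \<open>fourier_cutoff\<close> and \<open>is_fourier_transform\<close>.\<close>

definition fourier_int :: "('a::euclidean_space \<Rightarrow> complex ^ 'n) \<Rightarrow> 'a \<Rightarrow> complex ^ 'n" where
  "fourier_int f p = (LINT x|lborel. cis (- (p \<bullet> x)) *s f x)"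

definition compact_L2 :: "('a::euclidean_space \<Rightarrow> complex ^ 'n) set" where
  "compact_L2 = {f. f \<in> borel_measurable borel \<and> integrable lborel (\<lambda>x. (norm (f x))\<^sup>2) \<and>
     (\<exists>R. \<forall>x. norm x > R \<longrightarrow> f x = 0)}"

lemma integrable_of_square_bounded_support:
  fixes f :: "'a::euclidean_space \<Rightarrow> 'b::{banach, second_countable_topology}"
  assumes [measurable]: "f \<in> borel_measurable borel" and f2: "integrable lborel (\<lambda>x. (norm (f x))\<^sup>2)"
    and R: "\<And>x. norm x > R \<Longrightarrow> f x = 0"
  shows "integrable lborel f"
proof (rule Bochner_Integration.integrable_bound)
  have "emeasure lborel (cball (0::'a) R) < \<infinity>" by (rule emeasure_bounded_finite) simp
  then show "integrable lborel (\<lambda>x. indicator (cball 0 R) x + (norm (f x))\<^sup>2)"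
    using f2 by (intro Bochner_Integration.integrable_add integrable_real_indicator) auto
  have "norm (f x) \<le> indicator (cball 0 R) x + (norm (f x))\<^sup>2" for x
  proof (cases "norm x > R")
    case False
    have "norm (f x) \<le> 1 + (norm (f x))\<^sup>2"
      using sum_squares_bound[of "norm (f x)" 1, simplified] norm_ge_zero[of "f x"] by linarith
    with False show ?thesis by (simp add: indicator_def)
  qed (simp add: R)
  then show "AE x in lborel. norm (f x) \<le> norm (indicator (cball 0 R) x + (norm (f x))\<^sup>2)"
    by (intro AE_I2) (simp add: abs_of_nonneg)
qed simp

lemma compact_L2_integrable: "f \<in> compact_L2 \<Longrightarrow> integrable lborel f"
  unfolding compact_L2_def by (auto intro: integrable_of_square_bounded_support)

lemma integrable_kernel:
  fixes f :: "'a \<Rightarrow> complex ^ 'n"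
  assumes "integrable M f" and [measurable]: "k \<in> borel_measurable M" and "\<And>x. norm (k x) \<le> 1"
  shows "integrable M (\<lambda>x. k x *s f x)"
proof (rule Bochner_Integration.integrable_bound[OF assms(1)])
  have [measurable]: "f \<in> borel_measurable M" using assms(1) by auto
  show "(\<lambda>x. k x *s f x) \<in> borel_measurable M" by measurable
qed (auto intro!: AE_I2 mult_left_le_one_le assms(3) simp: norm_vector_smult)

lemma integrable_cis_smult:
  fixes f :: "'a::euclidean_space \<Rightarrow> complex ^ 'n"
  assumes "integrable lborel f"
  shows "integrable lborel (\<lambda>x. cis (- (p \<bullet> x)) *s f x)"
  by (rule integrable_kernel[OF assms]) auto

lemma fourier_int_nth:
  fixes f :: "'a::euclidean_space \<Rightarrow> complex ^ 'n"
  assumes "integrable lborel f"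
  shows "fourier_int f p $ j = (LINT x|lborel. cis (- (p \<bullet> x)) * f x $ j)"
  unfolding fourier_int_def integral_vec_nth[OF integrable_cis_smult[OF assms]] by simp

lemma fourier_int_measurable [measurable (raw)]:
  fixes f :: "'a::euclidean_space \<Rightarrow> complex ^ 'n"
  assumes [measurable]: "f \<in> borel_measurable borel"
  shows "fourier_int f \<in> borel_measurable borel"
  unfolding fourier_int_def[abs_def] by measurable

lemma plancherel:
  fixes f :: "'a::euclidean_space \<Rightarrow> complex ^ 'n"
  assumes f1: "integrable lborel f" and f2: "integrable lborel (\<lambda>x. (norm (f x))\<^sup>2)"
  shows "(\<integral>\<^sup>+ p. ennreal ((norm (fourier_int f p))\<^sup>2) \<partial>lborel)
    = ennreal ((2 * pi) ^ DIM('a) * (LINT x|lborel. (norm (f x))\<^sup>2))"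
proof -
  have [measurable]: "f \<in> borel_measurable borel" using borel_measurable_integrable[OF f1] by simp
  have i2: "integrable lborel (\<lambda>x. (norm (f x $ j))\<^sup>2)" for j
    by (rule Bochner_Integration.integrable_bound[OF f2])
       (auto intro!: AE_I2 power_mono Finite_Cartesian_Product.norm_nth_le)
  have "(\<integral>\<^sup>+ p. ennreal ((norm (fourier_int f p))\<^sup>2) \<partial>lborel)
      = (\<integral>\<^sup>+ p. (\<Sum>j\<in>UNIV. ennreal ((norm (LINT x|lborel. cis (- (p \<bullet> x)) * f x $ j))\<^sup>2)) \<partial>lborel)"
    by (simp add: norm_complex_vec_square fourier_int_nth[OF f1] sum_ennreal)
  also have "\<dots> = (\<Sum>j\<in>UNIV. \<integral>\<^sup>+ p. ennreal ((norm (LINT x|lborel. cis (- (p \<bullet> x)) * f x $ j))\<^sup>2) \<partial>lborel)"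
    by (rule nn_integral_sum) measurable
  also have "\<dots> = (\<Sum>j\<in>UNIV. ennreal ((2 * pi) ^ DIM('a) * (LINT x|lborel. (norm (f x $ j))\<^sup>2)))"
    by (intro sum.cong refl plancherel_complex integrable_vec_nth f1 i2)
  also have "\<dots> = ennreal ((2 * pi) ^ DIM('a) * (\<Sum>j\<in>UNIV. LINT x|lborel. (norm (f x $ j))\<^sup>2))"
    by (subst sum_ennreal) (auto simp: sum_distrib_left integral_nonneg)
  also have "(\<Sum>j\<in>UNIV. LINT x|lborel. (norm (f x $ j))\<^sup>2) = (LINT x|lborel. (norm (f x))\<^sup>2)"
    unfolding norm_complex_vec_square by (rule Bochner_Integration.integral_sum[symmetric]) (rule i2)
  finally show ?thesis .
qed

lemma fourier_int_add:
  assumes "integrable lborel f" "integrable lborel g"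
  shows "fourier_int (\<lambda>x. f x + g x) p = fourier_int f p + fourier_int g p"
  unfolding fourier_int_def vector_add_ldistrib
  by (intro Bochner_Integration.integral_add integrable_cis_smult assms)

lemma fourier_int_diff:
  assumes "integrable lborel f" "integrable lborel g"
  shows "fourier_int (\<lambda>x. f x - g x) p = fourier_int f p - fourier_int g p"
  unfolding fourier_int_def vector_ssub_ldistrib
  by (intro Bochner_Integration.integral_diff integrable_cis_smult assms)

lemma fourier_int_smult:
  assumes "integrable lborel f"
  shows "fourier_int (\<lambda>x. c *s f x) p = c *s fourier_int f p"
proof -
  have "(\<lambda>x. cis (- (p \<bullet> x)) *s (c *s f x)) = (\<lambda>x. c *s (cis (- (p \<bullet> x)) *s f x))"
    by (simp add: vector_smult_assoc mult.commute)
  then show ?thesis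
    unfolding fourier_int_def
    by (simp only: integral_bounded_linear[OF bounded_linear_smult integrable_cis_smult[OF assms]])
qed

lemma fourier_int_matrix:
  fixes A :: "complex ^ 'n ^ 'm"
  assumes "integrable lborel f"
  shows "fourier_int (\<lambda>x. A *v f x) p = A *v fourier_int f p"
  unfolding fourier_int_def
  by (simp only: vector_scalar_commute[symmetric]
      integral_bounded_linear[OF matrix_vector_mul_bounded_linear integrable_cis_smult[OF assms]])

lemma fourier_int_translate:
  fixes f :: "'a::euclidean_space \<Rightarrow> complex ^ 'n"
  assumes [measurable]: "integrable lborel f"
  shows "fourier_int (\<lambda>x. f (x + v)) p = cis (p \<bullet> v) *s fourier_int f p"
proof -
  have [measurable]: "f \<in> borel_measurable borel" using borel_measurable_integrable[OF assms] by simp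
  have "fourier_int (\<lambda>x. f (x + v)) p
      = (LINT x|lborel. (\<lambda>y. cis (p \<bullet> v) *s (cis (- (p \<bullet> y)) *s f y)) (x + v))"
    unfolding fourier_int_def
    by (intro Bochner_Integration.integral_cong refl)
       (simp add: vector_smult_assoc cis_mult inner_add_right)
  also have "\<dots> = (LINT y|lborel. cis (p \<bullet> v) *s (cis (- (p \<bullet> y)) *s f y))"
    by (rule lborel_integral_translate) measurable
  also have "\<dots> = cis (p \<bullet> v) *s fourier_int f p"
    unfolding fourier_int_def
    by (rule integral_bounded_linear[OF bounded_linear_smult integrable_cis_smult[OF assms]])
  finally show ?thesis .
qed

lemma fourier_int_eq_0_imp_AE:
  assumes f: "f \<in> compact_L2" and 0: "\<And>p. fourier_int f p = 0"
  shows "AE x in lborel. f x = 0"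
proof -
  have m [measurable]: "f \<in> borel_measurable borel" and f2: "integrable lborel (\<lambda>x. (norm (f x))\<^sup>2)"
    using f by (auto simp: compact_L2_def)
  have "ennreal ((2 * pi) ^ DIM('a) * (LINT x|lborel. (norm (f x))\<^sup>2)) = 0"
    using plancherel[OF compact_L2_integrable[OF f] f2] by (simp add: 0)
  then have "(2 * pi) ^ DIM('a) * (LINT x|lborel. (norm (f x))\<^sup>2) \<le> (2 * pi) ^ DIM('a) * 0"
    by (simp only: ennreal_eq_0_iff mult_zero_right)
  then have "(LINT x|lborel. (norm (f x))\<^sup>2) \<le> 0"
    by (rule mult_left_le_imp_le) simp
  then have "(LINT x|lborel. (norm (f x))\<^sup>2) = 0"
    by (intro antisym integral_nonneg) auto
  then have "AE x in lborel. (norm (f x))\<^sup>2 = 0"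
    using f2 by (subst (asm) integral_nonneg_eq_0_iff_AE) auto
  then show ?thesis by auto
qed

section \<open>The Fourier transform on \<open>L2\<close>\<close>

lemma borel_measurable_lebesgue_representative:
  fixes f :: "'a::euclidean_space \<Rightarrow> 'b::euclidean_space"
  assumes f: "f \<in> borel_measurable lebesgue"
  obtains g where "g \<in> borel_measurable borel" "AE x in lebesgue. f x = g x"
proof -
  have "\<exists>g\<in>borel_measurable lborel. AE x in lborel. f x \<bullet> b = g x" for b
    by (rule completion_ex_borel_measurable_real) (use f in measurable)
  then obtain g where g: "\<And>b. g b \<in> borel_measurable lborel" "\<And>b. AE x in lborel. f x \<bullet> b = g b x"
    by metis
  have [measurable]: "g b \<in> borel_measurable borel" for b using g(1)[of b] by simp
  show thesis
  proof (rule that)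
    show "(\<lambda>x. \<Sum>b\<in>Basis. g b x *\<^sub>R b) \<in> borel_measurable borel" by measurable
    have "AE x in lborel. \<forall>b\<in>Basis. f x \<bullet> b = g b x"
      using g(2) by (intro AE_finite_allI) auto
    then show "AE x in lebesgue. f x = (\<Sum>b\<in>Basis. g b x *\<^sub>R b)"
      unfolding AE_completion_iff
    proof eventually_elim
      case (elim x)
      then have "(\<Sum>b\<in>Basis. g b x *\<^sub>R b) = (\<Sum>b\<in>Basis. (f x \<bullet> b) *\<^sub>R b)" by simp
      then show ?case by (simp add: euclidean_representation)
    qed
  qed
qed

lemma L2_representative:
  assumes f: "f \<in> L2"
  obtains g where "g \<in> borel_measurable borel" "AE x in lebesgue. f x = g x"
    "integrable lborel (\<lambda>x. (norm (g x))\<^sup>2)"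
proof -
  from f have m: "f \<in> borel_measurable lebesgue" and i: "integrable lebesgue (\<lambda>x. (norm (f x))\<^sup>2)"
    by (auto simp: L2_def)
  obtain g where g [measurable]: "g \<in> borel_measurable borel" "AE x in lebesgue. f x = g x"
    using borel_measurable_lebesgue_representative[OF m] .
  have "integrable lebesgue (\<lambda>x. (norm (g x))\<^sup>2)"
    by (rule integrable_cong_AE_imp[OF i]) (use g in \<open>auto intro: measurable_completion\<close>)
  then have "integrable lborel (\<lambda>x. (norm (g x))\<^sup>2)" by (subst (asm) integrable_completion) auto
  with g that show thesis by blast
qed

lemma L2_I:
  assumes "g \<in> borel_measurable borel" "integrable lborel (\<lambda>x. (norm (g x))\<^sup>2)"
  shows "g \<in> L2"
  using assms by (auto simp: L2_def integrable_completion intro: measurable_completion)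

lemma cball_borel_measurable [measurable]: "cball a r \<in> sets borel"
  by simp

definition truncate_ball :: "real \<Rightarrow> ('a::euclidean_space \<Rightarrow> complex ^ 'n) \<Rightarrow> 'a \<Rightarrow> complex ^ 'n" where
  "truncate_ball R f x = indicator (cball 0 R) x *\<^sub>R f x"

lemma truncate_ball_compact_L2:
  assumes [measurable]: "f \<in> borel_measurable borel" and f: "integrable lborel (\<lambda>x. (norm (f x))\<^sup>2)"
  shows "truncate_ball R f \<in> compact_L2"
  unfolding compact_L2_def
proof (intro CollectI conjI)
  show m: "truncate_ball R f \<in> borel_measurable borel" unfolding truncate_ball_def[abs_def] by measurable
  show "integrable lborel (\<lambda>x. (norm (truncate_ball R f x))\<^sup>2)"
    by (rule Bochner_Integration.integrable_bound[OF f])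
       (use m in \<open>auto simp: truncate_ball_def indicator_def intro!: AE_I2\<close>)
  show "\<exists>R'. \<forall>x. R' < norm x \<longrightarrow> truncate_ball R f x = 0"
    by (intro exI[of _ R]) (auto simp: truncate_ball_def)
qed

abbreviation fourier_const :: real where "fourier_const \<equiv> (2 * pi) powr (- 3 / 2)"

lemma fourier_const_square: "fourier_const\<^sup>2 * (2 * pi) ^ 3 = 1"
proof -
  have "fourier_const\<^sup>2 = (2 * pi) powr (- 3)"
    by (simp add: power2_eq_square powr_add[symmetric])
  then have "fourier_const\<^sup>2 * (2 * pi) ^ 3 = (2 * pi) powr (- 3) * (2 * pi) powr 3"
    by (simp only: powr_numeral) simp
  also have "\<dots> = (2 * pi) powr (- 3 + 3)" by (rule powr_add[symmetric])
  also have "\<dots> = 1" by simp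
  finally show ?thesis .
qed

text \<open>The cut-off integrals do not see null sets, so questions about Lebesgue measurable
  representatives reduce to Borel functions under \<open>lborel\<close>, where Plancherel's identity
  was proved.\<close>

lemma fourier_cutoff_eq:
  assumes g: "g \<in> borel_measurable borel" "AE x in lebesgue. f x = g x" and f: "f \<in> borel_measurable lebesgue"
  shows "fourier_cutoff R f = (\<lambda>p. fourier_const *\<^sub>R fourier_int (truncate_ball R g) p)"
proof (rule ext)
  fix p
  note [measurable] = g(1)
  have [measurable]: "f \<in> borel_measurable lebesgue" by fact
  have c: "(\<lambda>x::real^3. cis (- (p \<bullet> x))) \<in> borel_measurable lebesgue"
    by (rule measurable_completion) measurable
  have B: "(indicator (cball 0 R) :: real^3 \<Rightarrow> real) \<in> borel_measurable lebesgue"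
    by (rule measurable_completion) measurable
  have "(LINT x|lebesgue. indicator (cball 0 R) x *\<^sub>R (cis (- (p \<bullet> x)) *s f x))
     = (LINT x|lebesgue. cis (- (p \<bullet> x)) *s truncate_ball R g x)"
  proof (rule integral_cong_AE)
    show "(\<lambda>x. indicator (cball 0 R) x *\<^sub>R (cis (- (p \<bullet> x)) *s f x)) \<in> borel_measurable lebesgue"
      using c B by measurable
    show "(\<lambda>x. cis (- (p \<bullet> x)) *s truncate_ball R g x) \<in> borel_measurable lebesgue"
      unfolding truncate_ball_def by (rule measurable_completion) measurable
    show "AE x in lebesgue. indicator (cball 0 R) x *\<^sub>R (cis (- (p \<bullet> x)) *s f x) = cis (- (p \<bullet> x)) *s truncate_ball R g x"
      using g(2) by eventually_elim (simp add: truncate_ball_def indicator_def)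
  qed
  also have "\<dots> = (LINT x|lborel. cis (- (p \<bullet> x)) *s truncate_ball R g x)"
    unfolding truncate_ball_def by (rule integral_completion) measurable
  finally show "fourier_cutoff R f p = fourier_const *\<^sub>R fourier_int (truncate_ball R g) p"
    by (simp add: fourier_cutoff_def set_lebesgue_integral_def fourier_int_def)
qed

lemma truncate_ball_measurable [measurable]:
  "f \<in> borel_measurable borel \<Longrightarrow> truncate_ball R f \<in> borel_measurable borel"
  unfolding truncate_ball_def[abs_def] by measurable

lemma fourier_cutoff_measurable:
  assumes "f \<in> borel_measurable lebesgue"
  shows "fourier_cutoff R f \<in> borel_measurable borel"
proof -
  obtain g where g [measurable]: "g \<in> borel_measurable borel" and ae: "AE x in lebesgue. f x = g x"
    using borel_measurable_lebesgue_representative[OF assms] .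
  show ?thesis unfolding fourier_cutoff_eq[OF g ae assms] by measurable
qed

text \<open>Stands in for the triangle inequality in L2; the factor 2 is harmless wherever only
  integrability or convergence to 0 is at stake.\<close>

lemma norm_diff_square_le:
  fixes a b c :: "'a::real_normed_vector"
  shows "(norm (a - b))\<^sup>2 \<le> 2 * (norm (c - a))\<^sup>2 + 2 * (norm (c - b))\<^sup>2"
proof -
  have "norm (a - b) \<le> norm (c - a) + norm (c - b)"
    using norm_triangle_ineq4[of "c - b" "c - a"] by simp
  then have "(norm (a - b))\<^sup>2 \<le> (norm (c - a) + norm (c - b))\<^sup>2" by (rule power_mono) simp
  also have "\<dots> \<le> 2 * (norm (c - a))\<^sup>2 + 2 * (norm (c - b))\<^sup>2"
    using sum_squares_bound[of "norm (c - a)" "norm (c - b)"] by (simp add: power2_sum)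
  finally show ?thesis .
qed

lemma nn_integral_norm_diff_square_le:
  fixes a b c :: "'x \<Rightarrow> 'a::{banach, second_countable_topology}"
  assumes [measurable]: "a \<in> borel_measurable M" "b \<in> borel_measurable M" "c \<in> borel_measurable M"
  shows "(\<integral>\<^sup>+ x. ennreal ((norm (a x - b x))\<^sup>2) \<partial>M)
    \<le> 2 * (\<integral>\<^sup>+ x. ennreal ((norm (c x - a x))\<^sup>2) \<partial>M) + 2 * (\<integral>\<^sup>+ x. ennreal ((norm (c x - b x))\<^sup>2) \<partial>M)"
proof -
  have "(\<integral>\<^sup>+ x. ennreal ((norm (a x - b x))\<^sup>2) \<partial>M)
    \<le> (\<integral>\<^sup>+ x. 2 * ennreal ((norm (c x - a x))\<^sup>2) + 2 * ennreal ((norm (c x - b x))\<^sup>2) \<partial>M)"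
  proof (rule nn_integral_mono)
    fix x
    have "ennreal ((norm (a x - b x))\<^sup>2) \<le> ennreal (2 * (norm (c x - a x))\<^sup>2 + 2 * (norm (c x - b x))\<^sup>2)"
      by (intro ennreal_leI norm_diff_square_le)
    then show "ennreal ((norm (a x - b x))\<^sup>2) \<le> 2 * ennreal ((norm (c x - a x))\<^sup>2) + 2 * ennreal ((norm (c x - b x))\<^sup>2)"
      by (simp add: ennreal_mult)
  qed
  also have "\<dots> = 2 * (\<integral>\<^sup>+ x. ennreal ((norm (c x - a x))\<^sup>2) \<partial>M) + 2 * (\<integral>\<^sup>+ x. ennreal ((norm (c x - b x))\<^sup>2) \<partial>M)"
    by (simp add: nn_integral_add nn_integral_cmult)
  finally show ?thesis .
qed

lemma is_fourier_transform_unique: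
  assumes "is_fourier_transform f g" "is_fourier_transform f g'"
  shows "AE p in lebesgue. g p = g' p"
proof -
  have f: "f \<in> borel_measurable lebesgue" and [measurable]: "g \<in> borel_measurable lebesgue" "g' \<in> borel_measurable lebesgue"
    and l: "((\<lambda>R. \<integral>\<^sup>+ p. ennreal ((norm (fourier_cutoff R f p - g p))\<^sup>2) \<partial>lebesgue) \<longlongrightarrow> 0) at_top"
      "((\<lambda>R. \<integral>\<^sup>+ p. ennreal ((norm (fourier_cutoff R f p - g' p))\<^sup>2) \<partial>lebesgue) \<longlongrightarrow> 0) at_top"
    using assms by (auto simp: is_fourier_transform_def L2_def)
  have [measurable]: "fourier_cutoff R f \<in> borel_measurable lebesgue" for R
    by (intro measurable_completion) (use fourier_cutoff_measurable[OF f] in simp)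
  have "((\<lambda>R. 2 * (\<integral>\<^sup>+ p. ennreal ((norm (fourier_cutoff R f p - g p))\<^sup>2) \<partial>lebesgue)
      + 2 * (\<integral>\<^sup>+ p. ennreal ((norm (fourier_cutoff R f p - g' p))\<^sup>2) \<partial>lebesgue)) \<longlongrightarrow> 2 * 0 + 2 * 0) at_top"
    by (intro tendsto_add ennreal_tendsto_cmult l) auto
  then have "(\<integral>\<^sup>+ p. ennreal ((norm (g p - g' p))\<^sup>2) \<partial>lebesgue) \<le> 2 * 0 + 2 * 0"
    by (rule tendsto_lowerbound)
       (auto intro!: always_eventually nn_integral_norm_diff_square_le)
  then have "(\<integral>\<^sup>+ p. ennreal ((norm (g p - g' p))\<^sup>2) \<partial>lebesgue) = 0" by simp
  then have "AE p in lebesgue. ennreal ((norm (g p - g' p))\<^sup>2) = 0"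
    by (subst (asm) nn_integral_0_iff_AE) measurable
  then show ?thesis by eventually_elim simp
qed

text \<open>Plancherel's identity on the ball of radius \<open>R\<close> turns the distance of the
  two cut-off transforms into \<open>J R\<close>, the squared norm of the truncated difference of
  representatives. \<open>J\<close> is increasing and bounded by a quantity tending to 0, hence it
  vanishes at every radius.\<close>

lemma is_fourier_transform_inj:
  assumes "is_fourier_transform f g" "is_fourier_transform f' g"
  shows "AE x in lebesgue. f x = f' x"
proof -
  have fL: "f \<in> L2" "f' \<in> L2" and f: "f \<in> borel_measurable lebesgue" "f' \<in> borel_measurable lebesgue"
    and [measurable]: "g \<in> borel_measurable lebesgue"
    and l: "((\<lambda>R. \<integral>\<^sup>+ p. ennreal ((norm (fourier_cutoff R f p - g p))\<^sup>2) \<partial>lebesgue) \<longlongrightarrow> 0) at_top"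
      "((\<lambda>R. \<integral>\<^sup>+ p. ennreal ((norm (fourier_cutoff R f' p - g p))\<^sup>2) \<partial>lebesgue) \<longlongrightarrow> 0) at_top"
    using assms by (auto simp: is_fourier_transform_def L2_def)
  obtain h where h [measurable]: "h \<in> borel_measurable borel" and ae: "AE x in lebesgue. f x = h x"
    and h2: "integrable lborel (\<lambda>x. (norm (h x))\<^sup>2)" using L2_representative[OF fL(1)] .
  obtain h' where h' [measurable]: "h' \<in> borel_measurable borel" and ae': "AE x in lebesgue. f' x = h' x"
    and h'2: "integrable lborel (\<lambda>x. (norm (h' x))\<^sup>2)" using L2_representative[OF fL(2)] .
  define d where "d x = h x - h' x" for x
  have d [measurable]: "d \<in> borel_measurable borel" unfolding d_def[abs_def] by measurable
  have d2: "integrable lborel (\<lambda>x. (norm (d x))\<^sup>2)"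
  proof (rule Bochner_Integration.integrable_bound)
    show "integrable lborel (\<lambda>x. 2 * (norm (h x))\<^sup>2 + 2 * (norm (h' x))\<^sup>2)" using h2 h'2 by simp
    have "(norm (d x))\<^sup>2 \<le> 2 * (norm (h x))\<^sup>2 + 2 * (norm (h' x))\<^sup>2" for x
      using norm_diff_square_le[of "h x" "h' x" 0] by (simp add: d_def)
    then show "AE x in lborel. norm ((norm (d x))\<^sup>2) \<le> norm (2 * (norm (h x))\<^sup>2 + 2 * (norm (h' x))\<^sup>2)"
      by (intro AE_I2) simp
  qed measurable
  have [measurable]: "fourier_cutoff R f \<in> borel_measurable lebesgue" "fourier_cutoff R f' \<in> borel_measurable lebesgue" for R
    by (intro measurable_completion; use fourier_cutoff_measurable f in simp)+
  define J where "J R = (\<integral>\<^sup>+ x. ennreal ((norm (truncate_ball R d x))\<^sup>2) \<partial>lborel)" for R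
  have cl: "truncate_ball R d \<in> compact_L2" "truncate_ball R h \<in> compact_L2" "truncate_ball R h' \<in> compact_L2" for R
    by (intro truncate_ball_compact_L2 d d2 h h2 h' h'2)+
  have J: "J R \<le> 2 * (\<integral>\<^sup>+ p. ennreal ((norm (fourier_cutoff R f p - g p))\<^sup>2) \<partial>lebesgue)
      + 2 * (\<integral>\<^sup>+ p. ennreal ((norm (fourier_cutoff R f' p - g p))\<^sup>2) \<partial>lebesgue)" for R
  proof -
    have i2: "integrable lborel (\<lambda>x. (norm (truncate_ball R d x))\<^sup>2)" using cl(1)[of R] by (simp add: compact_L2_def)
    have eq: "fourier_cutoff R f p - fourier_cutoff R f' p = fourier_const *\<^sub>R fourier_int (truncate_ball R d) p" for p
    proof -
      have "truncate_ball R d = (\<lambda>x. truncate_ball R h x - truncate_ball R h' x)"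
        by (auto simp: truncate_ball_def d_def scaleR_diff_right)
      then show ?thesis
        unfolding fourier_cutoff_eq[OF h ae f(1)] fourier_cutoff_eq[OF h' ae' f(2)]
        by (simp only: fourier_int_diff[OF compact_L2_integrable[OF cl(2)] compact_L2_integrable[OF cl(3)]] scaleR_diff_right)
    qed
    have "J R = ennreal (LINT x|lborel. (norm (truncate_ball R d x))\<^sup>2)"
      unfolding J_def by (rule nn_integral_eq_integral[OF i2]) auto
    also have "\<dots> = ennreal (fourier_const\<^sup>2) * ennreal ((2 * pi) ^ 3 * (LINT x|lborel. (norm (truncate_ball R d x))\<^sup>2))"
      using fourier_const_square by (subst ennreal_mult[symmetric]) (auto simp: mult.assoc[symmetric] integral_nonneg)
    also have "\<dots> = ennreal (fourier_const\<^sup>2) * (\<integral>\<^sup>+ p. ennreal ((norm (fourier_int (truncate_ball R d) p))\<^sup>2) \<partial>lborel)"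
      using plancherel[OF compact_L2_integrable[OF cl(1)] i2] by simp
    also have "\<dots> = (\<integral>\<^sup>+ p. ennreal ((norm (fourier_cutoff R f p - fourier_cutoff R f' p))\<^sup>2) \<partial>lebesgue)"
      unfolding eq nn_integral_completion
      by (subst nn_integral_cmult[symmetric]) (auto simp: power_mult_distrib ennreal_mult)
    also have "\<dots> \<le> 2 * (\<integral>\<^sup>+ p. ennreal ((norm (g p - fourier_cutoff R f p))\<^sup>2) \<partial>lebesgue)
      + 2 * (\<integral>\<^sup>+ p. ennreal ((norm (g p - fourier_cutoff R f' p))\<^sup>2) \<partial>lebesgue)"
      by (rule nn_integral_norm_diff_square_le) measurable
    finally show ?thesis by (simp add: norm_minus_commute)
  qed
  have "((\<lambda>R. 2 * (\<integral>\<^sup>+ p. ennreal ((norm (fourier_cutoff R f p - g p))\<^sup>2) \<partial>lebesgue)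
      + 2 * (\<integral>\<^sup>+ p. ennreal ((norm (fourier_cutoff R f' p - g p))\<^sup>2) \<partial>lebesgue)) \<longlongrightarrow> 2 * 0 + 2 * 0) at_top"
    by (intro tendsto_add ennreal_tendsto_cmult l) auto
  note L = this[simplified]
  have "J r = 0" for r
  proof -
    have "J r \<le> 0"
    proof (rule tendsto_lowerbound[OF L])
      show "\<forall>\<^sub>F R in at_top. J r \<le> 2 * (\<integral>\<^sup>+ p. ennreal ((norm (fourier_cutoff R f p - g p))\<^sup>2) \<partial>lebesgue)
      + 2 * (\<integral>\<^sup>+ p. ennreal ((norm (fourier_cutoff R f' p - g p))\<^sup>2) \<partial>lebesgue)"
        using eventually_ge_at_top[of r]
      proof eventually_elim
        case (elim R)
        have "J r \<le> J R" unfolding J_def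
          using elim by (intro nn_integral_mono ennreal_leI power_mono) (auto simp: truncate_ball_def indicator_def)
        then show ?case using J[of R] by (rule order_trans)
      qed
    qed simp
    then show ?thesis by simp
  qed
  then have "AE x in lborel. ennreal ((norm (truncate_ball r d x))\<^sup>2) = 0" for r
    unfolding J_def by (subst (asm) nn_integral_0_iff_AE) auto
  then have "AE x in lborel. \<forall>n::nat. ennreal ((norm (truncate_ball (real n) d x))\<^sup>2) = 0"
    by (simp add: AE_all_countable)
  then have "AE x in lborel. d x = 0"
  proof eventually_elim
    case (elim x)
    obtain n :: nat where "norm x \<le> real n" using real_arch_simple by blast
    with elim[rule_format, of n] show ?case by (simp add: truncate_ball_def)
  qed
  then have "AE x in lebesgue. d x = 0" by (simp add: AE_completion_iff)
  with ae ae' show ?thesis by eventually_elim (simp add: d_def)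
qed

lemma is_fourier_transform_AE:
  assumes ft: "is_fourier_transform f g" and ae: "AE x in lebesgue. g x = g' x"
  shows "is_fourier_transform f g'"
proof -
  from ft have f: "f \<in> L2" "g \<in> L2" and m: "g \<in> borel_measurable lebesgue"
    and l: "((\<lambda>R. \<integral>\<^sup>+ p. ennreal ((norm (fourier_cutoff R f p - g p))\<^sup>2) \<partial>lebesgue) \<longlongrightarrow> 0) at_top"
    by (auto simp: is_fourier_transform_def L2_def)
  have m': "g' \<in> borel_measurable lebesgue" by (rule borel_measurable_AE[OF m ae])
  have "integrable lebesgue (\<lambda>x. (norm (g' x))\<^sup>2)"
  proof (rule integrable_cong_AE_imp)
    show "integrable lebesgue (\<lambda>x. (norm (g x))\<^sup>2)" using f by (simp add: L2_def)
    show "(\<lambda>x. (norm (g' x))\<^sup>2) \<in> borel_measurable lebesgue" using m' by measurable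
    show "AE x in lebesgue. (norm (g x))\<^sup>2 = (norm (g' x))\<^sup>2"
      using ae by eventually_elim simp
  qed
  with m' have "g' \<in> L2" by (simp add: L2_def)
  moreover have "(\<integral>\<^sup>+ p. ennreal ((norm (fourier_cutoff R f p - g p))\<^sup>2) \<partial>lebesgue)
     = (\<integral>\<^sup>+ p. ennreal ((norm (fourier_cutoff R f p - g' p))\<^sup>2) \<partial>lebesgue)" for R
    using ae by (intro nn_integral_cong_AE) auto
  ultimately show ?thesis using f l by (simp add: is_fourier_transform_def)
qed

text \<open>Once the cut-off radius exceeds that of the support, the cut-off integral is the full
  one and the error is exactly 0.\<close>

lemma is_fourier_transform_compact:
  assumes f: "f \<in> L2" and g: "g \<in> compact_L2" and ae: "AE x in lebesgue. f x = g x"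
  shows "is_fourier_transform f (\<lambda>p. fourier_const *\<^sub>R fourier_int g p)"
proof -
  have [measurable]: "g \<in> borel_measurable borel" and g2: "integrable lborel (\<lambda>x. (norm (g x))\<^sup>2)"
    using g by (auto simp: compact_L2_def)
  obtain R0 where R0: "\<And>x. norm x > R0 \<Longrightarrow> g x = 0" using g by (auto simp: compact_L2_def)
  have m: "f \<in> borel_measurable lebesgue" using f by (simp add: L2_def)
  have "fourier_cutoff R f p - fourier_const *\<^sub>R fourier_int g p = 0" if "R \<ge> R0" for R p
  proof -
    have "truncate_ball R g = g"
      using R0 that by (force simp: truncate_ball_def indicator_def fun_eq_iff not_le)
    then show ?thesis by (simp add: fourier_cutoff_eq[OF _ ae m])
  qed
  then have ev: "eventually (\<lambda>R. (\<integral>\<^sup>+ p. ennreal ((norm (fourier_cutoff R f p - fourier_const *\<^sub>R fourier_int g p))\<^sup>2) \<partial>lebesgue) = 0) at_top"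
    by (intro eventually_mono[OF eventually_ge_at_top[of R0]]) simp
  have "(\<integral>\<^sup>+ p. ennreal ((norm (fourier_int g p))\<^sup>2) \<partial>lborel) < \<infinity>"
    unfolding plancherel[OF compact_L2_integrable[OF g] g2] by simp
  then have "integrable lborel (\<lambda>p. (norm (fourier_int g p))\<^sup>2)"
    by (intro integrableI_bounded) auto
  then have "(\<lambda>p. fourier_const *\<^sub>R fourier_int g p) \<in> L2"
    by (intro L2_I) (auto simp: power_mult_distrib)
  then show ?thesis
    using f ev unfolding is_fourier_transform_def by (auto intro: tendsto_eventually)
qed

text \<open>Pins down both choices by \<open>SOME\<close>: the explicit integrals are witnesses that
  make \<open>someI\<close> applicable, and uniqueness respectively injectivity identifies whatever
  was chosen with them.\<close>

lemma fourier_multiplier_eqI: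
  assumes \<psi>: "\<psi> \<in> L2" and \<phi>: "\<phi> \<in> compact_L2" and ae: "AE x in lebesgue. \<psi> x = \<phi> x"
    and f: "f \<in> compact_L2" and eq: "\<And>p. fourier_int f p = M p *v fourier_int \<phi> p"
  shows "AE x in lebesgue. fourier_multiplier M \<psi> x = f x"
proof -
  have ft: "is_fourier_transform \<psi> (\<lambda>p. fourier_const *\<^sub>R fourier_int \<phi> p)"
    by (rule is_fourier_transform_compact[OF \<psi> \<phi> ae])
  then have "is_fourier_transform \<psi> (fourier \<psi>)" unfolding fourier_def by (rule someI[where P="is_fourier_transform \<psi>"])
  then have "AE p in lebesgue. fourier_const *\<^sub>R fourier_int \<phi> p = fourier \<psi> p"
    using ft is_fourier_transform_unique by blast
  then have ae': "AE p in lebesgue. fourier_const *\<^sub>R fourier_int f p = M p *v fourier \<psi> p"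
  proof eventually_elim
    case (elim p)
    show ?case unfolding elim[symmetric] eq
      by (simp add: linear_scale[OF bounded_linear.linear[OF matrix_vector_mul_bounded_linear]])
  qed
  have fL: "f \<in> L2" using f by (auto simp: compact_L2_def intro: L2_I)
  \<comment> \<open>No measurability of \<open>M\<close> is assumed: that the product lies in
    \<open>L2\<close> comes from its agreement almost everywhere with the transform of
    \<open>f\<close>.\<close>
  have "is_fourier_transform f (\<lambda>p. M p *v fourier \<psi> p)"
    by (rule is_fourier_transform_AE[OF is_fourier_transform_compact[OF fL f] ae']) simp
  moreover from this have "is_fourier_transform (fourier_multiplier M \<psi>) (\<lambda>p. M p *v fourier \<psi> p)"
    unfolding fourier_multiplier_def inv_fourier_def
    by (rule someI[where P="\<lambda>f. is_fourier_transform f (\<lambda>p. M p *v fourier \<psi> p)"])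
  ultimately show ?thesis using is_fourier_transform_inj by blast
qed

section \<open>The support edge as an attained supremum\<close>

lemma support_edge_cong:
  assumes "AE x in lebesgue. f x = g x"
  shows "support_edge e f = support_edge e g"
proof -
  have "(AE x in lebesgue. indicator {x. ereal (x \<bullet> e) \<le> a} x *\<^sub>R f x = 0)
      \<longleftrightarrow> (AE x in lebesgue. indicator {x. ereal (x \<bullet> e) \<le> a} x *\<^sub>R g x = 0)" for a
    by (rule eventually_subst) (use assms in \<open>auto elim!: eventually_mono\<close>)
  then show ?thesis by (simp add: support_edge_def)
qed

text \<open>\<open>GREATEST\<close> is informative only if the maximum is attained. The supremum is
  approached by countably many admissible values, whose exceptional null sets can be united, and the
  remaining hyperplane at the supremum itself is a null set.\<close>

lemma support_edge_ge_iff: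
  assumes e: "e \<noteq> 0"
  shows "a \<le> support_edge e f \<longleftrightarrow> (AE x in lebesgue. ereal (x \<bullet> e) \<le> a \<longrightarrow> f x = 0)"
proof -
  define Q where "Q a \<longleftrightarrow> (AE x in lebesgue. ereal (x \<bullet> e) \<le> a \<longrightarrow> f x = 0)" for a
  have Q: "(AE x in lebesgue. indicator {x. ereal (x \<bullet> e) \<le> a} x *\<^sub>R f x = 0) \<longleftrightarrow> Q a" for a
    unfolding Q_def by (intro eventually_subst always_eventually) (auto simp: indicator_def)
  have mono: "Q a" if "Q b" "a \<le> b" for a b
    using that(1) unfolding Q_def by eventually_elim (use that(2) in auto)
  define s where "s = Sup (Collect Q)"
  have "Q (- \<infinity>)" by (simp add: Q_def)
  then have "Collect Q \<noteq> {}" by auto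
  from Sup_countable_SUP[OF this] obtain c :: "nat \<Rightarrow> ereal"
    where c: "range c \<subseteq> Collect Q" "s = (SUP n. c n)" unfolding s_def by metis
  have "AE x in lebesgue. ereal (x \<bullet> e) \<le> c n \<longrightarrow> f x = 0" for n
    using c(1) unfolding Q_def by blast
  then have 1: "AE x in lebesgue. \<forall>n. ereal (x \<bullet> e) \<le> c n \<longrightarrow> f x = 0"
    by (simp only: AE_all_countable) simp
  have 2: "AE x in lebesgue. x \<bullet> e \<noteq> r" for r
  proof -
    have "negligible {x. e \<bullet> x = r}" using e by (rule negligible_hyperplane[OF disjI1])
    then have "{x. e \<bullet> x = r} \<in> null_sets lebesgue" by (simp add: negligible_iff_null_sets)
    then show ?thesis by (rule AE_I') (auto simp: inner_commute)
  qed
  \<comment> \<open>For infinite \<open>s\<close> the value \<open>real_of_ereal s\<close> is 0,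
    which does no harm: the finite number \<open>x \<bullet> e\<close> then differs from
    \<open>s\<close> anyway.\<close>
  have "Q s" unfolding Q_def using 1 2[of "real_of_ereal s"]
  proof eventually_elim
    case (elim x)
    show ?case
    proof
      assume "ereal (x \<bullet> e) \<le> s"
      moreover have "ereal (x \<bullet> e) \<noteq> s" using elim(2) by auto
      ultimately have "ereal (x \<bullet> e) < (SUP n. c n)" using c(2) by auto
      then obtain n where "ereal (x \<bullet> e) < c n" by (auto simp: less_SUP_iff)
      then show "f x = 0" using elim(1) by (auto intro: less_imp_le)
    qed
  qed
  moreover have "a \<le> s" if "Q a" for a using that unfolding s_def by (auto intro: Sup_upper)
  ultimately have "support_edge e f = s"
    unfolding support_edge_def Q by (intro Greatest_equality) auto
  then show ?thesis unfolding Q_def[symmetric]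
    using mono \<open>Q s\<close> \<open>\<And>a. Q a \<Longrightarrow> a \<le> s\<close> by blast
qed

section \<open>The Trotter product formula\<close>

lemmas scaleR_complex_conv = scaleR_conv_of_real[where 'a = complex]

lemma hermitian_cnj_nth:
  fixes A :: matrix4
  assumes "hermitian A"
  shows "cnj (A $ i $ j) = A $ j $ i"
proof -
  have "map_matrix cnj (transpose A) $ j $ i = A $ j $ i" using assms by (simp add: hermitian_def)
  then show ?thesis by (simp add: transpose_def)
qed

lemma hermitian_inner:
  assumes "hermitian A"
  shows "(A *v u) \<bullet> v = u \<bullet> (A *v v)"
proof -
  note h = hermitian_cnj_nth[OF assms]
  have i: "x \<bullet> y = Re (x * cnj y)" for x y :: complex by (simp add: inner_complex_def)
  have "(A *v u) \<bullet> v = (\<Sum>i\<in>UNIV. \<Sum>j\<in>UNIV. Re (A $ i $ j * u $ j * cnj (v $ i)))"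
    by (simp only: inner_vec_def i matrix_vector_mult_def vec_lambda_beta sum_distrib_right Re_sum)
  also have "\<dots> = (\<Sum>j\<in>UNIV. \<Sum>i\<in>UNIV. Re (A $ i $ j * u $ j * cnj (v $ i)))"
    by (rule sum.swap)
  also have "\<dots> = (\<Sum>j\<in>UNIV. \<Sum>i\<in>UNIV. Re (u $ j * cnj (A $ j $ i * v $ i)))"
    by (simp only: complex_cnj_mult h mult_ac)
  also have "\<dots> = u \<bullet> (A *v v)"
    by (simp only: inner_vec_def i matrix_vector_mult_def vec_lambda_beta cnj_sum sum_distrib_left Re_sum)
  finally show ?thesis .
qed

text \<open>For a Hermitian involution \<open>A\<close> this is the action of \<open>exp (i s A)\<close>.\<close>

definition rot :: "real \<Rightarrow> matrix4 \<Rightarrow> complex ^ 4 \<Rightarrow> complex ^ 4" where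
  "rot s A u = of_real (cos s) *s u + (\<i> * of_real (sin s)) *s (A *v u)"

definition hermitian_involution :: "matrix4 \<Rightarrow> bool" where
  "hermitian_involution A \<longleftrightarrow> hermitian A \<and> A ** A = mat 1"

lemma involution_apply: "hermitian_involution A \<Longrightarrow> A *v (A *v u) = u"
  by (simp add: hermitian_involution_def matrix_vector_mul_assoc)

lemma smult_of_real: "of_real c *s (v :: complex ^ 'n) = c *\<^sub>R v"
  by (simp add: vec_eq_iff scaleR_complex_conv)

lemma inner_ii: "(\<i> *s a) \<bullet> b = - (a \<bullet> (\<i> *s b))" for a b :: "complex ^ 'n"
  by (simp add: inner_vec_def inner_complex_def sum_negf[symmetric])

lemma norm_involution:
  assumes "hermitian_involution A"
  shows "norm (A *v u) = norm u"
proof -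
  have "(A *v u) \<bullet> (A *v u) = u \<bullet> u"
    using assms by (subst hermitian_inner) (auto simp: hermitian_involution_def matrix_vector_mul_assoc)
  then show ?thesis by (simp add: norm_eq_sqrt_inner)
qed

text \<open>For Hermitian \<open>A\<close> the vectors u and i A u are orthogonal in the real inner
  product, and for an involution they have equal length; Pythagoras does the rest.\<close>

lemma norm_rot:
  assumes A: "hermitian_involution A"
  shows "norm (rot s A u) = norm u"
proof -
  have "u \<bullet> (\<i> *s (A *v u)) = (A *v u) \<bullet> (\<i> *s u)"
    using A by (subst hermitian_inner) (auto simp: hermitian_involution_def vector_scalar_commute)
  then have 0: "u \<bullet> (\<i> *s (A *v u)) = 0"
    using inner_ii[of u "A *v u"] by (simp add: inner_commute)
  have r: "rot s A u = cos s *\<^sub>R u + sin s *\<^sub>R (\<i> *s (A *v u))"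
    by (simp add: rot_def smult_of_real[symmetric] vector_smult_assoc mult.commute)
  have n: "(\<i> *s (A *v u)) \<bullet> (\<i> *s (A *v u)) = u \<bullet> u"
    using norm_vector_smult[of \<i> "A *v u"] norm_involution[OF A, of u] by (simp add: norm_eq_sqrt_inner)
  have "rot s A u \<bullet> rot s A u = (cos s)\<^sup>2 * (u \<bullet> u) + (sin s)\<^sup>2 * (u \<bullet> u)"
    unfolding r by (simp add: inner_add_left inner_add_right 0 n inner_commute[of "\<i> *s (A *v u)" u]
        power2_eq_square mult.assoc)
  also have "\<dots> = u \<bullet> u" by (simp add: distrib_right[symmetric])
  finally show ?thesis by (simp add: norm_eq_sqrt_inner)
qed

lemma rot_diff: "rot s A (u - v) = rot s A u - rot s A v"
  by (simp add: rot_def vector_ssub_ldistrib matrix_vector_mult_diff_distrib)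

lemma rot_rot:
  assumes A: "hermitian_involution A"
  shows "rot a A (rot b A u) = rot (a + b) A u"
  unfolding rot_def
  by (simp add: matrix_vector_right_distrib vector_scalar_commute involution_apply[OF A] vec_eq_iff
      cos_add sin_add algebra_simps)

lemma rot_0: "rot 0 A u = u" by (simp add: rot_def)

lemma rot_funpow:
  assumes A: "hermitian_involution A"
  shows "(rot s A ^^ n) u = rot (real n * s) A u"
  by (induction n) (simp_all add: rot_0 rot_rot[OF A] algebra_simps)

text \<open>The consistency condition for a Trotter step with generator \<open>B\<close>: local
  error of second order in the step size, relative to the norm of the vector.\<close>

definition second_order :: "(real \<Rightarrow> 'a::real_normed_vector \<Rightarrow> 'a) \<Rightarrow> ('a \<Rightarrow> 'a) \<Rightarrow> bool" where
  "second_order X B \<longleftrightarrow> bounded_linear B \<and>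
     (\<exists>K\<ge>0. \<forall>s u. \<bar>s\<bar> \<le> 1 \<longrightarrow> norm (X s u - u - s *\<^sub>R B u) \<le> K * s\<^sup>2 * norm u)"

text \<open>Generators add under composition, because their failure to commute is visible only at
  order s^2.\<close>

lemma second_order_comp:
  assumes X: "second_order X B" and Y: "second_order Y C"
  shows "second_order (\<lambda>s u. X s (Y s u)) (\<lambda>u. B u + C u)"
proof -
  have B: "bounded_linear B" and C: "bounded_linear C" using assms by (auto simp: second_order_def)
  obtain b where b: "b \<ge> 0" "\<And>u. norm (B u) \<le> norm u * b"
    using bounded_linear.nonneg_bounded[OF B] by metis
  obtain c where c: "c \<ge> 0" "\<And>u. norm (C u) \<le> norm u * c"
    using bounded_linear.nonneg_bounded[OF C] by metis
  obtain K where K: "K \<ge> 0" "\<And>s u. \<bar>s\<bar> \<le> 1 \<Longrightarrow> norm (X s u - u - s *\<^sub>R B u) \<le> K * s\<^sup>2 * norm u"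
    using X unfolding second_order_def by metis
  obtain L where L: "L \<ge> 0" "\<And>s u. \<bar>s\<bar> \<le> 1 \<Longrightarrow> norm (Y s u - u - s *\<^sub>R C u) \<le> L * s\<^sup>2 * norm u"
    using Y unfolding second_order_def by metis
  have "norm (X s (Y s u) - u - s *\<^sub>R (B u + C u)) \<le> (K * (1 + (c + L)) + L + b * (c + L)) * s\<^sup>2 * norm u"
    if s: "\<bar>s\<bar> \<le> 1" for s u
  proof -
    define v where "v = Y s u"
    have "s\<^sup>2 \<le> \<bar>s\<bar>" using s mult_left_le[of "\<bar>s\<bar>" "\<bar>s\<bar>"] by (simp add: power2_eq_square)
    then have "L * s\<^sup>2 * norm u \<le> L * \<bar>s\<bar> * norm u" using L by (intro mult_right_mono mult_left_mono) auto
    then have w: "norm (v - u - s *\<^sub>R C u) \<le> L * \<bar>s\<bar> * norm u" using L(2)[OF s, of u] by (simp add: v_def)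
    have "norm (v - u) \<le> norm (v - u - s *\<^sub>R C u) + norm (s *\<^sub>R C u)"
      using norm_triangle_ineq[of "v - u - s *\<^sub>R C u" "s *\<^sub>R C u"] by simp
    also have "\<dots> \<le> L * \<bar>s\<bar> * norm u + \<bar>s\<bar> * (norm u * c)"
      using w c(2)[of u] by (auto intro!: add_mono mult_left_mono)
    finally have vu: "norm (v - u) \<le> (c + L) * \<bar>s\<bar> * norm u" by (simp add: algebra_simps)
    also have "\<dots> \<le> (c + L) * 1 * norm u"
      using s c L by (intro mult_right_mono mult_left_mono) auto
    finally have v: "norm v \<le> (1 + (c + L)) * norm u"
      using norm_triangle_ineq[of u "v - u"] by (simp add: algebra_simps)
    \<comment> \<open>Local error of \<open>X\<close> at \<open>v\<close>, local error of
      \<open>Y\<close> at \<open>u\<close>, and the effect of evaluating \<open>B\<close> at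
      \<open>v\<close> instead of \<open>u\<close>; the last has a prefactor \<open>s\<close> and a
      difference of order \<open>s\<close>.\<close>
    have e: "X s v - u - s *\<^sub>R (B u + C u) = (X s v - v - s *\<^sub>R B v) + (v - u - s *\<^sub>R C u) + s *\<^sub>R B (v - u)"
      by (simp add: linear_diff[OF bounded_linear.linear[OF B]] algebra_simps)
    have "norm (X s v - v - s *\<^sub>R B v) \<le> K * s\<^sup>2 * norm v" by (rule K(2)[OF s])
    also have "\<dots> \<le> K * s\<^sup>2 * ((1 + (c + L)) * norm u)" using K v by (intro mult_left_mono) auto
    finally have 1: "norm (X s v - v - s *\<^sub>R B v) \<le> K * (1 + (c + L)) * s\<^sup>2 * norm u" by (simp add: mult_ac)
    have 2: "norm (v - u - s *\<^sub>R C u) \<le> L * s\<^sup>2 * norm u" using L(2)[OF s, of u] by (simp add: v_def)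
    have "norm (s *\<^sub>R B (v - u)) \<le> \<bar>s\<bar> * (norm (v - u) * b)" using b(2)[of "v - u"] by (auto intro: mult_left_mono)
    also have "\<dots> \<le> \<bar>s\<bar> * ((c + L) * \<bar>s\<bar> * norm u * b)" using b vu by (intro mult_left_mono mult_right_mono) auto
    finally have 3: "norm (s *\<^sub>R B (v - u)) \<le> b * (c + L) * s\<^sup>2 * norm u" by (simp add: power2_eq_square mult_ac)
    show ?thesis unfolding v_def[symmetric] e
      using norm_triangle_ineq[of "X s v - v - s *\<^sub>R B v" "v - u - s *\<^sub>R C u"]
        norm_triangle_ineq[of "X s v - v - s *\<^sub>R B v + (v - u - s *\<^sub>R C u)" "s *\<^sub>R B (v - u)"] 1 2 3
      by (simp add: distrib_right)
  qed
  moreover have "0 \<le> K * (1 + (c + L)) + L + b * (c + L)" using K b c L by simp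
  ultimately show ?thesis
    unfolding second_order_def by (blast intro: bounded_linear_add B C)
qed

lemma bounded_linear_smult_matrix: "bounded_linear (\<lambda>u. c *s (A *v u))" for A :: "complex ^ 'n ^ 'm"
  by (rule bounded_linear_compose[OF bounded_linear_smult matrix_vector_mul_bounded_linear])

text \<open>cos x - 1 and sin x - x are the real and imaginary parts of exp(i x) - 1 - i x, hence
  both at most x^2 / 2 in absolute value; with x = s a their sum gives the constant
  \<open>a\<^sup>2\<close>.\<close>

lemma second_order_rot:
  assumes A: "hermitian_involution A"
  shows "second_order (\<lambda>s. rot (s * a) A) (\<lambda>u. (\<i> * of_real a) *s (A *v u))"
  unfolding second_order_def
proof (intro conjI exI[of _ "a\<^sup>2"] allI impI bounded_linear_smult_matrix)
  fix s :: real and u assume "\<bar>s\<bar> \<le> 1"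
  let ?x = "s * a"
  have "cmod (iexp ?x - (\<Sum>k \<le> 1. (\<i> * ?x) ^ k / fact k)) \<le> \<bar>?x\<bar> ^ Suc 1 / fact (Suc 1)"
    by (rule iexp_approx1)
  moreover have "iexp ?x - (\<Sum>k \<le> 1. (\<i> * ?x) ^ k / fact k) = Complex (cos ?x - 1) (sin ?x - ?x)"
    by (simp add: complex_eq_iff Re_exp Im_exp)
  ultimately have c: "cmod (Complex (cos ?x - 1) (sin ?x - ?x)) \<le> ?x\<^sup>2 / 2"
    by (simp add: power2_eq_square abs_mult[symmetric])
  have c1: "\<bar>cos ?x - 1\<bar> \<le> ?x\<^sup>2 / 2" using order_trans[OF abs_Re_le_cmod c] by simp
  have c2: "\<bar>sin ?x - ?x\<bar> \<le> ?x\<^sup>2 / 2" using order_trans[OF abs_Im_le_cmod c] by simp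
  have e: "rot ?x A u - u - s *\<^sub>R ((\<i> * of_real a) *s (A *v u))
     = of_real (cos ?x - 1) *s u + (\<i> * of_real (sin ?x - ?x)) *s (A *v u)"
    by (simp add: rot_def vec_eq_iff scaleR_complex_conv algebra_simps)
  have "norm (rot ?x A u - u - s *\<^sub>R ((\<i> * of_real a) *s (A *v u)))
      \<le> \<bar>cos ?x - 1\<bar> * norm u + \<bar>sin ?x - ?x\<bar> * norm u"
  proof -
    have n: "norm (of_real r *s v) = \<bar>r\<bar> * norm v" "norm ((\<i> * of_real r) *s v) = \<bar>r\<bar> * norm v"
      for r and v :: "complex ^ 4"
      by (simp_all add: norm_vector_smult norm_mult)
    show ?thesis
      unfolding e by (rule order_trans[OF norm_triangle_ineq]) (simp only: n norm_involution[OF A])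
  qed
  also have "\<dots> \<le> ?x\<^sup>2 / 2 * norm u + ?x\<^sup>2 / 2 * norm u"
    using c1 c2 by (intro add_mono mult_right_mono) auto
  also have "\<dots> = a\<^sup>2 * s\<^sup>2 * norm u" by (simp add: power_mult_distrib)
  finally show "norm (rot ?x A u - u - s *\<^sub>R ((\<i> * of_real a) *s (A *v u))) \<le> a\<^sup>2 * s\<^sup>2 * norm u" .
qed simp

lemma second_order_diff:
  assumes "second_order X B" "second_order Y B"
  obtains K where "K \<ge> 0" "\<And>s u. \<bar>s\<bar> \<le> 1 \<Longrightarrow> norm (X s u - Y s u) \<le> K * s\<^sup>2 * norm u"
proof -
  obtain K where K: "K \<ge> 0" "\<And>s u. \<bar>s\<bar> \<le> 1 \<Longrightarrow> norm (X s u - u - s *\<^sub>R B u) \<le> K * s\<^sup>2 * norm u"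
    using assms(1) unfolding second_order_def by metis
  obtain L where L: "L \<ge> 0" "\<And>s u. \<bar>s\<bar> \<le> 1 \<Longrightarrow> norm (Y s u - u - s *\<^sub>R B u) \<le> L * s\<^sup>2 * norm u"
    using assms(2) unfolding second_order_def by metis
  have "norm (X s u - Y s u) \<le> (K + L) * s\<^sup>2 * norm u" if "\<bar>s\<bar> \<le> 1" for s u
  proof -
    have "norm (X s u - Y s u) \<le> norm (X s u - u - s *\<^sub>R B u) + norm (Y s u - u - s *\<^sub>R B u)"
      using norm_triangle_ineq4[of "X s u - u - s *\<^sub>R B u" "Y s u - u - s *\<^sub>R B u"] by simp
    also have "\<dots> \<le> K * s\<^sup>2 * norm u + L * s\<^sup>2 * norm u" using K(2)[OF that] L(2)[OF that] by (intro add_mono)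
    finally show ?thesis by (simp add: algebra_simps)
  qed
  then show thesis using that[of "K + L"] K L by auto
qed

text \<open>Telescoping: each new defect is measured at an iterate of \<open>Y\<close>, which has
  the norm of \<open>u\<close>, and \<open>X\<close> carries the older errors along without
  enlarging them.\<close>

lemma funpow_norm_diff:
  fixes X Y :: "'a::real_normed_vector \<Rightarrow> 'a"
  assumes X: "\<And>u v. norm (X u - X v) = norm (u - v)" and Y: "\<And>u. norm (Y u) = norm u"
    and d: "\<And>u. norm (X u - Y u) \<le> d * norm u"
  shows "norm ((X ^^ n) u - (Y ^^ n) u) \<le> real n * d * norm u"
proof (induction n)
  case (Suc n)
  have Yn: "norm ((Y ^^ n) u) = norm u" by (induction n) (simp_all add: Y)
  have "norm ((X ^^ Suc n) u - (Y ^^ Suc n) u)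
      \<le> norm (X ((X ^^ n) u) - X ((Y ^^ n) u)) + norm (X ((Y ^^ n) u) - Y ((Y ^^ n) u))"
    using norm_triangle_ineq[of "X ((X ^^ n) u) - X ((Y ^^ n) u)" "X ((Y ^^ n) u) - Y ((Y ^^ n) u)"] by simp
  also have "\<dots> \<le> real n * d * norm u + d * norm u"
    using Suc d[of "(Y ^^ n) u"] by (simp add: X Yn)
  finally show ?case by (simp add: algebra_simps)
qed simp

text \<open>The Dirac symbol at a complex momentum \<open>v\<close>. It is in general no longer
  Hermitian there, but the Clifford relations still determine its square.\<close>

definition dirac_op :: "(3 \<Rightarrow> matrix4) \<Rightarrow> matrix4 \<Rightarrow> real \<Rightarrow> complex ^ 3 \<Rightarrow> complex ^ 4 \<Rightarrow> complex ^ 4" where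
  "dirac_op \<alpha> \<beta> m v u = (\<Sum>k\<in>UNIV. (v $ k) *s (\<alpha> k *v u)) + of_real m *s (\<beta> *v u)"

lemma dirac_symbol_apply: "dirac_symbol \<alpha> \<beta> m p *v u = dirac_op \<alpha> \<beta> m (\<chi> k. of_real (p $ k)) u"
proof -
  have s: "(c *\<^sub>R A) *v u = of_real c *s (A *v u)" for c and A :: matrix4
    by (simp add: vec_eq_iff matrix_vector_mult_def scaleR_complex_conv sum_distrib_left mult.assoc)
  show ?thesis
    by (simp add: dirac_symbol_def dirac_op_def sum_3 matrix_vector_mult_add_rdistrib s)
qed

context
  fixes \<alpha> :: "3 \<Rightarrow> matrix4" and \<beta> :: matrix4 and m :: real
begin

definition energy :: "real ^ 3 \<Rightarrow> real" where
  "energy p = sqrt (p \<bullet> p + m\<^sup>2)"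

definition unit_symbol :: "real ^ 3 \<Rightarrow> matrix4" where
  "unit_symbol p = (1 / energy p) *\<^sub>R dirac_symbol \<alpha> \<beta> m p"

text \<open>One Trotter step of exp(i s h(p)), with one factor for each of the four anticommuting
  summands of h(p).\<close>

definition split_step :: "real ^ 3 \<Rightarrow> real \<Rightarrow> complex ^ 4 \<Rightarrow> complex ^ 4" where
  "split_step p s u = rot (s * p $ 1) (\<alpha> 1) (rot (s * p $ 2) (\<alpha> 2) (rot (s * p $ 3) (\<alpha> 3) (rot (s * m) \<beta> u)))"

context
  assumes D: "dirac_matrices \<alpha> \<beta>"
begin

lemma alpha_involution: "hermitian_involution (\<alpha> k)"
proof -
  have "\<alpha> k ** \<alpha> k + \<alpha> k ** \<alpha> k = mat 2" using D by (simp add: dirac_matrices_def)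
  then have "2 * (\<alpha> k ** \<alpha> k) $ i $ j = 2 * (mat 1 :: matrix4) $ i $ j" for i j
    by (simp add: vec_eq_iff mat_def)
  then have "\<alpha> k ** \<alpha> k = mat 1" by (simp add: vec_eq_iff)
  then show ?thesis using D by (simp add: hermitian_involution_def dirac_matrices_def)
qed

lemma beta_involution: "hermitian_involution \<beta>"
  using D by (simp add: hermitian_involution_def dirac_matrices_def)

lemma alpha_anticommute: "j \<noteq> k \<Longrightarrow> \<alpha> j *v (\<alpha> k *v u) = - (\<alpha> k *v (\<alpha> j *v u))"
proof -
  assume "j \<noteq> k"
  then have "(\<alpha> j ** \<alpha> k + \<alpha> k ** \<alpha> j) *v u = 0" using D by (simp add: dirac_matrices_def)
  then show ?thesis
    by (simp add: matrix_vector_mult_add_rdistrib matrix_vector_mul_assoc eq_neg_iff_add_eq_0)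
qed

lemma beta_anticommute: "\<beta> *v (\<alpha> k *v u) = - (\<alpha> k *v (\<beta> *v u))"
proof -
  have "(\<alpha> k ** \<beta> + \<beta> ** \<alpha> k) *v u = 0" using D by (simp add: dirac_matrices_def)
  then show ?thesis
    by (simp add: matrix_vector_mult_add_rdistrib matrix_vector_mul_assoc eq_neg_iff_add_eq_0 add.commute)
qed

lemma dirac_op_square:
  "dirac_op \<alpha> \<beta> m v (dirac_op \<alpha> \<beta> m v u) = ((\<Sum>k\<in>UNIV. (v $ k)\<^sup>2) + (of_real m)\<^sup>2) *s u"
proof -
  note i = involution_apply[OF alpha_involution] involution_apply[OF beta_involution]
  \<comment> \<open>Oriented so that rewriting sorts the factors by index; the mixed products then
    cancel in pairs.\<close>
  have a: "\<alpha> 2 *v (\<alpha> 1 *v u) = - (\<alpha> 1 *v (\<alpha> 2 *v u))" "\<alpha> 3 *v (\<alpha> 1 *v u) = - (\<alpha> 1 *v (\<alpha> 3 *v u))"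
    "\<alpha> 3 *v (\<alpha> 2 *v u) = - (\<alpha> 2 *v (\<alpha> 3 *v u))"
    by (rule alpha_anticommute, simp)+
  show ?thesis
    unfolding dirac_op_def sum_3
    by (simp add: matrix_vector_right_distrib vector_scalar_commute i a beta_anticommute
        vec_eq_iff power2_eq_square algebra_simps)
qed

context
  assumes m: "m > 0"
begin

lemma energy_pos: "energy p > 0"
  using m by (simp add: energy_def add_nonneg_pos)

lemma energy_square: "(energy p)\<^sup>2 = p \<bullet> p + m\<^sup>2"
  by (simp add: energy_def)

lemma symbol_conv_unit: "dirac_symbol \<alpha> \<beta> m p = energy p *\<^sub>R unit_symbol p"
  using energy_pos[of p] by (simp add: unit_symbol_def)

lemma unit_symbol_apply: "of_real (energy p) *s (unit_symbol p *v u) = dirac_op \<alpha> \<beta> m (\<chi> k. of_real (p $ k)) u"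
proof -
  have s: "(c *\<^sub>R A) *v u = of_real c *s (A *v u)" for c and A :: matrix4
    by (simp add: vec_eq_iff matrix_vector_mult_def scaleR_complex_conv sum_distrib_left mult.assoc)
  show ?thesis unfolding dirac_symbol_apply[symmetric] by (simp add: symbol_conv_unit s)
qed

lemma unit_symbol_involution: "hermitian_involution (unit_symbol p)"
proof -
  note h = hermitian_cnj_nth
  have hs: "hermitian (\<alpha> k)" "hermitian \<beta>" for k using D by (auto simp: dirac_matrices_def)
  have "hermitian (unit_symbol p)"
    unfolding hermitian_def unit_symbol_def dirac_symbol_def sum_3
    by (simp add: vec_eq_iff transpose_def h[OF hs(1)] h[OF hs(2)])
  moreover have "unit_symbol p *v (unit_symbol p *v u) = u" for u
  proof -
    let ?e = "complex_of_real (energy p)"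
    have "(?e * ?e) *s (unit_symbol p *v (unit_symbol p *v u))
        = ?e *s (unit_symbol p *v (?e *s (unit_symbol p *v u)))"
      by (simp add: vector_scalar_commute vector_smult_assoc)
    also have "\<dots> = ((\<Sum>k\<in>UNIV. (of_real (p $ k))\<^sup>2) + (of_real m)\<^sup>2) *s u"
      unfolding unit_symbol_apply dirac_op_square by simp
    also have "(\<Sum>k\<in>UNIV. (complex_of_real (p $ k))\<^sup>2) + (of_real m)\<^sup>2 = ?e * ?e"
      using energy_square[of p]
      by (simp add: inner_vec_def power2_eq_square flip: of_real_mult of_real_add of_real_sum)
    finally have "(?e * ?e) *s (unit_symbol p *v (unit_symbol p *v u)) = (?e * ?e) *s u" .
    then show ?thesis using energy_pos[of p] by (simp add: vec_eq_iff)
  qed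
  then have "unit_symbol p ** unit_symbol p = mat 1"
    by (simp add: matrix_eq flip: matrix_vector_mul_assoc)
  ultimately show ?thesis by (simp add: hermitian_involution_def)
qed

text \<open>\<open>exp (i t h(p)) = cos (t \<epsilon>) + i sin (t \<epsilon>) h(p) / \<epsilon>\<close> with \<open>\<epsilon> = energy p\<close>, since \<open>h(p)\<^sup>2 = \<epsilon>\<^sup>2\<close>.\<close>

lemma mat_exp_symbol:
  "mat_exp (map_matrix ((*) (\<i> * complex_of_real t)) (dirac_symbol \<alpha> \<beta> m p)) *v u
    = rot (t * energy p) (unit_symbol p) u"
proof -
  define B where "B = unit_symbol p"
  define x where "x = \<i> * complex_of_real (t * energy p)"
  define sc where "sc c A = map_matrix ((*) c) A" for c and A :: matrix4
  define A where "A = map_matrix ((*) (\<i> * complex_of_real t)) (dirac_symbol \<alpha> \<beta> m p)"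
  have BB: "B ** B = mat 1" using unit_symbol_involution[of p] by (simp add: B_def hermitian_involution_def)
  have A: "A = sc x B"
    by (simp add: A_def sc_def x_def B_def symbol_conv_unit vec_eq_iff scaleR_complex_conv)
  have sc_mult: "sc a M ** sc b M' = sc (a * b) (M ** M')" for a b M M'
    by (simp add: sc_def vec_eq_iff matrix_matrix_mult_def sum_distrib_left mult_ac)
  \<comment> \<open>\<open>B\<close> squares to the identity, so even powers are multiples of
    \<open>mat 1\<close> and odd powers multiples of \<open>B\<close>. The even and odd halves of
    the exponential series are then summed as the half-sum and half-difference of exp(x) and
    exp(-x).\<close>
  have pw: "((**) A ^^ n) (mat 1) = sc (if even n then x ^ n else 0) (mat 1) + sc (if even n then 0 else x ^ n) B" for n
  proof (induction n)
    case 0 show ?case by (simp add: sc_def vec_eq_iff)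
  next
    case (Suc n)
    have z: "sc 0 M = 0" for M by (simp add: sc_def vec_eq_iff)
    show ?case
    proof (cases "even n")
      case True
      then have "((**) A ^^ n) (mat 1) = sc (x ^ n) (mat 1)" using Suc by (simp add: z)
      then show ?thesis using True by (simp add: z A sc_mult)
    next
      case False
      then have "((**) A ^^ n) (mat 1) = sc (x ^ n) B" using Suc by (simp add: z)
      then show ?thesis using False by (simp add: z A sc_mult BB)
    qed
  qed
  have bl: "bounded_linear (\<lambda>c. sc c M)" for M
  proof (rule bounded_linear_intro)
    show "norm (sc c M) \<le> norm c * norm M" for c
    proof -
      have "norm (sc c M $ i) = norm c * norm (M $ i)" for i
        by (simp add: sc_def norm_vec_def L2_set_def norm_mult power_mult_distrib real_sqrt_mult flip: sum_distrib_left)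
      then show ?thesis
        by (simp add: norm_vec_def[of "sc c M"] norm_vec_def[of M] L2_set_def power_mult_distrib real_sqrt_mult flip: sum_distrib_left)
    qed
  qed (simp_all add: sc_def vec_eq_iff algebra_simps scaleR_complex_conv)
  have e1: "(\<lambda>n. x ^ n /\<^sub>R fact n) sums exp x" and e2: "(\<lambda>n. (- x) ^ n /\<^sub>R fact n) sums exp (- x)"
    by (rule exp_converges)+
  have ex: "exp x = cis (t * energy p)" "exp (- x) = cis (- (t * energy p))"
    by (simp_all add: x_def cis_conv_exp)
  have "(\<lambda>n. (x ^ n /\<^sub>R fact n + (- x) ^ n /\<^sub>R fact n) / 2) sums ((exp x + exp (- x)) / 2)"
    by (intro sums_divide sums_add e1 e2)
  moreover have "(x ^ n /\<^sub>R fact n + (- x) ^ n /\<^sub>R fact n) / 2 = (if even n then x ^ n else 0) /\<^sub>R fact n" for n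
    by (simp add: field_simps)
  moreover have "(exp x + exp (- x)) / 2 = of_real (cos (t * energy p))"
    by (simp add: ex complex_eq_iff)
  ultimately have c: "(\<lambda>n. (if even n then x ^ n else 0) /\<^sub>R fact n) sums of_real (cos (t * energy p))" by simp
  have "(\<lambda>n. (x ^ n /\<^sub>R fact n - (- x) ^ n /\<^sub>R fact n) / 2) sums ((exp x - exp (- x)) / 2)"
    by (intro sums_divide sums_diff e1 e2)
  moreover have "(x ^ n /\<^sub>R fact n - (- x) ^ n /\<^sub>R fact n) / 2 = (if even n then 0 else x ^ n) /\<^sub>R fact n" for n
    by (simp add: field_simps)
  moreover have "(exp x - exp (- x)) / 2 = \<i> * of_real (sin (t * energy p))"
    by (simp add: ex complex_eq_iff)
  ultimately have s: "(\<lambda>n. (if even n then 0 else x ^ n) /\<^sub>R fact n) sums (\<i> * of_real (sin (t * energy p)))" by simp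
  have "(\<lambda>n. sc ((if even n then x ^ n else 0) /\<^sub>R fact n) (mat 1) + sc ((if even n then 0 else x ^ n) /\<^sub>R fact n) B)
     sums (sc (of_real (cos (t * energy p))) (mat 1) + sc (\<i> * of_real (sin (t * energy p))) B)"
    by (intro sums_add bounded_linear.sums[OF bl] c s)
  moreover have "sc ((if even n then x ^ n else 0) /\<^sub>R fact n) (mat 1) + sc ((if even n then 0 else x ^ n) /\<^sub>R fact n) B
     = (1 / fact n) *\<^sub>R ((**) A ^^ n) (mat 1)" for n
    by (simp only: pw linear_scale[OF bounded_linear.linear[OF bl]] scaleR_add_right inverse_eq_divide)
  ultimately have "(\<lambda>n. (1 / fact n) *\<^sub>R ((**) A ^^ n) (mat 1))
     sums (sc (of_real (cos (t * energy p))) (mat 1) + sc (\<i> * of_real (sin (t * energy p))) B)" by simp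
  then have "mat_exp A = sc (of_real (cos (t * energy p))) (mat 1) + sc (\<i> * of_real (sin (t * energy p))) B"
    unfolding mat_exp_def by (rule sums_unique[symmetric])
  moreover have "sc c M *v u = c *s (M *v u)" for c M
    by (simp add: sc_def vec_eq_iff matrix_vector_mult_def sum_distrib_left mult.assoc)
  ultimately show ?thesis
    unfolding A_def[symmetric] rot_def B_def[symmetric] by (simp add: matrix_vector_mult_add_rdistrib)
qed

lemma norm_split_step_diff: "norm (split_step p s u - split_step p s v) = norm (u - v)"
  by (simp add: split_step_def flip: rot_diff)
     (simp add: norm_rot alpha_involution beta_involution)

lemma norm_split_step: "norm (split_step p s u) = norm u"
  by (simp add: split_step_def norm_rot alpha_involution beta_involution)

text \<open>The split step and the exact rotation have the same generator i h(p), so one step of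
  length t / n costs O(1 / n^2), and n norm-preserving steps accumulate only O(1 / n).\<close>

lemma split_step_tendsto:
  "(\<lambda>n. (split_step p (t / real (Suc n)) ^^ Suc n) u) \<longlonglongrightarrow> rot (t * energy p) (unit_symbol p) u"
proof -
  note so = second_order_rot[OF alpha_involution] second_order_rot[OF beta_involution]
  have "second_order (split_step p) (\<lambda>u. (\<i> * of_real (p $ 1)) *s (\<alpha> 1 *v u) + ((\<i> * of_real (p $ 2)) *s (\<alpha> 2 *v u)
     + ((\<i> * of_real (p $ 3)) *s (\<alpha> 3 *v u) + (\<i> * of_real m) *s (\<beta> *v u))))"
    unfolding split_step_def[abs_def] by (intro second_order_comp so)
  also have "(\<lambda>u. (\<i> * of_real (p $ 1)) *s (\<alpha> 1 *v u) + ((\<i> * of_real (p $ 2)) *s (\<alpha> 2 *v u)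
     + ((\<i> * of_real (p $ 3)) *s (\<alpha> 3 *v u) + (\<i> * of_real m) *s (\<beta> *v u))))
     = (\<lambda>u. (\<i> * of_real (energy p)) *s (unit_symbol p *v u))"
  proof
    fix u
    have "(\<i> * of_real (energy p)) *s (unit_symbol p *v u) = \<i> *s dirac_op \<alpha> \<beta> m (\<chi> k. of_real (p $ k)) u"
      by (simp only: vector_smult_assoc[symmetric] unit_symbol_apply)
    then show "(\<i> * of_real (p $ 1)) *s (\<alpha> 1 *v u) + ((\<i> * of_real (p $ 2)) *s (\<alpha> 2 *v u)
     + ((\<i> * of_real (p $ 3)) *s (\<alpha> 3 *v u) + (\<i> * of_real m) *s (\<beta> *v u)))
     = (\<i> * of_real (energy p)) *s (unit_symbol p *v u)"
      by (simp add: dirac_op_def sum_3 vec_eq_iff algebra_simps)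
  qed
  finally obtain K where K: "K \<ge> 0"
    "\<And>s u. \<bar>s\<bar> \<le> 1 \<Longrightarrow> norm (split_step p s u - rot (s * energy p) (unit_symbol p) u) \<le> K * s\<^sup>2 * norm u"
    using second_order_diff[OF _ second_order_rot[OF unit_symbol_involution, of "energy p" p]] by metis
  have bd: "norm ((split_step p (t / real (Suc n)) ^^ Suc n) u - rot (t * energy p) (unit_symbol p) u)
      \<le> K * t\<^sup>2 * norm u * inverse (real (Suc n))" if n: "\<bar>t\<bar> \<le> real (Suc n)" for n
  proof -
    let ?s = "t / real (Suc n)"
    have s: "\<bar>?s\<bar> \<le> 1" using n by (simp add: field_simps)
    have "norm ((split_step p ?s ^^ Suc n) u - (rot (?s * energy p) (unit_symbol p) ^^ Suc n) u)
        \<le> real (Suc n) * (K * ?s\<^sup>2) * norm u"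
      using K(2)[OF s]
      by (intro funpow_norm_diff norm_split_step_diff norm_rot unit_symbol_involution) auto
    moreover have "(rot (?s * energy p) (unit_symbol p) ^^ Suc n) u = rot (t * energy p) (unit_symbol p) u"
      unfolding rot_funpow[OF unit_symbol_involution] by (simp del: of_nat_Suc)
    moreover have "real (Suc n) * (K * ?s\<^sup>2) * norm u = K * t\<^sup>2 * norm u * inverse (real (Suc n))"
      by (simp add: power2_eq_square field_simps del: of_nat_Suc)
    ultimately show ?thesis by (simp only:)
  qed
  have "(\<lambda>n. K * t\<^sup>2 * norm u * inverse (real (Suc n))) \<longlonglongrightarrow> K * t\<^sup>2 * norm u * 0"
    by (intro tendsto_intros LIMSEQ_inverse_real_of_nat)
  then have "(\<lambda>n. K * t\<^sup>2 * norm u * inverse (real (Suc n))) \<longlonglongrightarrow> 0" by simp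
  moreover have "\<forall>\<^sub>F n in sequentially. norm ((split_step p (t / real (Suc n)) ^^ Suc n) u - rot (t * energy p) (unit_symbol p) u)
      \<le> K * t\<^sup>2 * norm u * inverse (real (Suc n))"
  proof -
    obtain N :: nat where "\<bar>t\<bar> \<le> real N" using real_arch_simple by blast
    then show ?thesis by (intro eventually_mono[OF eventually_ge_at_top[of N]] bd) simp
  qed
  ultimately have "(\<lambda>n. (split_step p (t / real (Suc n)) ^^ Suc n) u - rot (t * energy p) (unit_symbol p) u) \<longlonglongrightarrow> 0"
    by (rule Lim_null_comparison[rotated])
  then show ?thesis by (simp add: LIM_zero_iff)
qed

end

end

end

section \<open>Existence of the evolution with compact support\<close>

text \<open>Keeps track of the radius, which \<open>compact_L2\<close> forgets: the limit of Trotter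
  iterates needs one ball that contains all supports.\<close>

definition L2_ball :: "real \<Rightarrow> ('a::euclidean_space \<Rightarrow> complex ^ 'n) set" where
  "L2_ball R = {f. f \<in> borel_measurable borel \<and> integrable lborel (\<lambda>x. (norm (f x))\<^sup>2) \<and>
     (\<forall>x. norm x > R \<longrightarrow> f x = 0)}"

lemma L2_ball_compact: "f \<in> L2_ball R \<Longrightarrow> f \<in> compact_L2"
  by (auto simp: L2_ball_def compact_L2_def)

lemma L2_ball_add:
  assumes "f \<in> L2_ball R" "g \<in> L2_ball R"
  shows "(\<lambda>x. f x + g x) \<in> L2_ball R"
  unfolding L2_ball_def
proof (intro CollectI conjI)
  have [measurable]: "f \<in> borel_measurable borel" "g \<in> borel_measurable borel" using assms by (auto simp: L2_ball_def)
  show "(\<lambda>x. f x + g x) \<in> borel_measurable borel" by measurable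
  show "integrable lborel (\<lambda>x. (norm (f x + g x))\<^sup>2)"
  proof (rule Bochner_Integration.integrable_bound)
    show "integrable lborel (\<lambda>x. 2 * (norm (f x))\<^sup>2 + 2 * (norm (g x))\<^sup>2)"
      using assms by (auto simp: L2_ball_def)
    show "AE x in lborel. norm ((norm (f x + g x))\<^sup>2) \<le> norm (2 * (norm (f x))\<^sup>2 + 2 * (norm (g x))\<^sup>2)"
    proof (intro AE_I2)
      fix x
      show "norm ((norm (f x + g x))\<^sup>2) \<le> norm (2 * (norm (f x))\<^sup>2 + 2 * (norm (g x))\<^sup>2)"
        using norm_diff_square_le[of "f x" "- g x" 0] by simp
    qed
  qed measurable
qed (use assms in \<open>auto simp: L2_ball_def\<close>)

lemma L2_ball_bounded_linear:
  assumes f: "f \<in> L2_ball R" and B: "bounded_linear B"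
  shows "(\<lambda>x. B (f x)) \<in> L2_ball R"
  unfolding L2_ball_def
proof (intro CollectI conjI)
  have [measurable]: "f \<in> borel_measurable borel" using f by (auto simp: L2_ball_def)
  show [measurable]: "(\<lambda>x. B (f x)) \<in> borel_measurable borel"
    by (rule borel_measurable_continuous_on[OF linear_continuous_on[OF B]]) measurable
  obtain K where K: "\<And>u. norm (B u) \<le> norm u * K" using bounded_linear.bounded[OF B] by blast
  show "integrable lborel (\<lambda>x. (norm (B (f x)))\<^sup>2)"
  proof (rule Bochner_Integration.integrable_bound)
    show "integrable lborel (\<lambda>x. (norm (f x))\<^sup>2 * K\<^sup>2)" using f by (auto simp: L2_ball_def)
    show "AE x in lborel. norm ((norm (B (f x)))\<^sup>2) \<le> norm ((norm (f x))\<^sup>2 * K\<^sup>2)"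
      using K by (intro AE_I2) (auto simp: power_mult_distrib[symmetric] intro!: power_mono)
  qed measurable
  show "\<forall>x. R < norm x \<longrightarrow> B (f x) = 0"
    using f linear_0[OF bounded_linear.linear[OF B]] by (auto simp: L2_ball_def)
qed

lemma L2_ball_translate:
  fixes f :: "'a::euclidean_space \<Rightarrow> complex ^ 'n"
  assumes f: "f \<in> L2_ball R"
  shows "(\<lambda>x. f (x + v)) \<in> L2_ball (R + norm v)"
  unfolding L2_ball_def
proof (intro CollectI conjI allI impI)
  have [measurable]: "f \<in> borel_measurable borel" using f by (auto simp: L2_ball_def)
  show "(\<lambda>x. f (x + v)) \<in> borel_measurable borel" by measurable
  show "integrable lborel (\<lambda>x. (norm (f (x + v)))\<^sup>2)"
    using f by (intro lborel_integrable_translate[of "\<lambda>x. (norm (f x))\<^sup>2"]) (auto simp: L2_ball_def)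
  fix x :: 'a assume "R + norm v < norm x"
  moreover have "norm x \<le> norm (x + v) + norm v" using norm_triangle_ineq4[of "x + v" v] by simp
  ultimately show "f (x + v) = 0" using f by (auto simp: L2_ball_def)
qed

lemma L2_ball_integrable: "f \<in> L2_ball R \<Longrightarrow> integrable lborel f"
  by (rule compact_L2_integrable[OF L2_ball_compact])

text \<open>Covers the mass term, whose factor does not depend on the momentum and so acts pointwise
  in position space.\<close>

lemma rot_realization_const:
  assumes f: "f \<in> L2_ball R"
  shows "\<exists>g\<in>L2_ball R. \<forall>p. fourier_int g p = rot s A (fourier_int f p)"
proof (intro bexI[of _ "\<lambda>x. of_real (cos s) *s f x + (\<i> * of_real (sin s)) *s (A *v f x)"] allI)
  have 1: "(\<lambda>x. of_real (cos s) *s f x) \<in> L2_ball R" by (intro L2_ball_bounded_linear[OF f] bounded_linear_smult)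
  have 2: "(\<lambda>x. A *v f x) \<in> L2_ball R"
    by (intro L2_ball_bounded_linear[OF f] matrix_vector_mul_bounded_linear)
  have 3: "(\<lambda>x. (\<i> * of_real (sin s)) *s (A *v f x)) \<in> L2_ball R"
    by (rule L2_ball_bounded_linear[OF 2 bounded_linear_smult])
  show "(\<lambda>x. of_real (cos s) *s f x + (\<i> * of_real (sin s)) *s (A *v f x)) \<in> L2_ball R"
    by (intro L2_ball_add 1 3)
  fix p
  show "fourier_int (\<lambda>x. of_real (cos s) *s f x + (\<i> * of_real (sin s)) *s (A *v f x)) p = rot s A (fourier_int f p)"
    unfolding fourier_int_add[OF L2_ball_integrable[OF 1] L2_ball_integrable[OF 3]]
      fourier_int_smult[OF L2_ball_integrable[OF f]] fourier_int_smult[OF L2_ball_integrable[OF 2]]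
      fourier_int_matrix[OF L2_ball_integrable[OF f]] rot_def ..
qed

text \<open>\<open>rot\<close> equals cis(a) (1 + A) / 2 + cis(-a) (1 - A) / 2, and for a = s p_k
  the phases are translations by s along the k-th axis in opposite directions. This is the source of
  finite propagation speed.\<close>

lemma rot_realization_translate:
  fixes f :: wavefunction
  assumes f: "f \<in> L2_ball R"
  shows "\<exists>g\<in>L2_ball (R + \<bar>s\<bar>). \<forall>p. fourier_int g p = rot (s * p $ k) A (fourier_int f p)"
proof -
  define v :: "real ^ 3" where "v = s *\<^sub>R axis k 1"
  have nv: "norm v = \<bar>s\<bar>" by (simp add: v_def)
  have fp: "(\<lambda>x. f (x + v)) \<in> L2_ball (R + \<bar>s\<bar>)" using L2_ball_translate[OF f, of v] by (simp add: nv)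
  have fm: "(\<lambda>x. f (x + - v)) \<in> L2_ball (R + \<bar>s\<bar>)" using L2_ball_translate[OF f, of "- v"] by (simp add: nv)
  define B where "B c u = (1/2) *s u + c *s (A *v u)" for c u
  have B: "bounded_linear (B c)" for c
    unfolding B_def by (intro bounded_linear_add bounded_linear_smult bounded_linear_smult_matrix)
  have gp: "(\<lambda>x. B (1/2) (f (x + v))) \<in> L2_ball (R + \<bar>s\<bar>)" by (rule L2_ball_bounded_linear[OF fp B])
  have gm: "(\<lambda>x. B (- (1/2)) (f (x + - v))) \<in> L2_ball (R + \<bar>s\<bar>)" by (rule L2_ball_bounded_linear[OF fm B])
  have FB: "fourier_int (\<lambda>x. B c (g x)) p = B c (fourier_int g p)" if g: "g \<in> L2_ball R'" for c g p R'
  proof -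
    have 1: "(\<lambda>x. A *v g x) \<in> L2_ball R'" by (intro L2_ball_bounded_linear[OF g] matrix_vector_mul_bounded_linear)
    have 2: "(\<lambda>x. (1/2) *s g x) \<in> L2_ball R'" "(\<lambda>x. c *s (A *v g x)) \<in> L2_ball R'"
      by (intro L2_ball_bounded_linear[OF g] L2_ball_bounded_linear[OF 1] bounded_linear_smult)+
    show ?thesis unfolding B_def
      by (simp only: fourier_int_add[OF L2_ball_integrable[OF 2(1)] L2_ball_integrable[OF 2(2)]]
          fourier_int_smult[OF L2_ball_integrable[OF g]] fourier_int_smult[OF L2_ball_integrable[OF 1]]
          fourier_int_matrix[OF L2_ball_integrable[OF g]])
  qed
  show ?thesis
  proof (intro bexI[of _ "\<lambda>x. B (1/2) (f (x + v)) + B (- (1/2)) (f (x + - v))"] allI L2_ball_add gp gm)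
    fix p :: "real ^ 3"
    let ?u = "fourier_int f p" and ?a = "s * p $ k"
    have pv: "p \<bullet> v = ?a" by (simp add: v_def cart_eq_inner_axis)
    have "fourier_int (\<lambda>x. B (1/2) (f (x + v)) + B (- (1/2)) (f (x + - v))) p
        = B (1/2) (cis ?a *s ?u) + B (- (1/2)) (cis (- ?a) *s ?u)"
      unfolding fourier_int_add[OF L2_ball_integrable[OF gp] L2_ball_integrable[OF gm]]
        FB[OF fp] FB[OF fm] fourier_int_translate[OF L2_ball_integrable[OF f]] by (simp add: pv)
    also have "\<dots> = ((cis ?a + cis (- ?a)) / 2) *s ?u + ((cis ?a - cis (- ?a)) / 2) *s (A *v ?u)"
      by (simp add: B_def vector_scalar_commute vec_eq_iff field_simps)
    also have "(cis ?a + cis (- ?a)) / 2 = of_real (cos ?a)" by (simp add: complex_eq_iff)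
    also have "(cis ?a - cis (- ?a)) / 2 = \<i> * of_real (sin ?a)" by (simp add: complex_eq_iff)
    finally show "fourier_int (\<lambda>x. B (1/2) (f (x + v)) + B (- (1/2)) (f (x + - v))) p = rot ?a A ?u"
      by (simp add: rot_def)
  qed
qed

text \<open>Each of the three kinetic factors widens the ball by \<open>\<bar>s\<bar>\<close>, the
  mass factor does not. The resulting speed bound 3 is crude, but only boundedness of the support
  matters later.\<close>

lemma split_step_realization:
  fixes f :: wavefunction
  assumes D: "dirac_matrices \<alpha> \<beta>" and f: "f \<in> L2_ball R"
  shows "\<exists>g\<in>L2_ball (R + 3 * \<bar>s\<bar>). \<forall>p. fourier_int g p = split_step \<alpha> \<beta> m p s (fourier_int f p)"
proof -
  obtain f0 where f0: "f0 \<in> L2_ball R" "\<And>p. fourier_int f0 p = rot (s * m) \<beta> (fourier_int f p)"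
    using rot_realization_const[OF f] by metis
  obtain f3 where f3: "f3 \<in> L2_ball (R + \<bar>s\<bar>)" "\<And>p. fourier_int f3 p = rot (s * p $ 3) (\<alpha> 3) (fourier_int f0 p)"
    using rot_realization_translate[OF f0(1)] by metis
  obtain f2 where f2: "f2 \<in> L2_ball (R + \<bar>s\<bar> + \<bar>s\<bar>)" "\<And>p. fourier_int f2 p = rot (s * p $ 2) (\<alpha> 2) (fourier_int f3 p)"
    using rot_realization_translate[OF f3(1)] by metis
  obtain f1 where f1: "f1 \<in> L2_ball (R + \<bar>s\<bar> + \<bar>s\<bar> + \<bar>s\<bar>)" "\<And>p. fourier_int f1 p = rot (s * p $ 1) (\<alpha> 1) (fourier_int f2 p)"
    using rot_realization_translate[OF f2(1)] by metis
  have "R + \<bar>s\<bar> + \<bar>s\<bar> + \<bar>s\<bar> = R + 3 * \<bar>s\<bar>" by simp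
  show ?thesis
    using f1(1)[unfolded \<open>R + \<bar>s\<bar> + \<bar>s\<bar> + \<bar>s\<bar> = R + 3 * \<bar>s\<bar>\<close>]
    by (intro bexI[of _ f1]) (simp_all add: split_step_def f0(2) f1(2) f2(2) f3(2))
qed

lemma split_step_funpow_realization:
  fixes f :: wavefunction
  assumes D: "dirac_matrices \<alpha> \<beta>" and f: "f \<in> L2_ball R"
  shows "\<exists>g\<in>L2_ball (R + real n * (3 * \<bar>s\<bar>)). \<forall>p. fourier_int g p = (split_step \<alpha> \<beta> m p s ^^ n) (fourier_int f p)"
proof (induction n)
  case 0 show ?case using f by auto
next
  case (Suc n)
  then obtain g where g: "g \<in> L2_ball (R + real n * (3 * \<bar>s\<bar>))"
    "\<And>p. fourier_int g p = (split_step \<alpha> \<beta> m p s ^^ n) (fourier_int f p)" by auto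
  obtain h where h: "h \<in> L2_ball (R + real n * (3 * \<bar>s\<bar>) + 3 * \<bar>s\<bar>)"
    "\<And>p. fourier_int h p = split_step \<alpha> \<beta> m p s (fourier_int g p)"
    using split_step_realization[OF D g(1)] by metis
  have e: "R + real n * (3 * \<bar>s\<bar>) + 3 * \<bar>s\<bar> = R + real (Suc n) * (3 * \<bar>s\<bar>)" by (simp add: algebra_simps)
  show ?case using h(1)[unfolded e] h(2) g(2) by (intro bexI[of _ h]) (simp_all del: of_nat_Suc)
qed

text \<open>Fatou's lemma, in the form that transfers norm bounds to almost everywhere
  limits.\<close>

lemma nn_integral_le_of_AE_tendsto:
  fixes u :: "nat \<Rightarrow> 'a \<Rightarrow> ennreal"
  assumes [measurable]: "\<And>n. u n \<in> borel_measurable M"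
    and lim: "AE x in M. (\<lambda>n. u n x) \<longlonglongrightarrow> v x"
    and le: "\<forall>\<^sub>F n in sequentially. (\<integral>\<^sup>+ x. u n x \<partial>M) \<le> c"
  shows "(\<integral>\<^sup>+ x. v x \<partial>M) \<le> c"
proof -
  have "(\<integral>\<^sup>+ x. v x \<partial>M) = (\<integral>\<^sup>+ x. liminf (\<lambda>n. u n x) \<partial>M)"
    using lim by (intro nn_integral_cong_AE, eventually_elim) (simp add: lim_imp_Liminf)
  also have "\<dots> \<le> liminf (\<lambda>n. \<integral>\<^sup>+ x. u n x \<partial>M)"
    by (rule nn_integral_liminf) simp
  also have "\<dots> \<le> c" by (rule Liminf_le[OF _ le]) simp
  finally show ?thesis .
qed

lemma L2_ball_diff:
  assumes "f \<in> L2_ball R" "g \<in> L2_ball R"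
  shows "(\<lambda>x. f x - g x) \<in> L2_ball R"
  using L2_ball_add[OF assms(1) L2_ball_bounded_linear[OF assms(2) bounded_linear_minus[OF bounded_linear_ident]]]
  by simp

text \<open>Split at height \<open>c\<close>: values up to \<open>c\<close> are paid for by the
  volume of the ball, larger ones satisfy |f| \<le> |f|^2 / c. A free parameter takes the place of
  the square root in the Cauchy-Schwarz inequality.\<close>

lemma L1_le_L2_on_ball:
  fixes f :: "'a::euclidean_space \<Rightarrow> complex ^ 'n"
  assumes f: "f \<in> L2_ball R" and c: "c > 0"
  shows "(LINT x|lborel. norm (f x)) \<le> c * measure lborel (cball (0::'a) R) + (LINT x|lborel. (norm (f x))\<^sup>2) / c"
proof -
  have fin: "emeasure lborel (cball (0::'a) R) < \<infinity>" by (rule emeasure_bounded_finite) simp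
  then have ib: "integrable lborel (\<lambda>x. c * indicator (cball (0::'a) R) x)"
    by (intro integrable_mult_right integrable_real_indicator) auto
  have i2: "integrable lborel (\<lambda>x. (norm (f x))\<^sup>2 / c)" using f by (auto simp: L2_ball_def)
  have "(LINT x|lborel. norm (f x)) \<le> (LINT x|lborel. c * indicator (cball 0 R) x + (norm (f x))\<^sup>2 / c)"
  proof (rule integral_mono)
    show "integrable lborel (\<lambda>x. norm (f x))" using L2_ball_integrable[OF f] by simp
    show "integrable lborel (\<lambda>x. c * indicator (cball 0 R) x + (norm (f x))\<^sup>2 / c)"
      using ib i2 by (rule Bochner_Integration.integrable_add)
    fix x
    show "norm (f x) \<le> c * indicator (cball 0 R) x + (norm (f x))\<^sup>2 / c"
    proof (cases "norm x \<le> R")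
      case True
      show ?thesis
      proof (cases "norm (f x) \<le> c")
        case True
        then show ?thesis using \<open>norm x \<le> R\<close> c by (simp add: add_increasing2)
      next
        case False
        then have "c * norm (f x) \<le> (norm (f x))\<^sup>2" unfolding power2_eq_square by (intro mult_right_mono) auto
        then have "norm (f x) \<le> (norm (f x))\<^sup>2 / c" using c by (simp add: field_simps)
        then show ?thesis using c by (simp add: add_increasing)
      qed
    next
      case False
      then show ?thesis using f c by (simp add: L2_ball_def)
    qed
  qed
  also have "\<dots> = c * measure lborel (cball (0::'a) R) + (LINT x|lborel. (norm (f x))\<^sup>2) / c"
    by (subst Bochner_Integration.integral_add[OF ib i2]) simp
  finally show ?thesis .
qed

lemma norm_fourier_int_le:
  assumes f: "integrable lborel f"
  shows "norm (fourier_int f p) \<le> (LINT x|lborel. norm (f x))"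
  unfolding fourier_int_def
  by (rule order_trans[OF integral_norm_bound]) (simp add: norm_vector_smult)

lemma plancherel_L2_ball:
  fixes f :: "'a::euclidean_space \<Rightarrow> complex ^ 'n"
  assumes f: "f \<in> L2_ball R"
  shows "integrable lborel (\<lambda>p. (norm (fourier_int f p))\<^sup>2)"
    and "(LINT p|lborel. (norm (fourier_int f p))\<^sup>2) = (2 * pi) ^ DIM('a) * (LINT x|lborel. (norm (f x))\<^sup>2)"
proof -
  have [measurable]: "f \<in> borel_measurable borel" and f2: "integrable lborel (\<lambda>x. (norm (f x))\<^sup>2)"
    using f by (auto simp: L2_ball_def)
  note P = plancherel[OF L2_ball_integrable[OF f] f2]
  show i: "integrable lborel (\<lambda>p. (norm (fourier_int f p))\<^sup>2)"
    by (rule integrableI_bounded) (simp_all add: P)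
  have "ennreal (LINT p|lborel. (norm (fourier_int f p))\<^sup>2) = ennreal ((2 * pi) ^ DIM('a) * (LINT x|lborel. (norm (f x))\<^sup>2))"
    using nn_integral_eq_integral[OF i] P by simp
  then show "(LINT p|lborel. (norm (fourier_int f p))\<^sup>2) = (2 * pi) ^ DIM('a) * (LINT x|lborel. (norm (f x))\<^sup>2)"
    by (subst (asm) ennreal_inj) (auto intro!: integral_nonneg mult_nonneg_nonneg)
qed

lemma L2_le_fourier_L2:
  fixes f :: "'a::euclidean_space \<Rightarrow> complex ^ 'n"
  assumes f: "f \<in> L2_ball R"
  shows "(LINT x|lborel. (norm (f x))\<^sup>2) \<le> (LINT p|lborel. (norm (fourier_int f p))\<^sup>2)"
proof -
  have "1 \<le> (2 * pi) ^ DIM('a)" using pi_ge_two by (intro one_le_power) linarith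
  then show ?thesis
    using mult_right_mono[of 1 "(2 * pi) ^ DIM('a)" "LINT x|lborel. (norm (f x))\<^sup>2"]
    by (simp add: plancherel_L2_ball(2)[OF f] integral_nonneg)
qed

text \<open>The common modulus dominates the transforms, so they converge in L2; Plancherel makes
  the \<open>g n\<close> Cauchy in L2, and the common ball makes them Cauchy in L1. A subsequence
  converges almost everywhere to \<open>h\<close>, and L1 convergence gives the equality of
  transforms at every \<open>p\<close>.\<close>

lemma fourier_int_limit_realization:
  fixes g :: "nat \<Rightarrow> 'a::euclidean_space \<Rightarrow> complex ^ 'n"
  assumes g: "\<And>n. g n \<in> L2_ball R" and f: "f \<in> L2_ball R'"
    and norm: "\<And>n p. norm (fourier_int (g n) p) = norm (fourier_int f p)"
    and lim: "\<And>p. (\<lambda>n. fourier_int (g n) p) \<longlonglongrightarrow> G p"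
  shows "\<exists>h\<in>L2_ball R. \<forall>p. fourier_int h p = G p"
proof -
  have [measurable]: "g n \<in> borel_measurable borel" "f \<in> borel_measurable borel" for n
    using g f by (auto simp: L2_ball_def)
  have Gm [measurable]: "G \<in> borel_measurable borel"
    by (rule borel_measurable_LIMSEQ_metric[OF _ lim]) measurable
  have nG: "norm (G p) = norm (fourier_int f p)" for p
    using LIMSEQ_unique[OF tendsto_norm[OF lim[of p]], of "norm (fourier_int f p)"] by (simp add: norm)
  define V where "V = measure lborel (cball (0::'a) R)"
  have V: "V \<ge> 0" by (simp add: V_def)
  define D where "D n = (LINT p|lborel. (norm (fourier_int (g n) p - G p))\<^sup>2)" for n
  have Dbd: "(norm (fourier_int (g n) p - G p))\<^sup>2 \<le> 4 * (norm (fourier_int f p))\<^sup>2" for n p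
    using norm_diff_square_le[of "fourier_int (g n) p" "G p" 0] by (simp add: norm nG)
  have Di: "integrable lborel (\<lambda>p. (norm (fourier_int (g n) p - G p))\<^sup>2)" for n
    by (rule Bochner_Integration.integrable_bound[of _ "\<lambda>p. 4 * (norm (fourier_int f p))\<^sup>2"])
       (use plancherel_L2_ball(1)[OF f] Dbd in \<open>auto intro!: AE_I2\<close>)
  have "D \<longlonglongrightarrow> (LINT p|lborel. (norm (G p - G p))\<^sup>2)"
    unfolding D_def
  proof (rule integral_dominated_convergence[where w="\<lambda>p. 4 * (norm (fourier_int f p))\<^sup>2"])
    show "integrable lborel (\<lambda>p. 4 * (norm (fourier_int f p))\<^sup>2)" using plancherel_L2_ball(1)[OF f] by simp
    show "AE p in lborel. (\<lambda>n. (norm (fourier_int (g n) p - G p))\<^sup>2) \<longlonglongrightarrow> (norm (G p - G p))\<^sup>2"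
      by (intro AE_I2 tendsto_intros lim)
  qed (use Dbd in auto)
  then have D0: "D \<longlonglongrightarrow> 0" by simp
  have sq: "(LINT x|lborel. (norm (g i x - g j x))\<^sup>2) \<le> 2 * D i + 2 * D j" for i j
  proof -
    have dij: "(\<lambda>x. g i x - g j x) \<in> L2_ball R" by (rule L2_ball_diff[OF g g])
    have "(LINT x|lborel. (norm (g i x - g j x))\<^sup>2) \<le> (LINT p|lborel. (norm (fourier_int (g i) p - fourier_int (g j) p))\<^sup>2)"
      using L2_le_fourier_L2[OF dij]
      by (simp add: fourier_int_diff[OF L2_ball_integrable[OF g] L2_ball_integrable[OF g]])
    also have "\<dots> \<le> (LINT p|lborel. 2 * (norm (fourier_int (g i) p - G p))\<^sup>2 + 2 * (norm (fourier_int (g j) p - G p))\<^sup>2)"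
    proof (rule integral_mono)
      show "integrable lborel (\<lambda>p. (norm (fourier_int (g i) p - fourier_int (g j) p))\<^sup>2)"
        using plancherel_L2_ball(1)[OF dij] by (simp add: fourier_int_diff[OF L2_ball_integrable[OF g] L2_ball_integrable[OF g]])
      show "(norm (fourier_int (g i) p - fourier_int (g j) p))\<^sup>2
          \<le> 2 * (norm (fourier_int (g i) p - G p))\<^sup>2 + 2 * (norm (fourier_int (g j) p - G p))\<^sup>2" for p
        using norm_diff_square_le[of "fourier_int (g i) p" "fourier_int (g j) p" "G p"] by (simp add: norm_minus_commute)
    qed (use Di in auto)
    also have "\<dots> = 2 * D i + 2 * D j" using Di by (simp add: D_def)
    finally show ?thesis .
  qed
  have cauchy: "\<exists>N. \<forall>i\<ge>N. \<forall>j\<ge>N. (LINT x|lborel. norm (g i x - g j x)) < e" if e: "e > 0" for e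
  proof -
    \<comment> \<open>Makes \<open>c * V\<close> at most e / 2, the summand 1 covering the case V =
      0. The threshold c e / 8 for \<open>D\<close> then keeps (2 D i + 2 D j) / c below e /
      2.\<close>
    define c where "c = e / (2 * (V + 1))"
    have c: "c > 0" using e V by (simp add: c_def)
    have cV: "c * V \<le> e / 2"
    proof -
      have "c * V \<le> c * (V + 1)" using c by simp
      also have "\<dots> = e / 2" using V by (simp add: c_def add_nonneg_eq_0_iff divide_simps)
      finally show ?thesis .
    qed
    have "c * e / 8 > 0" using c e by simp
    from LIMSEQ_D[OF D0 this] obtain N where N: "\<And>n. n \<ge> N \<Longrightarrow> norm (D n - 0) < c * e / 8" by blast
    have "(LINT x|lborel. norm (g i x - g j x)) < e" if "i \<ge> N" "j \<ge> N" for i j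
    proof -
      have "(LINT x|lborel. norm (g i x - g j x)) \<le> c * V + (LINT x|lborel. (norm (g i x - g j x))\<^sup>2) / c"
        unfolding V_def by (rule L1_le_L2_on_ball[OF L2_ball_diff[OF g g] c])
      also have "(LINT x|lborel. (norm (g i x - g j x))\<^sup>2) / c < e / 2"
      proof -
        have "2 * D i + 2 * D j < c * e / 2" using N[OF that(1)] N[OF that(2)] by (simp add: abs_less_iff)
        with sq[of i j] have "(LINT x|lborel. (norm (g i x - g j x))\<^sup>2) < c * e / 2" by linarith
        then show ?thesis using c by (simp add: field_simps)
      qed
      finally show ?thesis using cV by linarith
    qed
    then show ?thesis by blast
  qed
  obtain r where r: "strict_mono r" and ae: "AE x in lborel. Cauchy (\<lambda>i. g (r i) x)"
    using cauchy_L1_AE_cauchy_subseq[OF L2_ball_integrable[OF g] cauchy] by blast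
  define h where "h x = lim (\<lambda>i. g (r i) x)" for x
  have hm [measurable]: "h \<in> borel_measurable borel" unfolding h_def[abs_def] by measurable
  have h: "AE x in lborel. (\<lambda>i. g (r i) x) \<longlonglongrightarrow> h x"
    using ae by eventually_elim (simp add: h_def Cauchy_convergent_iff convergent_LIMSEQ_iff)
  have "(\<integral>\<^sup>+ x. ennreal ((norm (h x))\<^sup>2) \<partial>lborel) \<le> ennreal (LINT p|lborel. (norm (fourier_int f p))\<^sup>2)"
  proof (rule nn_integral_le_of_AE_tendsto)
    show "(\<lambda>x. ennreal ((norm (g (r n) x))\<^sup>2)) \<in> borel_measurable lborel" for n by measurable
    show "AE x in lborel. (\<lambda>n. ennreal ((norm (g (r n) x))\<^sup>2)) \<longlonglongrightarrow> ennreal ((norm (h x))\<^sup>2)"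
      using h by eventually_elim (intro tendsto_ennrealI tendsto_intros)
    have "(\<integral>\<^sup>+ x. ennreal ((norm (g n x))\<^sup>2) \<partial>lborel) \<le> ennreal (LINT p|lborel. (norm (fourier_int f p))\<^sup>2)" for n
    proof -
      have "(LINT x|lborel. (norm (g n x))\<^sup>2) \<le> (LINT p|lborel. (norm (fourier_int f p))\<^sup>2)"
        using L2_le_fourier_L2[OF g, of n] by (simp add: norm)
      moreover have "(\<integral>\<^sup>+ x. ennreal ((norm (g n x))\<^sup>2) \<partial>lborel) = ennreal (LINT x|lborel. (norm (g n x))\<^sup>2)"
        using g[of n] by (intro nn_integral_eq_integral) (auto simp: L2_ball_def)
      ultimately show ?thesis by (simp add: ennreal_leI)
    qed
    then show "\<forall>\<^sub>F n in sequentially. (\<integral>\<^sup>+ x. ennreal ((norm (g (r n) x))\<^sup>2) \<partial>lborel) \<le> ennreal (LINT p|lborel. (norm (fourier_int f p))\<^sup>2)"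
      by simp
  qed
  then have "integrable lborel (\<lambda>x. (norm (h x))\<^sup>2)"
    by (intro integrableI_bounded) (auto intro: le_less_trans)
  \<comment> \<open>Outside the ball all terms are 0, so \<open>lim\<close> is 0 at every such
    point, whatever it returns where the sequence diverges.\<close>
  moreover have "h x = 0" if "norm x > R" for x
    using that g by (simp add: h_def L2_ball_def)
  ultimately have hL: "h \<in> L2_ball R" using hm by (simp add: L2_ball_def)
  have "fourier_int h p = G p" for p
  proof -
    have "(\<lambda>i. fourier_int (g (r i)) p) \<longlonglongrightarrow> fourier_int h p"
    proof (rule LIMSEQ_I)
      fix e :: real assume e: "e > 0"
      from cauchy[of "e/2"] e obtain N where N: "\<And>i j. i \<ge> N \<Longrightarrow> j \<ge> N \<Longrightarrow> (LINT x|lborel. norm (g i x - g j x)) < e / 2"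
        by auto
      have "norm (fourier_int (g (r i)) p - fourier_int h p) < e" if i: "i \<ge> N" for i
      proof -
        have ri: "r i \<ge> N" using i seq_suble[OF r, of i] by linarith
        have id: "integrable lborel (\<lambda>x. norm (g j x - h x))" for j
          using L2_ball_integrable[OF L2_ball_diff[OF g hL]] by simp
        \<comment> \<open>Fatou in \<open>n\<close> with \<open>i\<close> fixed passes the Cauchy
          estimate on to the limit.\<close>
        have "(\<integral>\<^sup>+ x. ennreal (norm (g (r i) x - h x)) \<partial>lborel) \<le> ennreal (e / 2)"
        proof (rule nn_integral_le_of_AE_tendsto)
          show "(\<lambda>x. ennreal (norm (g (r i) x - g (r n) x))) \<in> borel_measurable lborel" for n by measurable
          show "AE x in lborel. (\<lambda>n. ennreal (norm (g (r i) x - g (r n) x))) \<longlonglongrightarrow> ennreal (norm (g (r i) x - h x))"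
            using h by eventually_elim (intro tendsto_ennrealI tendsto_intros)
          show "\<forall>\<^sub>F n in sequentially. (\<integral>\<^sup>+ x. ennreal (norm (g (r i) x - g (r n) x)) \<partial>lborel) \<le> ennreal (e / 2)"
            using eventually_ge_at_top[of N]
          proof eventually_elim
            case (elim n)
            have "r n \<ge> N" using elim seq_suble[OF r, of n] by linarith
            have "(\<integral>\<^sup>+ x. ennreal (norm (g (r i) x - g (r n) x)) \<partial>lborel) = ennreal (LINT x|lborel. norm (g (r i) x - g (r n) x))"
              by (intro nn_integral_eq_integral integrable_norm L2_ball_integrable[OF L2_ball_diff[OF g g]]) auto
            also have "\<dots> \<le> ennreal (e / 2)" using N[OF ri \<open>r n \<ge> N\<close>] by (intro ennreal_leI) simp
            finally show ?case .
          qed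
        qed
        also have "(\<integral>\<^sup>+ x. ennreal (norm (g (r i) x - h x)) \<partial>lborel) = ennreal (LINT x|lborel. norm (g (r i) x - h x))"
          by (intro nn_integral_eq_integral id) auto
        finally have "(LINT x|lborel. norm (g (r i) x - h x)) \<le> e / 2" using e by simp
        moreover have "norm (fourier_int (g (r i)) p - fourier_int h p) \<le> (LINT x|lborel. norm (g (r i) x - h x))"
          unfolding fourier_int_diff[OF L2_ball_integrable[OF g] L2_ball_integrable[OF hL], symmetric]
          by (rule norm_fourier_int_le[OF L2_ball_integrable[OF L2_ball_diff[OF g hL]]])
        ultimately show ?thesis using e by linarith
      qed
      then show "\<exists>no. \<forall>n\<ge>no. norm (fourier_int (g (r n)) p - fourier_int h p) < e" by blast
    qed
    moreover have "(\<lambda>i. fourier_int (g (r i)) p) \<longlonglongrightarrow> G p"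
      using LIMSEQ_subseq_LIMSEQ[OF lim r, of p] by (simp add: o_def)
    ultimately show ?thesis using LIMSEQ_unique by blast
  qed
  with hL show ?thesis by blast
qed

theorem dirac_evolution_realization:
  fixes f :: wavefunction
  assumes D: "dirac_matrices \<alpha> \<beta>" and m: "m > 0" and f: "f \<in> L2_ball R"
  shows "\<exists>g\<in>L2_ball (R + 3 * \<bar>t\<bar>). \<forall>p. fourier_int g p
    = rot (t * energy m p) (unit_symbol \<alpha> \<beta> m p) (fourier_int f p)"
proof -
  have "\<exists>g\<in>L2_ball (R + 3 * \<bar>t\<bar>). \<forall>p. fourier_int g p
      = (split_step \<alpha> \<beta> m p (t / real (Suc n)) ^^ Suc n) (fourier_int f p)" for n
  proof -
    \<comment> \<open>The widening over all steps is 3 |t| whatever their number.\<close>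
    have "R + real (Suc n) * (3 * \<bar>t / real (Suc n)\<bar>) = R + 3 * \<bar>t\<bar>" by (simp add: abs_divide del: of_nat_Suc)
    then show ?thesis using split_step_funpow_realization[OF D f, of "Suc n" "t / real (Suc n)"] by (simp only:)
  qed
  then obtain g where g: "\<And>n. g n \<in> L2_ball (R + 3 * \<bar>t\<bar>)"
    "\<And>n p. fourier_int (g n) p = (split_step \<alpha> \<beta> m p (t / real (Suc n)) ^^ Suc n) (fourier_int f p)" by metis
  have n: "norm ((split_step \<alpha> \<beta> m p s ^^ n) u) = norm u" for p s n u
    by (induction n) (simp_all add: norm_split_step[OF D m])
  show ?thesis
  proof (rule fourier_int_limit_realization[OF g(1) f])
    show "norm (fourier_int (g n) p) = norm (fourier_int f p)" for n p unfolding g(2) by (rule n)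
    show "(\<lambda>n. fourier_int (g n) p) \<longlonglongrightarrow> rot (t * energy m p) (unit_symbol \<alpha> \<beta> m p) (fourier_int f p)" for p
      unfolding g(2) by (rule split_step_tendsto[OF D m])
  qed
qed

section \<open>Holomorphic functions on half-planes\<close>

text \<open>The a priori bound \<open>C\<close> may be enormous; the conclusion depends only on the
  boundary values. In the decay argument below \<open>C\<close> is uncontrolled in the exponent,
  while \<open>K\<close> is explicit.\<close>

lemma half_plane_maximum:
  assumes hol: "F holomorphic_on {z. Im z < - b}" and bc: "b < c"
    and C: "\<And>z. Im z \<le> - c \<Longrightarrow> norm (F z) \<le> C"
    and K: "\<And>z. Im z = - c \<Longrightarrow> norm (F z) \<le> K" "K > 0" and \<xi>: "Im \<xi> \<le> - c"
  shows "norm (F \<xi>) \<le> K"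
proof -
  \<comment> \<open>Phragmen-Lindelof: dividing by \<open>1 + i \<delta> (z + i c)\<close> makes the function small on large circles.\<close>
  have *: "norm (F \<xi>) \<le> K * norm (1 + \<i> * of_real \<delta> * (\<xi> + \<i> * of_real c))" if \<delta>: "\<delta> > 0" for \<delta> :: real
  proof -
    define d where "d z = 1 + \<i> * of_real \<delta> * (z + \<i> * of_real c)" for z
    \<comment> \<open>The first entry puts \<open>\<xi>\<close> into \<open>S\<close>. The second
      makes \<delta> |z + i c| at least |C| / K on the circle |z| = \<rho>, so that the quotient is
      at most \<open>K\<close> there too.\<close>
    define \<rho> where "\<rho> = max (norm \<xi>) (\<bar>c\<bar> + \<bar>C\<bar> / (\<delta> * K))"
    define S where "S = {z. Im z \<le> - c} \<inter> cball 0 \<rho>"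
    have Re_d: "Re (d z) = 1 - \<delta> * (Im z + c)" and Im_d: "Im (d z) = \<delta> * Re z" for z
      by (simp_all add: d_def algebra_simps)
    have d1: "norm (d z) \<ge> 1" if "Im z \<le> - c" for z
    proof -
      have "\<delta> * (Im z + c) \<le> 0" using that \<delta> by (intro mult_nonneg_nonpos) auto
      then have "1 \<le> Re (d z)" by (simp add: Re_d)
      then show ?thesis using complex_Re_le_cmod[of "d z"] by linarith
    qed
    have d2: "norm (d z) \<ge> \<delta> * norm (z + \<i> * of_real c)" if "Im z \<le> - c" for z
    proof (rule power2_le_imp_le)
      have y: "\<delta> * (Im z + c) \<le> 0" using that \<delta> by (intro mult_nonneg_nonpos) auto
      have "(\<delta> * norm (z + \<i> * of_real c))\<^sup>2 = (\<delta> * (Im z + c))\<^sup>2 + (\<delta> * Re z)\<^sup>2"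
        by (simp add: power_mult_distrib cmod_power2) (simp add: power2_eq_square algebra_simps)
      also have "\<dots> \<le> (1 - \<delta> * (Im z + c))\<^sup>2 + (\<delta> * Re z)\<^sup>2"
        using y by (simp add: power2_diff)
      also have "\<dots> = (norm (d z))\<^sup>2" by (simp add: cmod_power2 Re_d Im_d)
      finally show "(\<delta> * norm (z + \<i> * of_real c))\<^sup>2 \<le> (norm (d z))\<^sup>2" .
    qed simp
    have S: "closed S" "bounded S" "S \<subseteq> {z. Im z \<le> - c}"
      unfolding S_def by (auto intro!: closed_Int closed_halfspace_Im_le bounded_Int)
    have holS: "(\<lambda>z. F z / d z) holomorphic_on S"
    proof (intro holomorphic_intros)
      show "F holomorphic_on S" using S(3) bc by (intro holomorphic_on_subset[OF hol]) auto
      show "d holomorphic_on S" unfolding d_def by (intro holomorphic_intros)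
      show "d z \<noteq> 0" if "z \<in> S" for z using d1[of z] that S(3) by auto
    qed
    have "norm (F \<xi> / d \<xi>) \<le> K"
    proof (rule maximum_modulus_frontier[where f = "\<lambda>z. F z / d z" and S = S])
      show "(\<lambda>z. F z / d z) holomorphic_on interior S" using holS interior_subset by (rule holomorphic_on_subset)
      show "continuous_on (closure S) (\<lambda>z. F z / d z)"
        using holS S(1) by (simp add: holomorphic_on_imp_continuous_on)
      show "bounded S" by (rule S)
      show "\<xi> \<in> S" using \<xi> by (simp add: S_def \<rho>_def)
      fix z assume z: "z \<in> frontier S"
      then have zS: "z \<in> S" using S(1) by (simp add: frontier_def)
      then have zc: "Im z \<le> - c" by (simp add: S_def)
      have "\<not> (Im z < - c \<and> norm z < \<rho>)"
      proof
        assume "Im z < - c \<and> norm z < \<rho>"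
        moreover have "open ({z. Im z < - c} \<inter> ball 0 \<rho>)" by (intro open_Int open_halfspace_Im_lt open_ball)
        ultimately have "z \<in> interior S"
          by (intro interiorI[of "{z. Im z < - c} \<inter> ball 0 \<rho>"]) (auto simp: S_def)
        then show False using z by (simp add: frontier_def)
      qed
      then consider "Im z = - c" | "norm z = \<rho>" using zS by (auto simp: S_def)
      then show "norm (F z / d z) \<le> K"
      proof cases
        case 1
        then have "norm (F z) / norm (d z) \<le> norm (F z) / 1" using d1[of z] by (intro divide_left_mono) auto
        with K(1)[OF 1] show ?thesis by (simp add: norm_divide)
      next
        case 2
        have "\<rho> \<le> norm (z + \<i> * of_real c) + \<bar>c\<bar>"
          using norm_triangle_ineq4[of "z + \<i> * of_real c" "\<i> * of_real c"] 2 by (simp add: norm_mult)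
        moreover have "\<bar>c\<bar> + \<bar>C\<bar> / (\<delta> * K) \<le> \<rho>" by (simp add: \<rho>_def)
        ultimately have "\<bar>C\<bar> / (\<delta> * K) \<le> norm (z + \<i> * of_real c)" by linarith
        then have "\<bar>C\<bar> \<le> K * (\<delta> * norm (z + \<i> * of_real c))" using \<delta> K(2) by (simp add: field_simps)
        also have "\<dots> \<le> K * norm (d z)" using d2[OF zc] K(2) by (intro mult_left_mono) auto
        finally have "norm (F z) \<le> K * norm (d z)" using C[OF zc] by linarith
        moreover have "norm (d z) > 0" using d1[OF zc] by linarith
        ultimately show ?thesis by (simp add: norm_divide pos_divide_le_eq)
      qed
    qed
    moreover have "norm (d \<xi>) > 0" using d1[OF \<xi>] by linarith
    ultimately show ?thesis by (simp add: norm_divide pos_divide_le_eq d_def)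
  qed
  have "(\<lambda>n. K * norm (1 + \<i> * of_real (inverse (real (Suc n))) * (\<xi> + \<i> * of_real c)))
      \<longlonglongrightarrow> K * norm (1 + \<i> * of_real 0 * (\<xi> + \<i> * of_real c))"
    by (intro tendsto_intros LIMSEQ_inverse_real_of_nat)
  then have "norm (F \<xi>) \<le> K * norm (1 + \<i> * of_real 0 * (\<xi> + \<i> * of_real c))"
    by (rule LIMSEQ_le_const) (intro exI[of _ 0] allI impI *, simp)
  then show ?thesis by simp
qed

lemma norm_exp_ii: "norm (exp (\<i> * of_real a * z)) = exp (- a * Im z)"
  by (simp add: norm_exp_eq_Re)

text \<open>Apply \<open>half_plane_maximum\<close> to exp(i n z) u(z): on the line Im z = - c it is
  at most K exp(n c), and at depth y below that line this means |u| \<le> K exp(- n y). Let n tend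
  to infinity.\<close>

lemma half_plane_superexponential_decay:
  assumes hol: "u holomorphic_on {z. Im z < - b}" and bc: "b < c"
    and bd: "\<And>A. \<exists>C. \<forall>z. Im z \<le> - c \<longrightarrow> norm (exp (\<i> * of_real A * z) * u z) \<le> C"
    and z: "Im z < - c"
  shows "u z = 0"
proof -
  obtain C0 where C0: "\<And>z. Im z \<le> - c \<Longrightarrow> norm (u z) \<le> C0" using bd[of 0] by auto
  define K where "K = \<bar>C0\<bar> + 1"
  have K: "K > 0" "\<And>z. Im z \<le> - c \<Longrightarrow> norm (u z) \<le> K" using C0 by (force simp: K_def)+
  define y where "y = - Im z - c"
  have y: "y > 0" using z by (simp add: y_def)
  have *: "norm (u z) \<le> K * exp (- (real n * y))" for n
  proof -
    let ?F = "\<lambda>z. exp (\<i> * of_real (real n) * z) * u z"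
    obtain C where C: "\<And>z. Im z \<le> - c \<Longrightarrow> norm (?F z) \<le> C" using bd[of "real n"] by auto
    have "norm (?F z) \<le> exp (real n * c) * K"
    proof (rule half_plane_maximum[OF _ bc C])
      show "?F holomorphic_on {z. Im z < - b}" by (intro holomorphic_intros hol)
      show "norm (?F w) \<le> exp (real n * c) * K" if "Im w = - c" for w
        using K(2)[of w] that by (simp add: norm_mult norm_exp_ii)
      show "0 < exp (real n * c) * K" using K by simp
    qed (use z in auto)
    then have "exp (- real n * Im z) * norm (u z) \<le> exp (real n * c) * K"
      by (simp only: norm_mult norm_exp_ii)
    then have "exp (real n * Im z) * (exp (- real n * Im z) * norm (u z)) \<le> exp (real n * Im z) * (exp (real n * c) * K)"
      by (rule mult_left_mono) simp
    moreover have "exp (real n * Im z) * (exp (- real n * Im z) * norm (u z)) = norm (u z)"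
      unfolding mult.assoc[symmetric] exp_add[symmetric] by simp
    moreover have "exp (real n * Im z) * (exp (real n * c) * K) = K * exp (- (real n * y))"
    proof -
      have "real n * Im z + real n * c = - (real n * y)" by (simp add: y_def algebra_simps)
      then show ?thesis by (simp only: mult.assoc[symmetric] exp_add[symmetric]) (rule mult.commute)
    qed
    ultimately show ?thesis by (simp only:)
  qed
  have "(\<lambda>n. exp (- y) ^ n) \<longlonglongrightarrow> 0" using y by (intro LIMSEQ_realpow_zero) auto
  moreover have "exp (- y) ^ n = exp (- (real n * y))" for n by (simp add: exp_of_nat_mult[symmetric])
  ultimately have "(\<lambda>n. K * exp (- (real n * y))) \<longlonglongrightarrow> 0" by (intro tendsto_mult_right_zero) simp
  then have "norm (u z) \<le> 0" by (rule LIMSEQ_le_const) (use * in auto)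
  then show ?thesis by simp
qed

text \<open>The left-hand side vanishes to even order at \<open>i M\<close>, the right-hand side to odd order.\<close>

lemma square_eq_quadratic_times_square_imp_0:
  assumes p: "p holomorphic_on UNIV" and g: "g holomorphic_on UNIV" and M: "M > (0::real)"
    and eq: "\<And>z. (p z)\<^sup>2 = (z\<^sup>2 + (of_real M)\<^sup>2) * (g z)\<^sup>2"
  shows "g w = 0"
proof (rule ccontr)
  assume gw: "g w \<noteq> 0"
  define a where "a = \<i> * of_real M"
  have a: "a \<noteq> 0" "a\<^sup>2 = - (of_real M)\<^sup>2" using M by (simp_all add: a_def power_mult_distrib)
  have fac: "z\<^sup>2 + (of_real M)\<^sup>2 = (z + a) * (z - a)" for z
    using a(2) by (simp add: algebra_simps power2_eq_square)
  \<comment> \<open>Orders of vanishing are additive only for functions that are not identically 0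
    near \<open>a\<close>; the identity theorem excludes this for \<open>g\<close>, and
    \<open>eq\<close> passes it on to \<open>p\<close>.\<close>
  have fg: "\<exists>\<^sub>F z in at a. g z \<noteq> 0"
  proof (rule ccontr)
    assume "\<not> ?thesis"
    then have "\<forall>\<^sub>F z in at a. g z = 0" by (simp add: frequently_def)
    then obtain S where S: "open S" "a \<in> S" "\<And>z. z \<in> S \<Longrightarrow> z \<noteq> a \<Longrightarrow> g z = 0"
      unfolding eventually_at_topological by blast
    have "a islimpt S" using S interior_limit_point[of a S] by (simp add: interior_open)
    then have lim: "a islimpt (S - {a})" using islimpt_punctured[of a S] by blast
    have "g w = 0"
      by (rule analytic_continuation[OF g open_UNIV connected_UNIV _ _ lim]) (use S in auto)
    with gw show False by simp
  qed
  have na: "\<forall>\<^sub>F z in at a. z \<noteq> - a \<and> z \<noteq> a"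
  proof -
    have "open (- {- a})" "a \<in> - {- a}" using a by auto
    then show ?thesis unfolding eventually_at_topological by blast
  qed
  have q: "\<exists>\<^sub>F z in at a. z\<^sup>2 + (of_real M)\<^sup>2 \<noteq> 0"
    using na by (intro eventually_frequently) (auto elim!: eventually_mono simp: fac add_eq_0_iff2)
  have fp: "\<exists>\<^sub>F z in at a. p z \<noteq> 0"
  proof (rule frequently_rev_mp[OF frequently_eventually_conj[OF fg na]])
    show "\<forall>\<^sub>F z in at a. (z \<noteq> - a \<and> z \<noteq> a) \<and> g z \<noteq> 0 \<longrightarrow> p z \<noteq> 0"
    proof (intro always_eventually allI impI)
      fix z assume z: "(z \<noteq> - a \<and> z \<noteq> a) \<and> g z \<noteq> 0"
      then have "z + a \<noteq> 0" by (auto simp: add_eq_0_iff2)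
      then show "p z \<noteq> 0" using eq[of z] z by (auto simp: fac)
    qed
  qed
  have mero: "f meromorphic_on {a}" if "f holomorphic_on UNIV" for f
    using that by (intro analytic_on_imp_meromorphic_on) (auto simp: analytic_at)
  have g2: "\<exists>\<^sub>F z in at a. (g z)\<^sup>2 \<noteq> 0" using fg by simp
  have "2 * zorder p a = zorder (\<lambda>z. (p z)\<^sup>2) a"
    using zorder_power[OF mero[OF p] fp, of 2] by simp
  also have "\<dots> = zorder (\<lambda>z. (z\<^sup>2 + (of_real M)\<^sup>2) * (g z)\<^sup>2) a" by (simp only: eq)
  also have "\<dots> = zorder (\<lambda>z. z\<^sup>2 + (of_real M)\<^sup>2) a + zorder (\<lambda>z. (g z)\<^sup>2) a"
    by (rule zorder_mult[OF mero q mero g2]) (intro holomorphic_intros g)+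
  also have "zorder (\<lambda>z. z\<^sup>2 + (of_real M)\<^sup>2) a = 1"
    by (rule zorder_eqI[of UNIV a "\<lambda>z. z + a"]) (use a in \<open>auto simp: fac intro!: holomorphic_intros\<close>)
  also have "zorder (\<lambda>z. (g z)\<^sup>2) a = 2 * zorder g a"
    using zorder_power[OF mero[OF g] fg, of 2] by simp
  finally show False by presburger
qed

text \<open>sin(t eps) / eps as a function of w = eps^2; the value at 0 fills the removable
  singularity.\<close>

definition sinc_sqrt :: "real \<Rightarrow> complex \<Rightarrow> complex" where
  "sinc_sqrt t w = (if w = 0 then of_real t else sin (of_real t * csqrt w) / csqrt w)"

lemma holomorphic_on_UNIV_power_series:
  assumes "\<And>w. (\<lambda>n. a n * w ^ n) sums f w"
  shows "f holomorphic_on UNIV"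
proof -
  have "f holomorphic_on (\<Union>n::nat. ball 0 (real n))"
    using assms by (intro holomorphic_on_UN_open power_series_holomorphic[where a=a]) auto
  moreover have "(\<Union>n::nat. ball 0 (real n)) = (UNIV :: complex set)"
    using reals_Archimedean2 by auto
  ultimately show ?thesis by simp
qed

text \<open>Only even powers of \<open>csqrt w\<close> occur in the cosine series, that is, integer
  powers of \<open>w\<close>, and the cut of \<open>csqrt\<close> disappears.\<close>

lemma holomorphic_cos_csqrt: "(\<lambda>w. cos (of_real t * csqrt w)) holomorphic_on UNIV"
proof (rule holomorphic_on_UNIV_power_series)
  fix w
  let ?x = "complex_of_real t * csqrt w"
  have "(\<lambda>n. cos_coeff (2 * n) *\<^sub>R ?x ^ (2 * n)) sums cos ?x \<longleftrightarrow> (\<lambda>n. cos_coeff n *\<^sub>R ?x ^ n) sums cos ?x"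
  proof (rule sums_mono_reindex)
    show "strict_mono (\<lambda>n::nat. 2 * n)" by (simp add: strict_mono_def)
    show "cos_coeff n *\<^sub>R ?x ^ n = 0" if "n \<notin> range ((*) 2)" for n
      using that by (auto simp: cos_coeff_def elim!: evenE)
  qed
  then have "(\<lambda>n. cos_coeff (2 * n) *\<^sub>R ?x ^ (2 * n)) sums cos ?x" by (simp add: cos_converges)
  moreover have "cos_coeff (2 * n) *\<^sub>R ?x ^ (2 * n) = of_real (cos_coeff (2 * n) * t ^ (2 * n)) * w ^ n" for n
    by (simp add: power_mult_distrib power_mult scaleR_complex_conv)
  ultimately show "(\<lambda>n. of_real (cos_coeff (2 * n) * t ^ (2 * n)) * w ^ n) sums cos ?x" by simp
qed

lemma holomorphic_sinc_sqrt: "sinc_sqrt t holomorphic_on UNIV"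
proof (rule holomorphic_on_UNIV_power_series)
  fix w
  let ?x = "complex_of_real t * csqrt w"
  let ?a = "\<lambda>n. complex_of_real (sin_coeff (2 * n + 1) * t ^ (2 * n + 1))"
  show "(\<lambda>n. ?a n * w ^ n) sums sinc_sqrt t w"
  proof (cases "w = 0")
    case True
    then show ?thesis using powser_sums_zero[of ?a] by (simp add: sinc_sqrt_def sin_coeff_def)
  next
    case False
    have "(\<lambda>n. sin_coeff (2 * n + 1) *\<^sub>R ?x ^ (2 * n + 1)) sums sin ?x \<longleftrightarrow> (\<lambda>n. sin_coeff n *\<^sub>R ?x ^ n) sums sin ?x"
    proof (rule sums_mono_reindex)
      show "strict_mono (\<lambda>n::nat. 2 * n + 1)" by (simp add: strict_mono_def)
      show "sin_coeff n *\<^sub>R ?x ^ n = 0" if "n \<notin> range (\<lambda>n. 2 * n + 1)" for n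
        using that by (auto simp: sin_coeff_def elim!: oddE)
    qed
    then have "(\<lambda>n. sin_coeff (2 * n + 1) *\<^sub>R ?x ^ (2 * n + 1)) sums sin ?x" by (simp add: sin_converges)
    then have "(\<lambda>n. sin_coeff (2 * n + 1) *\<^sub>R ?x ^ (2 * n + 1) / csqrt w) sums (sin ?x / csqrt w)" by (rule sums_divide)
    moreover have "sin_coeff (2 * n + 1) *\<^sub>R ?x ^ (2 * n + 1) / csqrt w = ?a n * w ^ n" for n
    proof -
      have "csqrt w ^ (2 * n) = w ^ n" by (simp add: power_mult)
      then have "?x ^ (2 * n + 1) = of_real (t ^ (2 * n + 1)) * (w ^ n * csqrt w)"
        by (simp add: power_mult_distrib)
      then show ?thesis using False by (simp only: scaleR_complex_conv) simp
    qed
    ultimately show ?thesis using False by (simp add: sinc_sqrt_def)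
  qed
qed

section \<open>Fourier-Laplace transforms on complex lines\<close>

text \<open>The Fourier integral continued to the complex momentum q + z e. Its kernel has modulus
  exp(Im z (x . e)), so deep in the lower half-plane the parts with small x . e dominate and the
  lower edge of the support becomes visible.\<close>

definition fourier_laplace :: "real ^ 3 \<Rightarrow> wavefunction \<Rightarrow> real ^ 3 \<Rightarrow> complex \<Rightarrow> complex ^ 4" where
  "fourier_laplace e f q z = (LINT x|lborel. exp (- \<i> * (of_real (q \<bullet> x) + z * of_real (x \<bullet> e))) *s f x)"

lemma fourier_laplace_real: "fourier_laplace e f q (of_real s) = fourier_int f (q + s *\<^sub>R e)"
  unfolding fourier_laplace_def fourier_int_def
  by (intro Bochner_Integration.integral_cong refl)
     (simp add: cis_conv_exp inner_add_left inner_commute[of e] algebra_simps)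

context
  fixes e :: "real ^ 3" and f :: wavefunction and R :: real
  assumes e: "norm e = 1" and f: "f \<in> L2_ball R"
begin

private lemma fm [measurable]: "f \<in> borel_measurable borel" using f by (simp add: L2_ball_def)

private lemma inner_le: "f x \<noteq> 0 \<Longrightarrow> \<bar>x \<bullet> e\<bar> \<le> R"
  using Cauchy_Schwarz_ineq2[of x e] f e by (force simp: L2_ball_def not_less)

lemma norm_fourier_laplace_kernel:
  "norm (exp (- \<i> * (of_real (q \<bullet> x) + z * of_real (x \<bullet> e)))) = exp (Im z * (x \<bullet> e))"
  by (simp add: norm_exp_eq_Re)

lemma fourier_laplace_integrable:
  "integrable lborel (\<lambda>x. exp (- \<i> * (of_real (q \<bullet> x) + z * of_real (x \<bullet> e))) *s f x)"
proof (rule Bochner_Integration.integrable_bound)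
  show "integrable lborel (\<lambda>x. exp (\<bar>Im z\<bar> * R) * norm (f x))"
    using L2_ball_integrable[OF f] by simp
  show "(\<lambda>x. exp (- \<i> * (of_real (q \<bullet> x) + z * of_real (x \<bullet> e))) *s f x) \<in> borel_measurable lborel"
    by measurable
  have "exp (Im z * (x \<bullet> e)) * norm (f x) \<le> exp (\<bar>Im z\<bar> * R) * norm (f x)" for x
  proof (cases "f x = 0")
    case False
    have "Im z * (x \<bullet> e) \<le> \<bar>Im z\<bar> * \<bar>x \<bullet> e\<bar>" unfolding abs_mult[symmetric] by (rule abs_ge_self)
    also have "\<dots> \<le> \<bar>Im z\<bar> * R" using inner_le[OF False] by (intro mult_left_mono) auto
    finally show ?thesis by (intro mult_right_mono) auto
  qed simp
  then show "AE x in lborel. norm (exp (- \<i> * (of_real (q \<bullet> x) + z * of_real (x \<bullet> e))) *s f x)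
      \<le> norm (exp (\<bar>Im z\<bar> * R) * norm (f x))"
    by (intro AE_I2) (simp only: norm_vector_smult norm_fourier_laplace_kernel real_norm_def abs_mult abs_norm_cancel abs_exp_cancel)
qed

lemma norm_fourier_laplace_le_integral:
  "norm (exp (\<i> * of_real a * z) *s fourier_laplace e f q z) \<le> (LINT x|lborel. exp (Im z * (x \<bullet> e - a)) * norm (f x))"
proof -
  let ?k = "\<lambda>x. exp (- \<i> * (of_real (q \<bullet> x) + z * of_real (x \<bullet> e)))"
  have "norm (exp (\<i> * of_real a * z) *s fourier_laplace e f q z)
      \<le> exp (- a * Im z) * (LINT x|lborel. norm (?k x *s f x))"
    unfolding norm_vector_smult[of "exp (\<i> * of_real a * z)"] norm_exp_ii fourier_laplace_def
    by (rule mult_left_mono[OF integral_norm_bound]) simp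
  also have "\<dots> = (LINT x|lborel. exp (- a * Im z) * (exp (Im z * (x \<bullet> e)) * norm (f x)))"
    by (simp only: integral_mult_right_zero norm_vector_smult norm_fourier_laplace_kernel)
  also have "\<dots> = (LINT x|lborel. exp (Im z * (x \<bullet> e - a)) * norm (f x))"
    by (simp only: mult.assoc[symmetric] exp_add[symmetric]) (simp add: algebra_simps)
  finally show ?thesis .
qed

text \<open>Covers both regimes used below: \<open>B\<close> = 0 when sign of \<open>Im z\<close>
  and side of the support match, and a positive \<open>B\<close> on a horizontal strip.\<close>

lemma norm_fourier_laplace_le:
  assumes B: "AE x in lborel. f x \<noteq> 0 \<longrightarrow> Im z * (x \<bullet> e - a) \<le> B"
  shows "norm (exp (\<i> * of_real a * z) *s fourier_laplace e f q z) \<le> exp B * (LINT x|lborel. norm (f x))"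
proof -
  have i: "integrable lborel (\<lambda>x. exp B * norm (f x))" using L2_ball_integrable[OF f] by simp
  have ae: "AE x in lborel. exp (Im z * (x \<bullet> e - a)) * norm (f x) \<le> exp B * norm (f x)"
    using B
  proof eventually_elim
    case (elim x)
    then show ?case by (cases "f x = 0") (auto intro!: mult_right_mono)
  qed
  have "(LINT x|lborel. exp (Im z * (x \<bullet> e - a)) * norm (f x)) \<le> (LINT x|lborel. exp B * norm (f x))"
  proof (rule integral_mono_AE[OF _ i ae])
    show "integrable lborel (\<lambda>x. exp (Im z * (x \<bullet> e - a)) * norm (f x))"
      by (rule Bochner_Integration.integrable_bound[OF i]) (use ae in \<open>auto simp: abs_mult\<close>)
  qed
  with norm_fourier_laplace_le_integral[of a z q] show ?thesis by simp
qed

text \<open>Bounded support permits termwise integration of the exponential series in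
  \<open>z\<close>, the n-th term being dominated by (R |z|)^n / n!.\<close>

lemma holomorphic_fourier_laplace: "(\<lambda>z. fourier_laplace e f q z $ j) holomorphic_on UNIV"
proof -
  define c where "c n x = (- \<i> * of_real (x \<bullet> e)) ^ n /\<^sub>R fact n * (exp (- \<i> * of_real (q \<bullet> x)) * f x $ j)" for n and x :: "real ^ 3"
  have [measurable]: "c n \<in> borel_measurable borel" for n unfolding c_def[abs_def] by measurable
  have i0: "integrable lborel (\<lambda>x. norm (f x $ j))" using integrable_vec_nth[OF L2_ball_integrable[OF f]] by simp
  have cb: "norm (c n x * z ^ n) \<le> (R * norm z) ^ n / fact n * norm (f x $ j)" for n x z
  proof (cases "f x = 0")
    case False
    have "norm (c n x * z ^ n) = (\<bar>x \<bullet> e\<bar> * norm z) ^ n / fact n * norm (f x $ j)"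
      by (simp add: c_def norm_mult norm_power power_mult_distrib norm_exp_eq_Re divide_inverse)
    also have "\<dots> \<le> (R * norm z) ^ n / fact n * norm (f x $ j)"
      using inner_le[OF False] by (intro mult_right_mono divide_right_mono power_mono) auto
    finally show ?thesis .
  qed (simp add: c_def)
  have ci: "integrable lborel (\<lambda>x. c n x * z ^ n)" for n z
  proof (rule Bochner_Integration.integrable_bound)
    show "integrable lborel (\<lambda>x. (R * norm z) ^ n / fact n * norm (f x $ j))" using i0 by (intro integrable_mult_right)
    show "AE x in lborel. norm (c n x * z ^ n) \<le> norm ((R * norm z) ^ n / fact n * norm (f x $ j))"
      by (intro AE_I2) (rule order_trans[OF cb], simp only: real_norm_def abs_ge_self)
  qed measurable
  have cs: "(\<lambda>n. c n x * z ^ n) sums (exp (- \<i> * (of_real (q \<bullet> x) + z * of_real (x \<bullet> e))) * f x $ j)" for x z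
  proof -
    have "(\<lambda>n. (- \<i> * of_real (x \<bullet> e) * z) ^ n /\<^sub>R fact n * (exp (- \<i> * of_real (q \<bullet> x)) * f x $ j))
        sums (exp (- \<i> * of_real (x \<bullet> e) * z) * (exp (- \<i> * of_real (q \<bullet> x)) * f x $ j))"
      by (intro sums_mult2 exp_converges)
    moreover have "(- \<i> * of_real (x \<bullet> e) * z) ^ n /\<^sub>R fact n * (exp (- \<i> * of_real (q \<bullet> x)) * f x $ j) = c n x * z ^ n" for n
      by (simp only: c_def power_mult_distrib scaleR_complex_conv mult_ac)
    moreover have "exp (- \<i> * of_real (x \<bullet> e) * z) * (exp (- \<i> * of_real (q \<bullet> x)) * f x $ j)
       = exp (- \<i> * (of_real (q \<bullet> x) + z * of_real (x \<bullet> e))) * f x $ j"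
    proof -
      have "- \<i> * of_real (x \<bullet> e) * z + - \<i> * of_real (q \<bullet> x) = - \<i> * (of_real (q \<bullet> x) + z * of_real (x \<bullet> e))"
        by (simp add: algebra_simps)
      then show ?thesis by (simp only: mult.assoc[symmetric] exp_add[symmetric])
    qed
    ultimately show ?thesis by (simp only:)
  qed
  have se: "summable (\<lambda>n. (R * norm z) ^ n / fact n * b)" for z :: complex and b :: real
    using summable_exp[of "R * norm z"] by (intro summable_mult2) (simp add: divide_inverse mult.commute)
  show ?thesis
  proof (rule holomorphic_on_UNIV_power_series)
    fix z
    have sn: "summable (\<lambda>n. norm (c n x * z ^ n))" for x
      by (rule summable_comparison_test'[OF se[of z "norm (f x $ j)"]]) (use cb in auto)
    have si: "summable (\<lambda>n. LINT x|lborel. norm (c n x * z ^ n))"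
    proof (rule summable_comparison_test'[OF se[of z "LINT x|lborel. norm (f x $ j)"]])
      fix n :: nat
      have "(LINT x|lborel. norm (c n x * z ^ n)) \<le> (LINT x|lborel. (R * norm z) ^ n / fact n * norm (f x $ j))"
        by (intro integral_mono integrable_norm ci integrable_mult_right i0 cb)
      then show "norm (LINT x|lborel. norm (c n x * z ^ n)) \<le> (R * norm z) ^ n / fact n * (LINT x|lborel. norm (f x $ j))"
        by (simp add: integral_nonneg)
    qed
    have "(\<lambda>n. LINT x|lborel. c n x * z ^ n) sums (\<Sum>n. LINT x|lborel. c n x * z ^ n)"
      by (rule summable_sums, rule summable_integral[OF ci _ si]) (use sn in auto)
    also have "(\<Sum>n. LINT x|lborel. c n x * z ^ n) = (LINT x|lborel. (\<Sum>n. c n x * z ^ n))"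
      by (rule integral_suminf[OF ci _ si, symmetric]) (use sn in auto)
    also have "\<dots> = (LINT x|lborel. exp (- \<i> * (of_real (q \<bullet> x) + z * of_real (x \<bullet> e))) * f x $ j)"
      by (simp only: sums_unique[OF cs, symmetric])
    also have "\<dots> = fourier_laplace e f q z $ j"
      unfolding fourier_laplace_def integral_vec_nth[OF fourier_laplace_integrable] by simp
    finally show "(\<lambda>n. (LINT x|lborel. c n x) * z ^ n) sums (fourier_laplace e f q z $ j)" by simp
  qed
qed

end

section \<open>Spectral components of the symbol on a complex line\<close>

definition complex_momentum :: "real ^ 3 \<Rightarrow> real ^ 3 \<Rightarrow> complex \<Rightarrow> complex ^ 3" where
  "complex_momentum q e z = (\<chi> k. of_real (q $ k) + z * of_real (e $ k))"

lemma dirac_op_nth: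
  "dirac_op \<alpha> \<beta> m v u $ j = (\<Sum>k\<in>UNIV. v $ k * (\<Sum>l\<in>UNIV. \<alpha> k $ j $ l * u $ l)) + of_real m * (\<Sum>l\<in>UNIV. \<beta> $ j $ l * u $ l)"
  by (simp add: dirac_op_def matrix_vector_mult_def)

lemma dirac_op_smult: "dirac_op \<alpha> \<beta> m v (c *s u) = c *s dirac_op \<alpha> \<beta> m v u"
  by (simp add: vec_eq_iff dirac_op_nth sum_distrib_left distrib_left mult_ac)

lemma dirac_op_add: "dirac_op \<alpha> \<beta> m v (u + u') = dirac_op \<alpha> \<beta> m v u + dirac_op \<alpha> \<beta> m v u'"
  by (simp add: vec_eq_iff dirac_op_nth sum.distrib algebra_simps)

lemma holomorphic_dirac_op:
  fixes u :: "complex \<Rightarrow> complex ^ 4"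
  assumes "\<And>j. (\<lambda>z. u z $ j) holomorphic_on A"
  shows "(\<lambda>z. dirac_op \<alpha> \<beta> m (complex_momentum q e z) (u z) $ j) holomorphic_on A"
  unfolding dirac_op_nth complex_momentum_def vec_lambda_beta
  by (intro holomorphic_intros assms)

definition half_bounded :: "real \<Rightarrow> (complex \<Rightarrow> 'a::real_normed_vector) \<Rightarrow> bool" where
  "half_bounded c u \<longleftrightarrow> (\<exists>C. \<forall>z. Im z \<le> - c \<longrightarrow> norm (u z) \<le> C)"

lemma half_bounded_mono:
  assumes "half_bounded c u" "K \<ge> 0" "\<And>z. Im z \<le> - c \<Longrightarrow> norm (v z) \<le> K * norm (u z)"
  shows "half_bounded c v"
proof -
  obtain C where C: "\<And>z. Im z \<le> - c \<Longrightarrow> norm (u z) \<le> C" using assms(1) by (auto simp: half_bounded_def)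
  have "norm (v z) \<le> K * C" if "Im z \<le> - c" for z
    using assms(3)[OF that] mult_left_mono[OF C[OF that] assms(2)] by linarith
  then show ?thesis unfolding half_bounded_def by blast
qed

lemma half_bounded_add:
  assumes "half_bounded c u" "half_bounded c v"
  shows "half_bounded c (\<lambda>z. u z + v z)"
proof -
  obtain C where C: "\<And>z. Im z \<le> - c \<Longrightarrow> norm (u z) \<le> C" using assms(1) by (auto simp: half_bounded_def)
  obtain C' where C': "\<And>z. Im z \<le> - c \<Longrightarrow> norm (v z) \<le> C'" using assms(2) by (auto simp: half_bounded_def)
  have "norm (u z + v z) \<le> C + C'" if "Im z \<le> - c" for z
    using norm_triangle_mono[OF C[OF that] C'[OF that]] .
  then show ?thesis unfolding half_bounded_def by blast
qed

text \<open>The effective mass of the motion along \<open>e\<close> at fixed transverse momentum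
  \<open>q\<close>: on the line q + z e the squared energy is z^2 + M^2.\<close>

definition transverse_mass :: "real \<Rightarrow> real ^ 3 \<Rightarrow> real" where
  "transverse_mass m q = sqrt (q \<bullet> q + m\<^sup>2)"

text \<open>The square root of \<open>z\<^sup>2 + M\<^sup>2\<close> with branch cut from \<open>- i M\<close> to \<open>i M\<close>, so that it behaves
  like \<open>z\<close> in the lower half-plane.\<close>

definition energy_branch :: "real \<Rightarrow> complex \<Rightarrow> complex" where
  "energy_branch M z = z * csqrt (1 + (of_real M)\<^sup>2 / z\<^sup>2)"

text \<open>Twice the spectral projection for the eigenvalue \<open>\<sigma> \<epsilon>\<close> of the symbol at momentum \<open>q + z e\<close>,
  where \<open>\<epsilon>\<close> is the branch above and \<open>\<sigma> = 1\<close> or \<open>\<sigma> = -1\<close>.\<close>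

definition energy_projection ::
    "(3 \<Rightarrow> matrix4) \<Rightarrow> matrix4 \<Rightarrow> real \<Rightarrow> real ^ 3 \<Rightarrow> real ^ 3 \<Rightarrow> real \<Rightarrow> complex \<Rightarrow> complex ^ 4 \<Rightarrow> complex ^ 4" where
  "energy_projection \<alpha> \<beta> m e q \<sigma> z u =
     u + (1 / (of_real \<sigma> * energy_branch (transverse_mass m q) z)) *s dirac_op \<alpha> \<beta> m (complex_momentum q e z) u"

context
  fixes \<alpha> :: "3 \<Rightarrow> matrix4" and \<beta> :: matrix4 and m :: real and e q :: "real ^ 3"
  assumes D: "dirac_matrices \<alpha> \<beta>" and m: "m > 0" and e: "norm e = 1" and qe: "q \<bullet> e = 0"
begin

private abbreviation "h z \<equiv> dirac_op \<alpha> \<beta> m (complex_momentum q e z)"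

private abbreviation "M \<equiv> transverse_mass m q"

private lemma M: "M > 0" "M\<^sup>2 = q \<bullet> q + m\<^sup>2" "m \<le> M" "norm q \<le> M"
proof -
  show "M > 0" using m by (simp add: transverse_mass_def add_nonneg_pos)
  show "M\<^sup>2 = q \<bullet> q + m\<^sup>2" by (simp add: transverse_mass_def)
  show "m \<le> M" unfolding transverse_mass_def by (rule real_le_rsqrt) simp
  show "norm q \<le> M" unfolding transverse_mass_def by (rule real_le_rsqrt) (simp add: power2_norm_eq_inner)
qed

private lemma ee: "(\<Sum>k\<in>UNIV. (complex_of_real (e $ k))\<^sup>2) = 1"
  and qq: "(\<Sum>k\<in>UNIV. (complex_of_real (q $ k))\<^sup>2) = of_real (q \<bullet> q)"
  and qe': "(\<Sum>k\<in>UNIV. complex_of_real (q $ k) * of_real (e $ k)) = 0"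
proof -
  have "(\<Sum>k\<in>UNIV. (complex_of_real (e $ k))\<^sup>2) = of_real (e \<bullet> e)"
    by (simp add: inner_vec_def power2_eq_square)
  also have "e \<bullet> e = 1" using e by (simp add: norm_eq_1)
  finally show "(\<Sum>k\<in>UNIV. (complex_of_real (e $ k))\<^sup>2) = 1" by simp
  show "(\<Sum>k\<in>UNIV. (complex_of_real (q $ k))\<^sup>2) = of_real (q \<bullet> q)"
    by (simp add: inner_vec_def power2_eq_square)
  have "(\<Sum>k\<in>UNIV. complex_of_real (q $ k) * of_real (e $ k)) = of_real (q \<bullet> e)"
    by (simp add: inner_vec_def)
  then show "(\<Sum>k\<in>UNIV. complex_of_real (q $ k) * of_real (e $ k)) = 0" using qe by simp
qed

private lemma h_square: "h z (h z u) = (z\<^sup>2 + (of_real M)\<^sup>2) *s u"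
proof -
  have "(\<Sum>k\<in>UNIV. (complex_momentum q e z $ k)\<^sup>2)
     = (\<Sum>k\<in>UNIV. (complex_of_real (q $ k))\<^sup>2) + 2 * z * (\<Sum>k\<in>UNIV. complex_of_real (q $ k) * of_real (e $ k))
       + z\<^sup>2 * (\<Sum>k\<in>UNIV. (complex_of_real (e $ k))\<^sup>2)"
    by (simp add: complex_momentum_def power2_sum sum.distrib sum_distrib_left power_mult_distrib mult_ac)
  also have "\<dots> = of_real (q \<bullet> q) + z\<^sup>2" by (simp only: ee qq qe') simp
  finally have v: "(\<Sum>k\<in>UNIV. (complex_momentum q e z $ k)\<^sup>2) = of_real (q \<bullet> q) + z\<^sup>2" .
  have "(complex_of_real M)\<^sup>2 = of_real (q \<bullet> q) + (of_real m)\<^sup>2"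
    using arg_cong[OF M(2), of complex_of_real] by simp
  then show ?thesis by (simp add: dirac_op_square[OF D] v add_ac)
qed

text \<open>Three momentum components of size at most 3/2 |z| and a mass of at most |z| / 2 add up
  to 5 |z|.\<close>

private lemma norm_h_le:
  assumes z: "norm z \<ge> 2 * M"
  shows "norm (h z u) \<le> 5 * norm z * norm u"
proof -
  have v: "norm (complex_momentum q e z $ k) \<le> 3 / 2 * norm z" for k
  proof -
    have "norm (complex_momentum q e z $ k) \<le> \<bar>q $ k\<bar> + norm z * \<bar>e $ k\<bar>"
      unfolding complex_momentum_def vec_lambda_beta by (rule order_trans[OF norm_triangle_ineq]) (simp add: norm_mult)
    also have "\<dots> \<le> M + norm z * 1"
      using component_le_norm_cart[of q k] component_le_norm_cart[of e k] e M(4)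
      by (intro add_mono mult_left_mono) auto
    finally show ?thesis using z by simp
  qed
  have "norm (h z u) \<le> (\<Sum>k\<in>UNIV. norm (complex_momentum q e z $ k) * norm u) + m * norm u"
    unfolding dirac_op_def
    by (rule order_trans[OF norm_triangle_ineq], intro add_mono order_trans[OF norm_sum] sum_mono)
       (use m in \<open>simp_all add: norm_vector_smult norm_involution[OF alpha_involution[OF D]] norm_involution[OF beta_involution[OF D]]\<close>)
  also have "\<dots> \<le> (\<Sum>k\<in>(UNIV :: 3 set). 3 / 2 * norm z * norm u) + norm z / 2 * norm u"
    using v z M(3) by (intro add_mono sum_mono mult_right_mono) auto
  also have "\<dots> = 5 * norm z * norm u" by simp
  finally show ?thesis .
qed

private abbreviation "eps \<equiv> energy_branch (transverse_mass m q)"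

text \<open>\<open>csqrt\<close> has nonnegative real part, hence |eps + z| \<ge> |z|. Since (eps -
  z)(eps + z) = M^2, it follows that |eps - z| \<le> M^2 / |z| \<le> M / 2, which carries the other
  estimates.\<close>

private lemma eps:
  assumes z: "norm z \<ge> 2 * M"
  shows eps_square: "(eps z)\<^sup>2 = z\<^sup>2 + (of_real M)\<^sup>2"
    and eps_diff: "norm (eps z - z) \<le> M"
    and eps_ge: "norm (eps z) \<ge> norm z / 2"
    and eps_nz: "eps z \<noteq> 0"
proof -
  have z0: "z \<noteq> 0" using z M(1) by auto
  show sq: "(eps z)\<^sup>2 = z\<^sup>2 + (of_real M)\<^sup>2"
    using z0 by (simp add: energy_branch_def power_mult_distrib distrib_left)
  have "1 \<le> norm (csqrt (1 + (of_real M)\<^sup>2 / z\<^sup>2) + 1)"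
    using complex_Re_le_cmod[of "csqrt (1 + (of_real M)\<^sup>2 / z\<^sup>2) + 1"] Re_csqrt[of "1 + (of_real M)\<^sup>2 / z\<^sup>2"]
    by (simp del: csqrt.sel csqrt.simps)
  then have "norm z * 1 \<le> norm z * norm (csqrt (1 + (of_real M)\<^sup>2 / z\<^sup>2) + 1)" by (rule mult_left_mono) simp
  then have s: "norm z \<le> norm (eps z + z)" by (simp add: energy_branch_def norm_mult[symmetric] distrib_left)
  have prod: "(eps z - z) * (eps z + z) = (of_real M)\<^sup>2"
    using sq by (simp add: algebra_simps power2_eq_square)
  have "norm (eps z - z) * norm (eps z + z) = M\<^sup>2"
    using arg_cong[OF prod, of norm] by (simp add: norm_mult norm_power)
  then have "norm (eps z - z) * norm z \<le> M\<^sup>2" using mult_left_mono[OF s, of "norm (eps z - z)"] by simp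
  moreover have "norm (eps z - z) * (2 * M) \<le> norm (eps z - z) * norm z" using z by (intro mult_left_mono) auto
  ultimately have "norm (eps z - z) * 2 * M \<le> M * M" by (simp add: power2_eq_square)
  then have d: "norm (eps z - z) * 2 \<le> M" using M(1) by (rule mult_right_le_imp_le)
  then show "norm (eps z - z) \<le> M" using M(1) by simp
  have "norm z \<le> norm (eps z) + norm (eps z - z)"
    using norm_triangle_ineq4[of "eps z" "eps z - z"] by simp
  then show ge: "norm (eps z) \<ge> norm z / 2" using d z M(1) by linarith
  show "eps z \<noteq> 0" using ge z0 by auto
qed

private lemma half_plane_norm: "Im z \<le> - (2 * M) \<Longrightarrow> norm z \<ge> 2 * M"
  using abs_Im_le_cmod[of z] by linarith

text \<open>The depth lies between M and 2 M: beyond M the argument of \<open>csqrt\<close> has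
  positive real part, and \<open>half_plane_superexponential_decay\<close> requires holomorphy
  strictly above the line Im z = - 2 M.\<close>

private lemma eps_holomorphic: "eps holomorphic_on {z. Im z < - (3 / 2 * M)}"
proof -
  have "1 + (of_real M)\<^sup>2 / z\<^sup>2 \<notin> \<real>\<^sub>\<le>\<^sub>0" "z\<^sup>2 \<noteq> 0" if "Im z < - (3 / 2 * M)" for z
  proof -
    have z: "norm z > M" using abs_Im_le_cmod[of z] that M(1) by linarith
    then show "z\<^sup>2 \<noteq> 0" using M(1) by auto
    have "norm ((of_real M)\<^sup>2 / z\<^sup>2) = (M / norm z)\<^sup>2" using M(1) by (simp add: norm_divide norm_power power_divide)
    also have "\<dots> < 1" using z M(1) by (simp add: power_less_one_iff divide_less_eq_1)
    finally have "- Re ((of_real M)\<^sup>2 / z\<^sup>2) < 1"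
      using abs_Re_le_cmod[of "(of_real M)\<^sup>2 / z\<^sup>2"] by linarith
    then have "Re (1 + (of_real M)\<^sup>2 / z\<^sup>2) > 0" by simp
    then show "1 + (of_real M)\<^sup>2 / z\<^sup>2 \<notin> \<real>\<^sub>\<le>\<^sub>0" by (auto simp: complex_nonpos_Reals_iff)
  qed
  then show ?thesis unfolding energy_branch_def[abs_def] by (intro holomorphic_intros) auto
qed

private abbreviation "proj \<equiv> energy_projection \<alpha> \<beta> m e q"

private lemma proj_smult: "proj \<sigma> z (c *s u) = c *s proj \<sigma> z u"
  by (simp add: energy_projection_def dirac_op_smult vector_add_ldistrib vector_smult_assoc mult.commute)

text \<open>1 from the identity and 10 from |h| \<le> 5 |z| with |eps| \<ge> |z| / 2.\<close>

private lemma norm_proj_le: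
  assumes z: "norm z \<ge> 2 * M" and \<sigma>: "\<bar>\<sigma>\<bar> = 1"
  shows "norm (proj \<sigma> z u) \<le> 11 * norm u"
proof -
  have "norm (proj \<sigma> z u) \<le> norm u + norm (h z u) / norm (eps z)"
    unfolding energy_projection_def by (rule order_trans[OF norm_triangle_ineq])
      (simp add: norm_vector_smult norm_divide norm_mult \<sigma>)
  also have "norm (h z u) / norm (eps z) \<le> 10 * norm u"
  proof -
    have "norm (h z u) \<le> 5 * norm z * norm u" by (rule norm_h_le[OF z])
    also have "\<dots> \<le> 5 * (2 * norm (eps z)) * norm u"
      using eps_ge[OF z] by (intro mult_right_mono mult_left_mono) auto
    finally show ?thesis using eps_nz[OF z] by (simp add: divide_le_eq mult_ac)
  qed
  finally show ?thesis by simp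
qed

context
  fixes f g :: wavefunction and R R' t :: real
  assumes f: "f \<in> L2_ball R" and g: "g \<in> L2_ball R'"
    and eq: "\<And>p. fourier_int g p = rot (t * energy m p) (unit_symbol \<alpha> \<beta> m p) (fourier_int f p)"
begin

text \<open>For real \<open>z\<close> this is the hypothesis \<open>eq\<close> with exp(i t h)
  expanded. The coefficients depend on \<open>z\<close> through z^2 + M^2 only, so both sides are
  entire and the identity theorem extends it.\<close>

private lemma fourier_laplace_evolution:
  "fourier_laplace e g q z
    = cos (of_real t * csqrt (z\<^sup>2 + (of_real M)\<^sup>2)) *s fourier_laplace e f q z
    + (\<i> * sinc_sqrt t (z\<^sup>2 + (of_real M)\<^sup>2)) *s h z (fourier_laplace e f q z)"
    (is "?L z = ?R z")
proof -
  have hf: "(\<lambda>z. fourier_laplace e f q z $ j) holomorphic_on UNIV" for j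
    by (rule holomorphic_fourier_laplace[OF e f])
  have w: "(\<lambda>z. z\<^sup>2 + (of_real M)\<^sup>2) holomorphic_on UNIV" by (intro holomorphic_intros)
  have c: "(\<lambda>z. cos (of_real t * csqrt (z\<^sup>2 + (of_real M)\<^sup>2))) holomorphic_on UNIV"
    using holomorphic_on_compose_gen[OF w holomorphic_cos_csqrt[of t]] by (simp add: o_def)
  have s: "(\<lambda>z. sinc_sqrt t (z\<^sup>2 + (of_real M)\<^sup>2)) holomorphic_on UNIV"
    using holomorphic_on_compose_gen[OF w holomorphic_sinc_sqrt[of t]] by (simp add: o_def)
  have real: "?L (of_real x) = ?R (of_real x)" for x
  proof -
    define p where "p = q + x *\<^sub>R e"
    have "p \<bullet> p = q \<bullet> q + x\<^sup>2"
      using e qe by (simp add: p_def inner_add_left inner_add_right inner_commute[of e q] norm_eq_1 power2_eq_square)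
    then have en: "(energy m p)\<^sup>2 = x\<^sup>2 + M\<^sup>2" using energy_square[OF D m, of p] M(2) by simp
    have pos: "energy m p > 0" by (rule energy_pos[OF D m])
    have "(complex_of_real x)\<^sup>2 + (of_real M)\<^sup>2 = of_real ((energy m p)\<^sup>2)" by (simp add: en)
    moreover have "csqrt (of_real ((energy m p)\<^sup>2)) = of_real (energy m p)" using pos by simp
    ultimately have cs: "csqrt ((complex_of_real x)\<^sup>2 + (of_real M)\<^sup>2) = of_real (energy m p)"
      and nz: "(complex_of_real x)\<^sup>2 + (of_real M)\<^sup>2 \<noteq> 0" using pos by auto
    have hp: "h (of_real x) u = of_real (energy m p) *s (unit_symbol \<alpha> \<beta> m p *v u)" for u
      unfolding unit_symbol_apply[OF D m] by (simp add: complex_momentum_def p_def)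
    have "?R (of_real x) = rot (t * energy m p) (unit_symbol \<alpha> \<beta> m p) (fourier_int f p)"
      using pos nz unfolding fourier_laplace_real hp
      by (simp add: cs sinc_sqrt_def rot_def p_def[symmetric] vector_smult_assoc cos_of_real sin_of_real
          flip: of_real_mult)
    then show ?thesis unfolding fourier_laplace_real by (simp add: eq p_def[symmetric])
  qed
  have "?L z $ j - ?R z $ j = 0" for j
  proof (rule analytic_continuation[where f="\<lambda>z. ?L z $ j - ?R z $ j" and S=UNIV and U="range of_real" and \<xi>=0])
    show "(\<lambda>z. ?L z $ j - ?R z $ j) holomorphic_on UNIV"
      unfolding vector_add_component vector_smult_component
      by (intro holomorphic_intros holomorphic_fourier_laplace[OF e g] holomorphic_dirac_op hf c s)
    show "(0::complex) islimpt range of_real"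
      unfolding islimpt_approachable
    proof (intro allI impI)
      fix r :: real assume "r > 0"
      then show "\<exists>x'\<in>range complex_of_real. x' \<noteq> 0 \<and> dist x' 0 < r"
        by (intro bexI[of _ "of_real (r / 2)"] rangeI) auto
    qed
    show "?L w $ j - ?R w $ j = 0" if "w \<in> range of_real" for w using that real by auto
  qed auto
  then show ?thesis by (simp add: vec_eq_iff)
qed

private lemma proj_evolution:
  assumes z: "norm z \<ge> 2 * M" and \<sigma>: "\<sigma> = 1 \<or> \<sigma> = - 1"
  shows "proj \<sigma> z (fourier_laplace e g q z) = exp (\<i> * of_real (\<sigma> * t) * eps z) *s proj \<sigma> z (fourier_laplace e f q z)"
proof -
  define E where "E = eps z"
  define w where "w = z\<^sup>2 + (of_real M)\<^sup>2"
  define G where "G = fourier_laplace e f q z"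
  define c s where "c = cos (of_real t * E)" and "s = sin (of_real t * E)"
  have E: "E \<noteq> 0" "w = E * E" using eps_nz[OF z] eps_square[OF z] by (simp_all add: E_def w_def power2_eq_square)
  \<comment> \<open>\<open>csqrt\<close> and the branch used here may differ in sign, but the cosine
    and the quotient sin(t E) / E are even in E.\<close>
  then have "csqrt w = E \<or> csqrt w = - E" by (metis power2_csqrt power2_eq_iff power2_eq_square)
  then have cs: "cos (of_real t * csqrt w) = c" "sinc_sqrt t w = s / E"
    using E by (auto simp: c_def s_def sinc_sqrt_def)
  have H: "fourier_laplace e g q z = c *s G + (\<i> * (s / E)) *s h z G"
    by (simp only: fourier_laplace_evolution cs G_def w_def[symmetric])
  have hH: "h z (fourier_laplace e g q z) = c *s h z G + (\<i> * (s / E)) *s (w *s G)"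
    by (simp add: H dirac_op_add dirac_op_smult h_square w_def)
  have ex: "exp (\<i> * of_real (\<sigma> * t) * E) = c + \<i> * of_real \<sigma> * s"
    using \<sigma> exp_Euler[of "of_real t * E"] exp_minus_Euler[of "of_real t * E"]
    by (auto simp: c_def s_def mult.assoc)
  have key: "c * x + \<i> * (s / E) * y + 1 / (of_real \<sigma> * E) * (c * y + \<i> * (s / E) * (w * x))
      = (c + \<i> * of_real \<sigma> * s) * (x + 1 / (of_real \<sigma> * E) * y)" for x y
    using \<sigma> E by (auto simp: field_simps)
  show ?thesis
    unfolding E_def[symmetric] G_def[symmetric] ex energy_projection_def hH vec_eq_iff
    by (simp only: H vector_add_component vector_smult_component key simp_thms)
qed

text \<open>As |eps - z| \<le> M, exchanging exp(i t eps) for exp(i t z) costs a factor bounded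
  uniformly on the half-plane; this makes each spectral component move with speed exactly 1 as far
  as support edges are concerned.\<close>

private lemma norm_exp_shift_le:
  assumes z: "norm z \<ge> 2 * M" and \<sigma>: "\<bar>\<sigma>\<bar> = 1"
  shows "norm (exp (\<i> * of_real (\<sigma> * t) * (z - eps z))) \<le> exp (\<bar>t\<bar> * M)"
    and "norm (exp (\<i> * of_real (\<sigma> * t) * (eps z - z))) \<le> exp (\<bar>t\<bar> * M)"
proof -
  have "norm (\<i> * of_real (\<sigma> * t) * (eps z - z)) \<le> \<bar>t\<bar> * M"
    using eps_diff[OF z] \<sigma> by (simp add: norm_mult abs_mult mult_left_mono)
  moreover have "norm (\<i> * of_real (\<sigma> * t) * (z - eps z)) = norm (\<i> * of_real (\<sigma> * t) * (eps z - z))"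
    by (simp only: norm_mult norm_minus_commute)
  ultimately show "norm (exp (\<i> * of_real (\<sigma> * t) * (z - eps z))) \<le> exp (\<bar>t\<bar> * M)"
    "norm (exp (\<i> * of_real (\<sigma> * t) * (eps z - z))) \<le> exp (\<bar>t\<bar> * M)"
    by (intro order_trans[OF norm_exp]; simp only: exp_le_cancel_iff)+
qed

text \<open>Forwards, each projection is bounded and the phase exp(i \<sigma> t eps) turns into a
  shift of \<open>a\<close> by \<sigma> t. Backwards, the phases are restored and the two components
  are added, giving twice the full transform.\<close>

lemma half_bounded_evolution_iff:
  "half_bounded (2 * M) (\<lambda>z. exp (\<i> * of_real a * z) *s fourier_laplace e g q z) \<longleftrightarrow>
    half_bounded (2 * M) (\<lambda>z. exp (\<i> * of_real (a + t) * z) *s proj 1 z (fourier_laplace e f q z)) \<and>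
    half_bounded (2 * M) (\<lambda>z. exp (\<i> * of_real (a - t) * z) *s proj (- 1) z (fourier_laplace e f q z))"
    (is "half_bounded _ ?H \<longleftrightarrow> half_bounded _ ?P \<and> half_bounded _ ?N")
proof -
  let ?K = "exp (\<bar>t\<bar> * M)"
  have key: "exp (\<i> * of_real (a + \<sigma> * t) * z) *s proj \<sigma> z (fourier_laplace e f q z)
      = exp (\<i> * of_real (\<sigma> * t) * (z - eps z)) *s (exp (\<i> * of_real a * z) *s proj \<sigma> z (fourier_laplace e g q z))"
    if "norm z \<ge> 2 * M" "\<sigma> = 1 \<or> \<sigma> = - 1" for z \<sigma>
    unfolding proj_evolution[OF that] vector_smult_assoc exp_add[symmetric]
    by (rule arg_cong2[where f = "\<lambda>c v. c *s v"]) (simp_all add: algebra_simps)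
  have half: "half_bounded (2 * M) (\<lambda>z. exp (\<i> * of_real (a + \<sigma> * t) * z) *s proj \<sigma> z (fourier_laplace e f q z))"
    if "half_bounded (2 * M) ?H" "\<sigma> = 1 \<or> \<sigma> = - 1" for \<sigma>
  proof (rule half_bounded_mono[OF that(1)])
    fix z assume "Im z \<le> - (2 * M)"
    then have z: "norm z \<ge> 2 * M" by (rule half_plane_norm)
    have \<sigma>: "\<bar>\<sigma>\<bar> = 1" using that(2) by auto
    have "norm (exp (\<i> * of_real (a + \<sigma> * t) * z) *s proj \<sigma> z (fourier_laplace e f q z))
        = norm (exp (\<i> * of_real (\<sigma> * t) * (z - eps z))) * norm (proj \<sigma> z (?H z))"
      by (simp only: key[OF z that(2)] norm_vector_smult proj_smult)
    also have "\<dots> \<le> ?K * (11 * norm (?H z))"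
      by (intro mult_mono norm_exp_shift_le(1)[OF z \<sigma>] norm_proj_le[OF z \<sigma>]) auto
    finally show "norm (exp (\<i> * of_real (a + \<sigma> * t) * z) *s proj \<sigma> z (fourier_laplace e f q z)) \<le> (?K * 11) * norm (?H z)"
      by simp
  qed simp
  have inv: "exp (\<i> * of_real a * z) *s proj \<sigma> z (fourier_laplace e g q z)
      = exp (\<i> * of_real (\<sigma> * t) * (eps z - z)) *s (exp (\<i> * of_real (a + \<sigma> * t) * z) *s proj \<sigma> z (fourier_laplace e f q z))"
    if "norm z \<ge> 2 * M" "\<sigma> = 1 \<or> \<sigma> = - 1" for z \<sigma>
    unfolding proj_evolution[OF that] vector_smult_assoc exp_add[symmetric]
    by (rule arg_cong2[where f = "\<lambda>c v. c *s v"]) (simp_all add: algebra_simps)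
  have recover: "half_bounded (2 * M) (\<lambda>z. exp (\<i> * of_real a * z) *s proj \<sigma> z (fourier_laplace e g q z))"
    if "half_bounded (2 * M) (\<lambda>z. exp (\<i> * of_real (a + \<sigma> * t) * z) *s proj \<sigma> z (fourier_laplace e f q z))"
      "\<sigma> = 1 \<or> \<sigma> = - 1" for \<sigma>
  proof (rule half_bounded_mono[OF that(1)])
    fix z assume "Im z \<le> - (2 * M)"
    then have z: "norm z \<ge> 2 * M" by (rule half_plane_norm)
    have \<sigma>: "\<bar>\<sigma>\<bar> = 1" using that(2) by auto
    show "norm (exp (\<i> * of_real a * z) *s proj \<sigma> z (fourier_laplace e g q z))
       \<le> ?K * norm (exp (\<i> * of_real (a + \<sigma> * t) * z) *s proj \<sigma> z (fourier_laplace e f q z))"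
      unfolding inv[OF z that(2)] norm_vector_smult[of "exp (\<i> * of_real (\<sigma> * t) * (eps z - z))"]
      by (intro mult_right_mono norm_exp_shift_le(2)[OF z \<sigma>]) auto
  qed simp
  have sum: "2 *\<^sub>R u = proj 1 z u + proj (- 1) z u" for z u
    by (simp add: energy_projection_def vec_eq_iff scaleR_complex_conv)
  show ?thesis
  proof (rule iffI)
    assume "half_bounded (2 * M) ?H"
    from half[OF this, of 1] half[OF this, of "- 1"]
    show "half_bounded (2 * M) ?P \<and> half_bounded (2 * M) ?N" by simp
  next
    assume *: "half_bounded (2 * M) ?P \<and> half_bounded (2 * M) ?N"
    have "half_bounded (2 * M) (\<lambda>z. exp (\<i> * of_real a * z) *s proj 1 z (fourier_laplace e g q z)
        + exp (\<i> * of_real a * z) *s proj (- 1) z (fourier_laplace e g q z))"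
      by (intro half_bounded_add recover) (use * in simp_all)
    then show "half_bounded (2 * M) ?H"
    proof (rule half_bounded_mono[where K = 1])
      fix z
      have "2 * norm (?H z) = norm (2 *\<^sub>R ?H z)" by simp
      also have "\<dots> = norm (exp (\<i> * of_real a * z) *s proj 1 z (fourier_laplace e g q z)
          + exp (\<i> * of_real a * z) *s proj (- 1) z (fourier_laplace e g q z))"
        by (simp only: sum[of _ z] proj_smult)
      finally show "norm (?H z) \<le> 1 * norm (exp (\<i> * of_real a * z) *s proj 1 z (fourier_laplace e g q z)
          + exp (\<i> * of_real a * z) *s proj (- 1) z (fourier_laplace e g q z))"
        using norm_ge_zero[of "?H z"] by linarith
    qed simp
  qed
qed

end

text \<open>Once the component vanishes in a half-plane, h G = - \<sigma> eps G there. Squaring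
  entry by entry removes the sign and the branch, and leaves an identity of entire functions that
  holds on the whole plane and contradicts the parity of the zero at i M unless G = 0.\<close>

lemma fourier_laplace_eq_0_of_unbounded_decay:
  assumes f: "f \<in> L2_ball R" and \<sigma>: "\<sigma> = 1 \<or> \<sigma> = - 1"
    and bd: "\<And>A. half_bounded (2 * M) (\<lambda>z. exp (\<i> * of_real A * z) *s proj \<sigma> z (fourier_laplace e f q z))"
  shows "fourier_laplace e f q z = 0"
proof -
  let ?G = "fourier_laplace e f q"
  have hG: "(\<lambda>z. ?G z $ j) holomorphic_on A" for j A
    using holomorphic_fourier_laplace[OF e f] by (rule holomorphic_on_subset) simp
  have P0: "proj \<sigma> z (?G z) $ j = 0" if z: "Im z < - (2 * M)" for z j
  proof (rule half_plane_superexponential_decay[where u = "\<lambda>z. proj \<sigma> z (?G z) $ j" and b = "3 / 2 * M" and c = "2 * M"])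
    \<comment> \<open>\<open>eps_nz\<close> requires |z| \<ge> 2 M, whereas the quotient by eps must
      be holomorphic on the larger half-plane.\<close>
    have "eps z \<noteq> 0" if "Im z < - (3 / 2 * M)" for z
    proof -
      have z: "norm z > M" using abs_Im_le_cmod[of z] that M(1) by linarith
      then have "z \<noteq> 0" using M(1) by auto
      have "norm ((of_real M)\<^sup>2 / z\<^sup>2) = (M / norm z)\<^sup>2" using M(1) by (simp add: norm_divide norm_power power_divide)
      also have "\<dots> < 1" using z M(1) by (simp add: power_less_one_iff divide_less_eq_1)
      finally have "1 + (of_real M)\<^sup>2 / z\<^sup>2 \<noteq> 0" by (auto simp: add_eq_0_iff)
      with \<open>z \<noteq> 0\<close> show ?thesis by (simp add: energy_branch_def)
    qed
    then show "(\<lambda>z. proj \<sigma> z (?G z) $ j) holomorphic_on {z. Im z < - (3 / 2 * M)}"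
      unfolding energy_projection_def vector_add_component vector_smult_component
      using \<sigma> by (intro holomorphic_intros hG holomorphic_dirac_op eps_holomorphic) auto
    show "3 / 2 * M < 2 * M" using M(1) by simp
    fix A
    obtain C where C: "\<And>z. Im z \<le> - (2 * M) \<Longrightarrow> norm (exp (\<i> * of_real A * z) *s proj \<sigma> z (?G z)) \<le> C"
      using bd[of A] by (auto simp: half_bounded_def)
    have "norm (exp (\<i> * of_real A * z) * proj \<sigma> z (?G z) $ j) \<le> C" if "Im z \<le> - (2 * M)" for z
      using order_trans[OF Finite_Cartesian_Product.norm_nth_le[of "exp (\<i> * of_real A * z) *s proj \<sigma> z (?G z)" j] C[OF that]] by simp
    then show "\<exists>C. \<forall>z. Im z \<le> - (2 * M) \<longrightarrow> norm (exp (\<i> * of_real A * z) * proj \<sigma> z (?G z) $ j) \<le> C" by blast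
  qed (rule z)
  have sq: "(h z (?G z) $ j)\<^sup>2 = (z\<^sup>2 + (of_real M)\<^sup>2) * (?G z $ j)\<^sup>2" for z j
  proof (rule analytic_continuation_open[where f = "\<lambda>z. (h z (?G z) $ j)\<^sup>2" and s = "{z. Im z < - (2 * M)}" and s' = UNIV])
    show "open {z. Im z < - (2 * M)}" by (rule open_halfspace_Im_lt)
    have "Complex 0 (- (2 * M) - 1) \<in> {z. Im z < - (2 * M)}" by simp
    then show "{z. Im z < - (2 * M)} \<noteq> {}" by blast
    show "(\<lambda>z. (h z (?G z) $ j)\<^sup>2) holomorphic_on UNIV"
      "(\<lambda>z. (z\<^sup>2 + (of_real M)\<^sup>2) * (?G z $ j)\<^sup>2) holomorphic_on UNIV"
      by (intro holomorphic_intros hG holomorphic_dirac_op)+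
    fix z assume "z \<in> {z. Im z < - (2 * M)}"
    then have z: "Im z < - (2 * M)" by simp
    then have z': "norm z \<ge> 2 * M" by (intro half_plane_norm) simp
    have "h z (?G z) $ j = - (of_real \<sigma> * eps z) * ?G z $ j"
      using P0[OF z, of j] eps_nz[OF z'] \<sigma> by (auto simp: energy_projection_def field_simps add_eq_0_iff2)
    then have "(h z (?G z) $ j)\<^sup>2 = (eps z)\<^sup>2 * (?G z $ j)\<^sup>2" using \<sigma> by (auto simp: power_mult_distrib)
    then show "(h z (?G z) $ j)\<^sup>2 = (z\<^sup>2 + (of_real M)\<^sup>2) * (?G z $ j)\<^sup>2" by (simp only: eps_square[OF z'])
  qed auto
  have "?G z $ j = 0" for j
    by (rule square_eq_quadratic_times_square_imp_0[OF holomorphic_dirac_op[OF hG] hG M(1) sq])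
  then show ?thesis by (simp add: vec_eq_iff)
qed

end

section \<open>Support edges\<close>

lemma L2_ball_indicator:
  assumes f: "f \<in> L2_ball R" and [measurable]: "S \<in> sets borel"
  shows "(\<lambda>x. indicator S x *\<^sub>R f x) \<in> L2_ball R"
  unfolding L2_ball_def
proof (intro CollectI conjI)
  have [measurable]: "f \<in> borel_measurable borel" and f2: "integrable lborel (\<lambda>x. (norm (f x))\<^sup>2)"
    using f by (auto simp: L2_ball_def)
  show "(\<lambda>x. indicator S x *\<^sub>R f x) \<in> borel_measurable borel" by measurable
  show "integrable lborel (\<lambda>x. (norm (indicator S x *\<^sub>R f x))\<^sup>2)"
    by (rule Bochner_Integration.integrable_bound[OF f2]) (auto simp: indicator_def intro!: AE_I2)
  show "\<forall>x. R < norm x \<longrightarrow> indicator S x *\<^sub>R f x = 0" using f by (simp add: L2_ball_def)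
qed

text \<open>The part of \<open>f\<close> on \<open>x \<bullet> e < a\<close> has a Fourier-Laplace transform that, after multiplication by
  \<open>exp (i a z)\<close>, is bounded in the upper half-plane anyway. If the lower half-plane bound holds for \<open>f\<close>,
  then it is a bounded entire function tending to \<open>0\<close> along the positive imaginary axis.\<close>

lemma vanishes_on_half_space_iff_half_bounded:
  fixes e :: "real ^ 3" and f :: wavefunction
  assumes e: "norm e = 1" and f: "f \<in> L2_ball R" and c: "\<And>q. c q \<ge> 0"
  shows "(AE x in lebesgue. x \<bullet> e \<le> a \<longrightarrow> f x = 0) \<longleftrightarrow>
    (\<forall>q. q \<bullet> e = 0 \<longrightarrow> half_bounded (c q) (\<lambda>z. exp (\<i> * of_real a * z) *s fourier_laplace e f q z))"
proof
  assume "AE x in lebesgue. x \<bullet> e \<le> a \<longrightarrow> f x = 0"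
  then have ae: "AE x in lborel. x \<bullet> e \<le> a \<longrightarrow> f x = 0" by (simp add: AE_completion_iff)
  show "\<forall>q. q \<bullet> e = 0 \<longrightarrow> half_bounded (c q) (\<lambda>z. exp (\<i> * of_real a * z) *s fourier_laplace e f q z)"
  proof (intro allI impI)
    fix q
    have "norm (exp (\<i> * of_real a * z) *s fourier_laplace e f q z) \<le> exp 0 * (LINT x|lborel. norm (f x))"
      if "Im z \<le> - c q" for z
    proof (rule norm_fourier_laplace_le[OF e f])
      have "Im z \<le> 0" using that c[of q] by simp
      with ae show "AE x in lborel. f x \<noteq> 0 \<longrightarrow> Im z * (x \<bullet> e - a) \<le> 0"
        by (elim eventually_mono) (auto intro!: mult_nonpos_nonneg)
    qed
    then show "half_bounded (c q) (\<lambda>z. exp (\<i> * of_real a * z) *s fourier_laplace e f q z)"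
      unfolding half_bounded_def by blast
  qed
next
  assume bd: "\<forall>q. q \<bullet> e = 0 \<longrightarrow> half_bounded (c q) (\<lambda>z. exp (\<i> * of_real a * z) *s fourier_laplace e f q z)"
  define f1 where "f1 x = indicator {x. x \<bullet> e < a} x *\<^sub>R f x" for x
  define f2 where "f2 x = indicator {x. a \<le> x \<bullet> e} x *\<^sub>R f x" for x
  have f1: "f1 \<in> L2_ball R" unfolding f1_def[abs_def] by (rule L2_ball_indicator[OF f]) measurable
  have f2: "f2 \<in> L2_ball R" unfolding f2_def[abs_def] by (rule L2_ball_indicator[OF f]) measurable
  have [measurable]: "f1 \<in> borel_measurable borel" using f1 by (simp add: L2_ball_def)
  have n1: "x \<bullet> e < a" if "f1 x \<noteq> 0" for x using that by (auto simp: f1_def indicator_def split: if_splits)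
  have n2: "a \<le> x \<bullet> e" if "f2 x \<noteq> 0" for x using that by (auto simp: f2_def indicator_def split: if_splits)
  have sum: "fourier_laplace e f q z = fourier_laplace e f1 q z + fourier_laplace e f2 q z" for q z
  proof -
    have "f x = f1 x + f2 x" for x by (simp add: f1_def f2_def indicator_def)
    then have "fourier_laplace e f q z = (LINT x|lborel. exp (- \<i> * (of_real (q \<bullet> x) + z * of_real (x \<bullet> e))) *s f1 x
        + exp (- \<i> * (of_real (q \<bullet> x) + z * of_real (x \<bullet> e))) *s f2 x)"
      unfolding fourier_laplace_def by (simp only: vector_add_ldistrib)
    also have "\<dots> = fourier_laplace e f1 q z + fourier_laplace e f2 q z"
      unfolding fourier_laplace_def
      by (intro Bochner_Integration.integral_add fourier_laplace_integrable[OF e f1] fourier_laplace_integrable[OF e f2])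
    finally show ?thesis .
  qed
  let ?I1 = "LINT x|lborel. norm (f1 x)" and ?I2 = "LINT x|lborel. norm (f2 x)"
  have 0: "fourier_laplace e f1 q z = 0" if qe: "q \<bullet> e = 0" for q z
  proof -
    define F where "F z = exp (\<i> * of_real a * z) *s fourier_laplace e f1 q z" for z
    obtain C where C: "\<And>z. Im z \<le> - c q \<Longrightarrow> norm (exp (\<i> * of_real a * z) *s fourier_laplace e f q z) \<le> C"
      using bd qe by (auto simp: half_bounded_def)
    have up: "norm (F z) \<le> ?I1" if "Im z \<ge> 0" for z
    proof -
      have "norm (F z) \<le> exp 0 * ?I1" unfolding F_def
        by (rule norm_fourier_laplace_le[OF e f1])
           (use n1 that in \<open>auto intro!: AE_I2 mult_nonneg_nonpos simp: less_imp_le\<close>)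
      then show ?thesis by simp
    qed
    \<comment> \<open>On this strip the bounded support alone suffices, as |x . e - a| \<le> |a| +
      R; hence the depth \<open>c q\<close> at which the hypothesis sets in is arbitrary.\<close>
    have mid: "norm (F z) \<le> exp (c q * (\<bar>a\<bar> + R)) * ?I1" if z: "- c q \<le> Im z" "Im z \<le> 0" for z
      unfolding F_def
    proof (rule norm_fourier_laplace_le[OF e f1], intro AE_I2 impI)
      fix x assume "f1 x \<noteq> 0"
      then have x: "norm x \<le> R" "x \<bullet> e < a" using f1 n1 by (auto simp: L2_ball_def not_less[symmetric])
      have "\<bar>x \<bullet> e\<bar> \<le> R" using Cauchy_Schwarz_ineq2[of x e] e x(1) by simp
      then have "a - x \<bullet> e \<le> \<bar>a\<bar> + R" by linarith
      then have "(- Im z) * (a - x \<bullet> e) \<le> c q * (\<bar>a\<bar> + R)"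
        using z x(2) c[of q] by (intro mult_mono) auto
      then show "Im z * (x \<bullet> e - a) \<le> c q * (\<bar>a\<bar> + R)" by (simp add: algebra_simps)
    qed
    have low: "norm (F z) \<le> C + ?I2" if z: "Im z \<le> - c q" for z
    proof -
      have "Im z \<le> 0" using z c[of q] by simp
      then have "norm (exp (\<i> * of_real a * z) *s fourier_laplace e f2 q z) \<le> exp 0 * ?I2"
        by (intro norm_fourier_laplace_le[OF e f2]) (use n2 in \<open>auto intro!: AE_I2 mult_nonpos_nonneg\<close>)
      moreover have "F z = exp (\<i> * of_real a * z) *s fourier_laplace e f q z - exp (\<i> * of_real a * z) *s fourier_laplace e f2 q z"
        by (simp add: F_def sum vector_add_ldistrib)
      ultimately show ?thesis
        using norm_triangle_ineq4[of "exp (\<i> * of_real a * z) *s fourier_laplace e f q z" "exp (\<i> * of_real a * z) *s fourier_laplace e f2 q z"]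
          C[OF z] by simp
    qed
    define B where "B = max ?I1 (max (exp (c q * (\<bar>a\<bar> + R)) * ?I1) (C + ?I2))"
    have B: "norm (F z) \<le> B" for z
      using up[of z] mid[of z] low[of z] unfolding B_def by (cases "Im z \<ge> 0"; cases "Im z \<le> - c q") auto
    have "F z $ j = 0" for j
    proof -
      have hol: "(\<lambda>z. F z $ j) holomorphic_on UNIV"
        unfolding F_def vector_smult_component
        by (intro holomorphic_intros holomorphic_fourier_laplace[OF e f1])
      have "bounded (range (\<lambda>z. F z $ j))"
        unfolding bounded_iff using order_trans[OF Finite_Cartesian_Product.norm_nth_le B] by blast
      from Liouville_theorem[OF hol this] obtain k where k: "\<And>z. F z $ j = k"
        by (auto simp: constant_on_def)
      \<comment> \<open>Evaluates the Liouville constant at z = i n: \<open>f1\<close> lives where x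
        . e < a, so the integrand decays pointwise and the constant is 0.\<close>
      have "(\<lambda>n. LINT x|lborel. exp (real n * (x \<bullet> e - a)) * norm (f1 x)) \<longlonglongrightarrow> (LINT x|(lborel :: (real ^ 3) measure). (0::real))"
      proof (rule integral_dominated_convergence[where w = "\<lambda>x. norm (f1 x)"])
        show "integrable lborel (\<lambda>x. norm (f1 x))" using L2_ball_integrable[OF f1] by simp
        show "AE x in lborel. norm (exp (real n * (x \<bullet> e - a)) * norm (f1 x)) \<le> norm (f1 x)" for n
        proof (intro AE_I2)
          fix x
          show "norm (exp (real n * (x \<bullet> e - a)) * norm (f1 x)) \<le> norm (f1 x)"
          proof (cases "f1 x = 0")
            case False
            have "real n * (x \<bullet> e - a) \<le> 0" using n1[OF False] by (intro mult_nonneg_nonpos) auto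
            then show ?thesis by (simp add: abs_mult mult_left_le_one_le)
          qed simp
        qed
        show "AE x in lborel. (\<lambda>n. exp (real n * (x \<bullet> e - a)) * norm (f1 x)) \<longlonglongrightarrow> 0"
        proof (intro AE_I2)
          fix x
          show "(\<lambda>n. exp (real n * (x \<bullet> e - a)) * norm (f1 x)) \<longlonglongrightarrow> 0"
          proof (cases "f1 x = 0")
            case False
            then have "(\<lambda>n. exp (x \<bullet> e - a) ^ n) \<longlonglongrightarrow> 0" using n1[OF False] by (intro LIMSEQ_realpow_zero) auto
            then have "(\<lambda>n. exp (real n * (x \<bullet> e - a))) \<longlonglongrightarrow> 0" by (simp add: exp_of_nat_mult)
            then show ?thesis by (rule tendsto_mult_left_zero)
          qed simp
        qed
      qed measurable
      moreover have "norm k \<le> (LINT x|lborel. exp (real n * (x \<bullet> e - a)) * norm (f1 x))" for n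
      proof -
        have "norm k \<le> norm (F (\<i> * of_real (real n)))"
          using Finite_Cartesian_Product.norm_nth_le[of "F (\<i> * of_real (real n))" j] by (simp only: k)
        also have "\<dots> \<le> (LINT x|lborel. exp (Im (\<i> * of_real (real n)) * (x \<bullet> e - a)) * norm (f1 x))"
          unfolding F_def by (rule norm_fourier_laplace_le_integral[OF e f1])
        finally show ?thesis by simp
      qed
      ultimately have "norm k \<le> (LINT x|(lborel :: (real ^ 3) measure). (0::real))" by (intro LIMSEQ_le_const) auto
      then show ?thesis by (simp add: k)
    qed
    then show ?thesis by (simp add: F_def vec_eq_iff)
  qed
  have "fourier_int f1 p = 0" for p
  proof -
    \<comment> \<open>Every real momentum lies on one of the lines: take \<open>q\<close> as the
      part of \<open>p\<close> orthogonal to \<open>e\<close> and z = p . e.\<close>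
    have "(p - (p \<bullet> e) *\<^sub>R e) \<bullet> e = 0" using e by (simp add: inner_diff_left norm_eq_1)
    from 0[OF this, of "of_real (p \<bullet> e)"] show ?thesis by (simp add: fourier_laplace_real)
  qed
  then have "AE x in lborel. f1 x = 0" by (rule fourier_int_eq_0_imp_AE[OF L2_ball_compact[OF f1]])
  then have "AE x in lebesgue. f1 x = 0" by (simp add: AE_completion_iff)
  moreover have "AE x in lebesgue. x \<bullet> e \<noteq> a"
  proof -
    have "negligible {x. e \<bullet> x = a}" using e by (intro negligible_hyperplane) auto
    then have "{x. e \<bullet> x = a} \<in> null_sets lebesgue" by (simp add: negligible_iff_null_sets)
    then show ?thesis by (rule AE_I') (auto simp: inner_commute)
  qed
  ultimately show "AE x in lebesgue. x \<bullet> e \<le> a \<longrightarrow> f x = 0"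
    by eventually_elim (auto simp: f1_def indicator_def split: if_splits)
qed

text \<open>Whether the half-lines \<open>A\<close> and \<open>B\<close> contain their end points is
  irrelevant, since \<open>E\<close> is located by reals strictly on either side. Properness of both
  sets keeps the suprema finite.\<close>

lemma ereal_eq_min_of_lower_sets:
  fixes A B :: "real set" and E :: ereal and t :: real
  assumes A: "A \<noteq> {}" "A \<noteq> UNIV" "\<And>a b. a \<in> A \<Longrightarrow> b \<le> a \<Longrightarrow> b \<in> A"
    and B: "B \<noteq> {}" "B \<noteq> UNIV" "\<And>a b. a \<in> B \<Longrightarrow> b \<le> a \<Longrightarrow> b \<in> B"
    and E: "\<And>a. ereal a \<le> E \<longleftrightarrow> a + t \<in> A \<and> a - t \<in> B"
  shows "E = ereal (min (Sup A - t) (Sup B + t))"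
proof -
  have bdd: "bdd_above S" if "S \<noteq> UNIV" "\<And>a b. a \<in> S \<Longrightarrow> b \<le> a \<Longrightarrow> b \<in> S" for S :: "real set"
  proof -
    obtain x where "x \<notin> S" using \<open>S \<noteq> UNIV\<close> by auto
    then have "y \<le> x" if "y \<in> S" for y using that \<open>\<And>a b. a \<in> S \<Longrightarrow> b \<le> a \<Longrightarrow> b \<in> S\<close>[of y x] by force
    then show ?thesis by (rule bdd_aboveI)
  qed
  have mem: "x \<in> S" if S: "x < Sup S" "S \<noteq> {}" "\<And>a b. a \<in> S \<Longrightarrow> b \<le> a \<Longrightarrow> b \<in> S" for S :: "real set" and x
  proof -
    obtain y where "y \<in> S" "x < y" using less_cSupD[OF S(2,1)] by blast
    then show ?thesis using S(3)[of y x] by simp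
  qed
  have bA: "bdd_above A" by (rule bdd[OF A(2)]) (erule A(3))
  have bB: "bdd_above B" by (rule bdd[OF B(2)]) (erule B(3))
  show ?thesis
  proof (rule antisym)
    show "E \<le> ereal (min (Sup A - t) (Sup B + t))"
    proof (rule ccontr)
      assume "\<not> ?thesis"
      then have "ereal (min (Sup A - t) (Sup B + t)) < E" by (simp only: not_le)
      then obtain a where a: "ereal (min (Sup A - t) (Sup B + t)) < ereal a" "ereal a < E"
        using ereal_dense2 by blast
      have "ereal a \<le> E" using a(2) by (rule less_imp_le)
      then have "a + t \<in> A" "a - t \<in> B" using E[of a] by blast+
      then have "a + t \<le> Sup A" "a - t \<le> Sup B" using bA bB by (blast intro: cSup_upper)+
      moreover have "min (Sup A - t) (Sup B + t) < a" using a(1) by (simp only: less_ereal.simps)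
      ultimately show False by linarith
    qed
    show "ereal (min (Sup A - t) (Sup B + t)) \<le> E"
    proof (rule ccontr)
      assume "\<not> ?thesis"
      then have "E < ereal (min (Sup A - t) (Sup B + t))" by (simp only: not_le)
      then obtain a where a: "E < ereal a" "ereal a < ereal (min (Sup A - t) (Sup B + t))"
        using ereal_dense2 by blast
      then have "a < min (Sup A - t) (Sup B + t)" by (simp only: less_ereal.simps)
      then have "a + t < Sup A" "a - t < Sup B" by linarith+
      then have "a + t \<in> A" "a - t \<in> B"
        using mem[of "a + t" A] mem[of "a - t" B] A(1,3) B(1,3) by blast+
      then have "ereal a \<le> E" using E[of a] by blast
      with a(1) show False using leD by blast
    qed
  qed
qed

text \<open>\<open>a\<close> and \<open>b\<close> are the suprema of the exponents admissible for
  the two spectral components of \<open>f\<close>. They are computed at time 0, before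
  \<open>t\<close> and \<open>g\<close> are chosen.\<close>

lemma support_edge_evolution:
  fixes f :: wavefunction
  assumes D: "dirac_matrices \<alpha> \<beta>" and m: "m > 0" and e: "norm e = 1" and f: "f \<in> L2_ball R"
    and nz: "\<not> (AE x in lebesgue. f x = 0)"
  shows "\<exists>a b. \<forall>t g R'. g \<in> L2_ball R' \<longrightarrow>
    (\<forall>p. fourier_int g p = rot (t * energy m p) (unit_symbol \<alpha> \<beta> m p) (fourier_int f p)) \<longrightarrow>
    support_edge e g = ereal (min (a - t) (b + t))"
proof -
  define T where "T \<sigma> = {A. \<forall>q. q \<bullet> e = 0 \<longrightarrow> half_bounded (2 * transverse_mass m q)
     (\<lambda>z. exp (\<i> * of_real A * z) *s energy_projection \<alpha> \<beta> m e q \<sigma> z (fourier_laplace e f q z))}" for \<sigma>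
  have e0: "e \<noteq> 0" using e by auto
  have tm: "2 * transverse_mass m q \<ge> 0" for q by (simp add: transverse_mass_def)
  have edge: "ereal a \<le> support_edge e g \<longleftrightarrow> a + t \<in> T 1 \<and> a - t \<in> T (- 1)"
    if g: "g \<in> L2_ball R'" and eq: "\<And>p. fourier_int g p = rot (t * energy m p) (unit_symbol \<alpha> \<beta> m p) (fourier_int f p)"
    for g R' t a
  proof -
    have "ereal a \<le> support_edge e g \<longleftrightarrow> (AE x in lebesgue. x \<bullet> e \<le> a \<longrightarrow> g x = 0)"
      using support_edge_ge_iff[OF e0, of "ereal a" g] by simp
    also have "\<dots> \<longleftrightarrow> (\<forall>q. q \<bullet> e = 0 \<longrightarrow> half_bounded (2 * transverse_mass m q) (\<lambda>z. exp (\<i> * of_real a * z) *s fourier_laplace e g q z))"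
      by (rule vanishes_on_half_space_iff_half_bounded[OF e g tm])
    also have "\<dots> \<longleftrightarrow> a + t \<in> T 1 \<and> a - t \<in> T (- 1)"
      unfolding T_def using half_bounded_evolution_iff[OF D m e _ f g eq, of _ a] by blast
    finally show ?thesis .
  qed
  \<comment> \<open>For Im z \<le> 0 the modulus exp(- a Im z) of exp(i a z) increases with
    \<open>a\<close>.\<close>
  have lower: "b \<in> T \<sigma>" if "a \<in> T \<sigma>" "b \<le> a" for a b \<sigma>
    unfolding T_def
  proof (intro CollectI allI impI)
    fix q assume "q \<bullet> e = 0"
    then have "half_bounded (2 * transverse_mass m q)
     (\<lambda>z. exp (\<i> * of_real a * z) *s energy_projection \<alpha> \<beta> m e q \<sigma> z (fourier_laplace e f q z))"
      using that(1) by (simp add: T_def)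
    then show "half_bounded (2 * transverse_mass m q)
     (\<lambda>z. exp (\<i> * of_real b * z) *s energy_projection \<alpha> \<beta> m e q \<sigma> z (fourier_laplace e f q z))"
    proof (rule half_bounded_mono[where K = 1])
      fix z assume "Im z \<le> - (2 * transverse_mass m q)"
      then have "Im z \<le> 0" using tm[of q] by linarith
      then have "exp (- b * Im z) \<le> exp (- a * Im z)" using that(2) by (simp add: mult_right_mono_neg)
      then show "norm (exp (\<i> * of_real b * z) *s energy_projection \<alpha> \<beta> m e q \<sigma> z (fourier_laplace e f q z))
        \<le> 1 * norm (exp (\<i> * of_real a * z) *s energy_projection \<alpha> \<beta> m e q \<sigma> z (fourier_laplace e f q z))"
        by (simp only: norm_vector_smult norm_exp_ii mult_1 mult_right_mono norm_ge_zero)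
    qed simp
  qed
  have proper: "T \<sigma> \<noteq> UNIV" if \<sigma>: "\<sigma> = 1 \<or> \<sigma> = - 1" for \<sigma>
  proof
    assume "T \<sigma> = UNIV"
    then have T: "half_bounded (2 * transverse_mass m q)
     (\<lambda>z. exp (\<i> * of_real A * z) *s energy_projection \<alpha> \<beta> m e q \<sigma> z (fourier_laplace e f q z))"
      if "q \<bullet> e = 0" for A q using that by (auto simp: T_def)
    have "fourier_int f p = 0" for p
    proof -
      have q: "(p - (p \<bullet> e) *\<^sub>R e) \<bullet> e = 0" using e by (simp add: inner_diff_left norm_eq_1)
      have "fourier_laplace e f (p - (p \<bullet> e) *\<^sub>R e) (of_real (p \<bullet> e)) = 0"
        by (rule fourier_laplace_eq_0_of_unbounded_decay[OF D m e q f \<sigma> T[OF q]])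
      then show ?thesis by (simp add: fourier_laplace_real)
    qed
    then have "AE x in lborel. f x = 0" by (rule fourier_int_eq_0_imp_AE[OF L2_ball_compact[OF f]])
    with nz show False by (simp add: AE_completion_iff)
  qed
  \<comment> \<open>Nonemptiness of both sets, from \<open>edge\<close> at t = 0 with
    \<open>g\<close> = \<open>f\<close>. Subtracting 1 gives the strict inequality |x| > R that
    \<open>L2_ball\<close> asks for.\<close>
  have "ereal (- R - 1) \<le> support_edge e f"
  proof -
    have "f x = 0" if "x \<bullet> e \<le> - R - 1" for x
    proof -
      have "\<bar>x \<bullet> e\<bar> \<le> norm x" using Cauchy_Schwarz_ineq2[of x e] e by simp
      then have "norm x > R" using that by linarith
      then show ?thesis using f by (simp add: L2_ball_def)
    qed
    then show ?thesis using support_edge_ge_iff[OF e0, of "ereal (- R - 1)" f] by simp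
  qed
  moreover have "fourier_int f p = rot (0 * energy m p) (unit_symbol \<alpha> \<beta> m p) (fourier_int f p)" for p
    by (simp add: rot_0)
  ultimately have ne: "T 1 \<noteq> {}" "T (- 1) \<noteq> {}"
    using edge[OF f, of 0 "- R - 1"] by blast+
  have "support_edge e g = ereal (min (Sup (T 1) - t) (Sup (T (- 1)) + t))"
    if g: "g \<in> L2_ball R'" and eq: "\<And>p. fourier_int g p = rot (t * energy m p) (unit_symbol \<alpha> \<beta> m p) (fourier_int f p)"
    for g R' t
  proof (rule ereal_eq_min_of_lower_sets[OF ne(1) _ _ ne(2) _ _ edge[OF g eq]])
    show "T 1 \<noteq> UNIV" "T (- 1) \<noteq> UNIV" by (rule proper, simp)+
  qed (erule lower, assumption)+
  then show ?thesis by blast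
qed

section \<open>The tent-shaped graph of the support edge over time\<close>

theorem mainTheorem1:
  fixes \<alpha> :: "3 \<Rightarrow> complex ^ 4 ^ 4" and \<beta> :: "complex ^ 4 ^ 4" and m :: real
    and \<psi> :: "real ^ 3 \<Rightarrow> complex ^ 4" and \<Delta> :: "(real ^ 3) set"
  assumes "m > 0" and "dirac_matrices \<alpha> \<beta>"
    and "\<psi> \<in> L2" and "\<not> (AE x in lebesgue. \<psi> x = 0)"
    and "\<Delta> \<in> sets lebesgue" and "bounded \<Delta>" and "localized_in \<psi> \<Delta>"
  shows "\<forall>e :: real ^ 3. norm e = 1 \<longrightarrow>
    (\<exists>!s :: real. \<forall>t. support_edge e (dirac_evolution \<alpha> \<beta> m t \<psi>)
        = support_edge e \<psi> + ereal \<bar>s\<bar> - ereal \<bar>t - s\<bar>) \<and>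
    (\<forall>s :: real. (\<forall>t. support_edge e (dirac_evolution \<alpha> \<beta> m t \<psi>)
        = support_edge e \<psi> + ereal \<bar>s\<bar> - ereal \<bar>t - s\<bar>) \<longrightarrow>
      support_edge e (dirac_evolution \<alpha> \<beta> m s \<psi>) = support_edge e \<psi> + ereal \<bar>s\<bar> \<and>
      (\<forall>t. support_edge e (dirac_evolution \<alpha> \<beta> m t \<psi>)
         \<le> support_edge e (dirac_evolution \<alpha> \<beta> m s \<psi>)))"
proof (intro allI impI)
  fix e :: "real ^ 3" assume e: "norm e = 1"
  note m = assms(1) and D = assms(2)
  obtain h where h: "h \<in> borel_measurable borel" "AE x in lebesgue. \<psi> x = h x" "integrable lborel (\<lambda>x. (norm (h x))\<^sup>2)"
    using L2_representative[OF assms(3)] .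
  obtain R where "\<And>x. x \<in> \<Delta> \<Longrightarrow> norm x \<le> R" using assms(6) unfolding bounded_iff by blast
  then have R: "\<Delta> \<subseteq> cball 0 R" by auto
  \<comment> \<open>A Borel representative that vanishes at every point outside the ball, as
    \<open>L2_ball\<close> demands; boundedness of \<open>\<Delta>\<close> and localization make it
    equal to \<open>\<psi>\<close> almost everywhere.\<close>
  define f where "f = truncate_ball R h"
  have f: "f \<in> L2_ball R"
    using truncate_ball_compact_L2[OF h(1,3), of R] by (auto simp: f_def L2_ball_def compact_L2_def truncate_ball_def)
  have ae: "AE x in lebesgue. \<psi> x = f x"
    using h(2) assms(7)[unfolded localized_in_def]
  proof eventually_elim
    case (elim x)
    show ?case
    proof (cases "x \<in> cball 0 R")
      case True
      then show ?thesis using elim(1) by (simp add: f_def truncate_ball_def)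
    next
      case False
      then have "indicator \<Delta> x = (0 :: real)" using R by (auto simp: indicator_def)
      with elim(2) have "\<psi> x = 0" by simp
      with False show ?thesis by (simp add: f_def truncate_ball_def)
    qed
  qed
  have nz: "\<not> (AE x in lebesgue. f x = 0)"
  proof
    assume "AE x in lebesgue. f x = 0"
    with ae have "AE x in lebesgue. \<psi> x = 0" by eventually_elim simp
    with assms(4) show False by simp
  qed
  obtain a b where ab: "\<And>t g R'. g \<in> L2_ball R' \<Longrightarrow>
    (\<And>p. fourier_int g p = rot (t * energy m p) (unit_symbol \<alpha> \<beta> m p) (fourier_int f p)) \<Longrightarrow>
    support_edge e g = ereal (min (a - t) (b + t))"
    using support_edge_evolution[OF D m e f nz] by metis
  define c where "c = min a b"
  have "support_edge e f = ereal (min (a - 0) (b + 0))" by (rule ab[OF f]) (simp add: rot_0)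
  then have E0: "support_edge e \<psi> = ereal c"
    by (simp add: c_def support_edge_cong[OF ae])
  have Et: "support_edge e (dirac_evolution \<alpha> \<beta> m t \<psi>) = ereal (min (a - t) (b + t))" for t
  proof -
    obtain g where g: "g \<in> L2_ball (R + 3 * \<bar>t\<bar>)"
      "\<And>p. fourier_int g p = rot (t * energy m p) (unit_symbol \<alpha> \<beta> m p) (fourier_int f p)"
      using dirac_evolution_realization[OF D m f, of t] by blast
    have "AE x in lebesgue. dirac_evolution \<alpha> \<beta> m t \<psi> x = g x"
      unfolding dirac_evolution_def
      by (rule fourier_multiplier_eqI[OF assms(3) L2_ball_compact[OF f] ae L2_ball_compact[OF g(1)]])
         (simp only: g(2) mat_exp_symbol[OF D m])
    then show ?thesis using ab[OF g] support_edge_cong by metis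
  qed
  \<comment> \<open>The time at which a - t and b + t cross, where their minimum peaks at (a + b) /
    2 = c + |s|.\<close>
  define s where "s = (a - b) / 2"
  have min_eq: "min (a - t) (b + t) = c + \<bar>s\<bar> - \<bar>t - s\<bar>" for t
    unfolding s_def c_def by (auto simp: min_def abs_if field_simps)
  have iff: "support_edge e (dirac_evolution \<alpha> \<beta> m t \<psi>) = support_edge e \<psi> + ereal \<bar>r\<bar> - ereal \<bar>t - r\<bar>
      \<longleftrightarrow> \<bar>s\<bar> - \<bar>t - s\<bar> = \<bar>r\<bar> - \<bar>t - r\<bar>" for t r
    unfolding Et E0 min_eq by auto
  show "(\<exists>!s :: real. \<forall>t. support_edge e (dirac_evolution \<alpha> \<beta> m t \<psi>)
        = support_edge e \<psi> + ereal \<bar>s\<bar> - ereal \<bar>t - s\<bar>) \<and>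
    (\<forall>s :: real. (\<forall>t. support_edge e (dirac_evolution \<alpha> \<beta> m t \<psi>)
        = support_edge e \<psi> + ereal \<bar>s\<bar> - ereal \<bar>t - s\<bar>) \<longrightarrow>
      support_edge e (dirac_evolution \<alpha> \<beta> m s \<psi>) = support_edge e \<psi> + ereal \<bar>s\<bar> \<and>
      (\<forall>t. support_edge e (dirac_evolution \<alpha> \<beta> m t \<psi>)
         \<le> support_edge e (dirac_evolution \<alpha> \<beta> m s \<psi>)))"
  proof (intro conjI allI impI)
    show "\<exists>!r. \<forall>t. support_edge e (dirac_evolution \<alpha> \<beta> m t \<psi>) = support_edge e \<psi> + ereal \<bar>r\<bar> - ereal \<bar>t - r\<bar>"
      unfolding iff
    proof (rule ex1I[of _ s])
      fix r assume r: "\<forall>t. \<bar>s\<bar> - \<bar>t - s\<bar> = \<bar>r\<bar> - \<bar>t - r\<bar>"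
      \<comment> \<open>The two instances read |s| = |r| - |s - r| and |r| = |s| - |r - s|; adding
        them gives |s - r| = 0.\<close>
      show "r = s" using r[rule_format, of s] r[rule_format, of r] by simp
    qed simp
  next
    fix r assume r: "\<forall>t. support_edge e (dirac_evolution \<alpha> \<beta> m t \<psi>) = support_edge e \<psi> + ereal \<bar>r\<bar> - ereal \<bar>t - r\<bar>"
    show r': "support_edge e (dirac_evolution \<alpha> \<beta> m r \<psi>) = support_edge e \<psi> + ereal \<bar>r\<bar>"
      using r[rule_format, of r] by (simp add: E0)
    show "support_edge e (dirac_evolution \<alpha> \<beta> m t \<psi>) \<le> support_edge e (dirac_evolution \<alpha> \<beta> m r \<psi>)" for t
      unfolding r' r[rule_format, of t] by (simp add: E0)
  qed
qed

end
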